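(* Let $(X,d)$ be a proper geodesic Gromov hyperbolic metric space, let $f\colon X\to X$ be a non-expanding self-map, and let $p\in X$. Let $(x_n)_{n\ge0}$ be an escaping backward orbit of $f$ with bounded step. Then the following are equivalent: (1) $b(x_n)>0$; (2) $(x_n)$ is a discrete quasi-geodesic ray; (3) $(x_n)$ converges to a boundary regular fixed point $\eta$ inside a geodesic region with vertex $\eta$; (4) $(x_n)$ converges to a boundary regular fixed point $\eta$ and $\lim_{n\to+\infty}h_{a,p}(x_n)=-\infty$ for all $a\in\Phi^{-1}(\eta)$, that is, $(x_n)$ is eventually contained in every horosphere centered at a point of $\Phi^{-1}(\eta)$; (5) $(x_n)$ converges to a boundary regular fixed point $\eta$ and $\liminf_{n\to+\infty}h_{a,p}(x_n)=-\infty$ for all $a\in\Phi^{-1}(\eta)$; (6) $(x_n)$ converges to a repelling boundary regular fixed point; (7) $(x_n)$ converges to a repelling boundary regular fixed point $\eta$ and $b(x_n)=\log\Lambda_\eta$.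
   Context: Non-expanding: $d(f(x),f(y))\le d(x,y)$. Gromov hyperbolic: for some $\delta>0$, in every geodesic triangle each side lies in the $\delta$-neighborhood of the union of the other two. $\partial_GX$ is the Gromov boundary, $\overline X^G=X\sqcup\partial_GX$ the Gromov compactification; convergence to boundary points is in $\overline X^G$. Horofunctions: $\overline X^H$ is the closure, in $C(X)$ (topology of uniform convergence on compacta) modulo constants, of the classes of the functions $y\mapsto d(x,y)$, $x\in X$; $\partial_HX=\overline X^H\setminus X$. For $a\in\partial_HX$, $h_{a,p}$ is the unique representative of $a$ vanishing at $p$; horospheres centered at $a$ are the sets $\{h_{a,p}\le c\}$, $c\in\mathbb R$. There is a (unique) continuous map $\Phi\colon\overline X^H\to\overline X^G$ restricting to the identity on $X$. For non-expanding $g$, $\log\lambda_{\eta,p}(g)=\liminf_{z\to\eta}[d(z,p)-d(g(z),p)]$. Geodesic region: $\{x\in X: d(x,\gamma)<R\}$ for a geodesic ray $\gamma$ and $R>0$, with vertex $[\gamma]\in\partial_GX$. $g$ has geodesic limit $\xi$ at $\eta$ if $g(x_n)\to\xi$ for every sequence $x_n\to\eta$ contained in a geodesic region with vertex $\eta$. $\eta\in\partial_GX$ is a boundary regular fixed point (BRFP) of $g$ if $\lambda_{\eta,p}(g)<+\infty$ (independent of $p$) and $g$ has geodesic limit $\eta$ at $\eta$; in the claim BRFPs are those of $f$. A BRFP of $f$ is a BRFP of all iterates; its stable dilation is given by $\log\Lambda_\eta=\lim_n\frac1n\log\lambda_{\eta,p}(f^n)$ (the limit exists, is finite, independent of $p$),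 and $\eta$ is repelling if $\Lambda_\eta>1$. A backward orbit is a sequence $(x_n)_{n\ge0}$ with $f(x_{n+1})=x_n$; bounded step means $\sup_nd(x_n,x_{n+1})<\infty$; escaping means eventually leaving every compact subset of $X$. $\sigma_m(x_n)=\lim_{n\to\infty}d(x_n,x_{n+m})$ and the backward step rate is $b(x_n)=\lim_{m\to\infty}\sigma_m(x_n)/m$. $(x_n)$ is a discrete quasi-geodesic ray if there are $A\ge1$, $B\ge0$ with $A^{-1}|n-m|-B\le d(x_n,x_m)\le A|n-m|+B$ for all $n,m\ge0$. *)

theory Defs
  imports "HOL-Analysis.Analysis"
begin

section \<open>Geodesics and Gromov hyperbolicity\<close>

text \<open>A metric space is a type of class \<open>metric_space\<close>; it is proper iff the type is of
  class \<open>heine_borel\<close>.\<close>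

definition geodesic_segment :: "'a::metric_space set \<Rightarrow> 'a \<Rightarrow> 'a \<Rightarrow> bool" where
  "geodesic_segment S x y \<longleftrightarrow>
     (\<exists>c :: real \<Rightarrow> 'a. c 0 = x \<and> c (dist x y) = y \<and>
        (\<forall>s\<in>{0..dist x y}. \<forall>t\<in>{0..dist x y}. dist (c s) (c t) = \<bar>s - t\<bar>) \<and>
        S = c ` {0..dist x y})"

definition geodesic_space :: "'a::metric_space itself \<Rightarrow> bool" where
  "geodesic_space _ \<longleftrightarrow> (\<forall>x y :: 'a. \<exists>S. geodesic_segment S x y)"

text \<open>Only the side \<open>S1\<close> is mentioned below; the other two sides are covered by the
  quantification over all (cyclically permuted) triangles.\<close>

definition gromov_hyperbolic :: "'a::metric_space itself \<Rightarrow> bool" where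
  "gromov_hyperbolic _ \<longleftrightarrow>
     (\<exists>\<delta>>0. \<forall>(x::'a) y z S1 S2 S3.
        geodesic_segment S1 x y \<and> geodesic_segment S2 y z \<and> geodesic_segment S3 z x \<longrightarrow>
        (\<forall>u\<in>S1. \<exists>v\<in>S2 \<union> S3. dist u v < \<delta>))"

section \<open>Gromov boundary and Gromov compactification\<close>

text \<open>Rays are parametrised by \<open>{0..}\<close>; their values at negative reals are irrelevant.\<close>

definition geodesic_ray :: "(real \<Rightarrow> 'a::metric_space) \<Rightarrow> bool" where
  "geodesic_ray \<gamma> \<longleftrightarrow> (\<forall>s\<ge>0. \<forall>t\<ge>0. dist (\<gamma> s) (\<gamma> t) = \<bar>s - t\<bar>)"

definition ray_class :: "(real \<Rightarrow> 'a::metric_space) \<Rightarrow> (real \<Rightarrow> 'a) set" where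
  "ray_class \<gamma> = {\<gamma>'. geodesic_ray \<gamma>' \<and> (\<exists>C. \<forall>t\<ge>0. dist (\<gamma> t) (\<gamma>' t) \<le> C)}"

definition gromov_boundary :: "(real \<Rightarrow> 'a::metric_space) set set" where
  "gromov_boundary = ray_class ` {\<gamma>. geodesic_ray \<gamma>}"

text \<open>Points of the Gromov compactification are \<open>Inl x\<close> for \<open>x\<close> in the space and \<open>Inr \<eta>\<close> for
  \<open>\<eta>\<close> in the Gromov boundary.\<close>

type_synonym 'a gromov_pt = "'a + (real \<Rightarrow> 'a) set"

definition gromov_compactification :: "'a::metric_space gromov_pt set" where
  "gromov_compactification = range Inl \<union> Inr ` gromov_boundary"

definition gromov_product :: "'a::metric_space \<Rightarrow> 'a \<Rightarrow> 'a \<Rightarrow> real" where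
  "gromov_product p x y = (dist x p + dist y p - dist x y) / 2"

text \<open>The usual neighbourhoods of a boundary point: all points whose Gromov product with \<open>\<eta>\<close>,
  measured along representing rays, is eventually at least \<open>r\<close>.\<close>

definition gromov_nbhd ::
    "'a::metric_space \<Rightarrow> (real \<Rightarrow> 'a) set \<Rightarrow> real \<Rightarrow> 'a gromov_pt set" where
  "gromov_nbhd p \<eta> r =
     {Inl x | x. \<exists>\<gamma>\<in>\<eta>. \<forall>\<^sub>F t in at_top. r \<le> gromov_product p x (\<gamma> t)} \<union>
     {Inr \<xi> | \<xi>. \<xi> \<in> gromov_boundary \<and>
        (\<exists>\<gamma>\<in>\<eta>. \<exists>\<gamma>'\<in>\<xi>. \<exists>T. \<forall>s\<ge>T. \<forall>t\<ge>T. r \<le> gromov_product p (\<gamma> s) (\<gamma>' t))}"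

text \<open>The sets \<open>gromov_nbhd p \<eta> r\<close> need not be open themselves; in a proper geodesic Gromov
  hyperbolic space they form, for any fixed \<open>p\<close>, a neighbourhood basis at \<open>\<eta>\<close>.\<close>

definition gromov_open :: "'a::metric_space gromov_pt set \<Rightarrow> bool" where
  "gromov_open U \<longleftrightarrow>
     U \<subseteq> gromov_compactification \<and> open {x. Inl x \<in> U} \<and>
     (\<forall>\<eta>. Inr \<eta> \<in> U \<longrightarrow> (\<forall>p. \<exists>r. gromov_nbhd p \<eta> r \<subseteq> U))"

definition gromov_topology :: "'a::metric_space gromov_pt topology" where
  "gromov_topology = topology gromov_open"

lemma gromov_nbhd_mono:
  assumes "r \<le> s" shows "gromov_nbhd p \<eta> s \<subseteq> gromov_nbhd p \<eta> r"
proof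
  fix z assume z: "z \<in> gromov_nbhd p \<eta> s"
  show "z \<in> gromov_nbhd p \<eta> r"
  proof (cases z)
    case (Inl x)
    with z obtain \<gamma> where "\<gamma> \<in> \<eta>" "\<forall>\<^sub>F t in at_top. s \<le> gromov_product p x (\<gamma> t)"
      by (auto simp: gromov_nbhd_def)
    moreover from this(2) have "\<forall>\<^sub>F t in at_top. r \<le> gromov_product p x (\<gamma> t)"
      by (rule eventually_mono) (use assms in linarith)
    ultimately show ?thesis using Inl by (auto simp: gromov_nbhd_def)
  next
    case (Inr \<xi>)
    with z obtain \<gamma> \<gamma>' T where "\<xi> \<in> gromov_boundary" "\<gamma> \<in> \<eta>" "\<gamma>' \<in> \<xi>"
      and T: "\<forall>s'\<ge>T. \<forall>t\<ge>T. s \<le> gromov_product p (\<gamma> s') (\<gamma>' t)"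
      unfolding gromov_nbhd_def by blast
    moreover have "\<forall>s'\<ge>T. \<forall>t\<ge>T. r \<le> gromov_product p (\<gamma> s') (\<gamma>' t)"
      using T assms order_trans by blast
    ultimately show ?thesis using Inr unfolding gromov_nbhd_def by blast
  qed
qed

lemma istopology_gromov_open: "istopology gromov_open"
  unfolding istopology_def
proof (intro conjI allI impI)
  fix U V :: "'a gromov_pt set" assume U: "gromov_open U" and V: "gromov_open V"
  have "\<exists>r. gromov_nbhd p \<eta> r \<subseteq> U \<inter> V" if \<eta>: "Inr \<eta> \<in> U \<inter> V" for p \<eta>
  proof -
    obtain r s where "gromov_nbhd p \<eta> r \<subseteq> U" "gromov_nbhd p \<eta> s \<subseteq> V"
      using U V \<eta> unfolding gromov_open_def by blast
    then have "gromov_nbhd p \<eta> (max r s) \<subseteq> U \<inter> V"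
      using gromov_nbhd_mono[of r "max r s" p \<eta>] gromov_nbhd_mono[of s "max r s" p \<eta>] by auto
    then show ?thesis ..
  qed
  moreover have "{x. Inl x \<in> U \<inter> V} = {x. Inl x \<in> U} \<inter> {x. Inl x \<in> V}" by auto
  ultimately show "gromov_open (U \<inter> V)"
    using U V unfolding gromov_open_def by (auto intro: open_Int)
next
  fix \<U> :: "'a gromov_pt set set" assume \<U>: "\<forall>U\<in>\<U>. gromov_open U"
  have "{x. Inl x \<in> \<Union>\<U>} = (\<Union>U\<in>\<U>. {x. Inl x \<in> U})" by auto
  moreover have "open \<dots>" using \<U> by (auto simp: gromov_open_def)
  moreover have "\<exists>r. gromov_nbhd p \<eta> r \<subseteq> \<Union>\<U>" if \<eta>: "Inr \<eta> \<in> \<Union>\<U>" for p \<eta>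
  proof -
    obtain U where "U \<in> \<U>" "Inr \<eta> \<in> U" using \<eta> by blast
    then obtain r where "gromov_nbhd p \<eta> r \<subseteq> U" using \<U> unfolding gromov_open_def by blast
    with \<open>U \<in> \<U>\<close> have "gromov_nbhd p \<eta> r \<subseteq> \<Union>\<U>" by blast
    then show ?thesis ..
  qed
  ultimately show "gromov_open (\<Union>\<U>)"
    using \<U> unfolding gromov_open_def by auto
qed

lemma openin_gromov_topology: "openin gromov_topology = gromov_open"
  by (simp add: gromov_topology_def istopology_gromov_open)

section \<open>Horofunction compactification\<close>

text \<open>\<open>C(X)\<close> with the topology of uniform convergence on compacta.\<close>

definition cont_funs :: "('a::metric_space \<Rightarrow> real) set" where
  "cont_funs = {g. continuous_on UNIV g}"

definition ucc_open :: "('a::metric_space \<Rightarrow> real) set \<Rightarrow> bool" where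
  "ucc_open U \<longleftrightarrow> U \<subseteq> cont_funs \<and>
     (\<forall>g\<in>U. \<exists>K \<epsilon>. compact K \<and> \<epsilon> > 0 \<and> {h \<in> cont_funs. \<forall>y\<in>K. \<bar>h y - g y\<bar> < \<epsilon>} \<subseteq> U)"

definition ucc_topology :: "('a::metric_space \<Rightarrow> real) topology" where
  "ucc_topology = topology ucc_open"

lemma istopology_ucc_open: "istopology ucc_open"
  unfolding istopology_def
proof (intro conjI allI impI)
  fix U V :: "('a \<Rightarrow> real) set" assume U: "ucc_open U" and V: "ucc_open V"
  have "\<exists>K \<epsilon>. compact K \<and> \<epsilon> > 0 \<and> {h \<in> cont_funs. \<forall>y\<in>K. \<bar>h y - g y\<bar> < \<epsilon>} \<subseteq> U \<inter> V"
    if g: "g \<in> U \<inter> V" for g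
  proof -
    obtain K \<epsilon> where 1: "compact K" "\<epsilon> > 0" "{h \<in> cont_funs. \<forall>y\<in>K. \<bar>h y - g y\<bar> < \<epsilon>} \<subseteq> U"
      using U g unfolding ucc_open_def by blast
    obtain L \<epsilon>' where 2: "compact L" "\<epsilon>' > 0" "{h \<in> cont_funs. \<forall>y\<in>L. \<bar>h y - g y\<bar> < \<epsilon>'} \<subseteq> V"
      using V g unfolding ucc_open_def by blast
    from 1 2 have "{h \<in> cont_funs. \<forall>y\<in>K \<union> L. \<bar>h y - g y\<bar> < min \<epsilon> \<epsilon>'} \<subseteq> U \<inter> V" by auto
    moreover have "compact (K \<union> L)" "min \<epsilon> \<epsilon>' > 0" using 1 2 by auto
    ultimately show ?thesis by blast
  qed
  then show "ucc_open (U \<inter> V)" using U unfolding ucc_open_def by blast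
next
  fix \<U> :: "('a \<Rightarrow> real) set set" assume \<U>: "\<forall>U\<in>\<U>. ucc_open U"
  have "\<exists>K \<epsilon>. compact K \<and> \<epsilon> > 0 \<and> {h \<in> cont_funs. \<forall>y\<in>K. \<bar>h y - g y\<bar> < \<epsilon>} \<subseteq> \<Union>\<U>"
    if g: "g \<in> \<Union>\<U>" for g
  proof -
    obtain U where "U \<in> \<U>" "g \<in> U" using g by blast
    then obtain K \<epsilon> where "compact K" "\<epsilon> > 0"
      and "{h \<in> cont_funs. \<forall>y\<in>K. \<bar>h y - g y\<bar> < \<epsilon>} \<subseteq> U"
      using \<U> unfolding ucc_open_def by meson
    moreover from this(3) \<open>U \<in> \<U>\<close>
    have "{h \<in> cont_funs. \<forall>y\<in>K. \<bar>h y - g y\<bar> < \<epsilon>} \<subseteq> \<Union>\<U>" by blast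
    ultimately show ?thesis by blast
  qed
  then show "ucc_open (\<Union>\<U>)" using \<U> unfolding ucc_open_def by blast
qed

lemma openin_ucc_topology: "openin ucc_topology = ucc_open"
  by (simp add: ucc_topology_def istopology_ucc_open)

definition const_class :: "('a \<Rightarrow> real) \<Rightarrow> ('a \<Rightarrow> real) set" where
  "const_class g = {h. \<exists>c. \<forall>y. h y = g y + c}"

lemma const_class_refl: "g \<in> const_class g"
  unfolding const_class_def by (auto intro: exI[of _ 0])

lemma const_class_eq: "h \<in> const_class g \<Longrightarrow> const_class h = const_class g"
proof -
  assume "h \<in> const_class g"
  then obtain c where c: "\<And>y. h y = g y + c" by (auto simp: const_class_def)
  have "(\<exists>d. \<forall>y. k y = h y + d) \<longleftrightarrow> (\<exists>d. \<forall>y. k y = g y + d)" for k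
  proof
    assume "\<exists>d. \<forall>y. k y = h y + d"
    then obtain d where "\<forall>y. k y = h y + d" ..
    then show "\<exists>d. \<forall>y. k y = g y + d" using c by (intro exI[of _ "c + d"]) simp
  next
    assume "\<exists>d. \<forall>y. k y = g y + d"
    then obtain d where "\<forall>y. k y = g y + d" ..
    then show "\<exists>d. \<forall>y. k y = h y + d" using c by (intro exI[of _ "d - c"]) simp
  qed
  then show ?thesis by (simp add: const_class_def)
qed

text \<open>The quotient topology on \<open>C(X)\<close> modulo constants: the preimage of a set \<open>U\<close> of classes
  under the quotient map is \<open>\<Union>U\<close>.\<close>

definition cont_mod_const_open :: "('a::metric_space \<Rightarrow> real) set set \<Rightarrow> bool" where
  "cont_mod_const_open U \<longleftrightarrow> U \<subseteq> const_class ` cont_funs \<and> openin ucc_topology (\<Union>U)"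

definition cont_mod_const_topology :: "('a::metric_space \<Rightarrow> real) set topology" where
  "cont_mod_const_topology = topology cont_mod_const_open"

lemma istopology_cont_mod_const_open: "istopology cont_mod_const_open"
  unfolding istopology_def
proof (intro conjI allI impI)
  fix U V :: "('a \<Rightarrow> real) set set"
  assume U: "cont_mod_const_open U" and V: "cont_mod_const_open V"
  have "\<Union>U \<inter> \<Union>V \<subseteq> \<Union>(U \<inter> V)"
  proof
    fix g assume "g \<in> \<Union>U \<inter> \<Union>V"
    then obtain A B where AB: "g \<in> A" "A \<in> U" "g \<in> B" "B \<in> V" by blast
    then have "A = const_class g" "B = const_class g"
      using U V const_class_eq unfolding cont_mod_const_open_def by blast+
    with AB show "g \<in> \<Union>(U \<inter> V)" by blast
  qed
  then have "\<Union>(U \<inter> V) = \<Union>U \<inter> \<Union>V" by blast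
  then show "cont_mod_const_open (U \<inter> V)"
    using U V unfolding cont_mod_const_open_def by (auto intro: openin_Int)
next
  fix \<U> :: "('a \<Rightarrow> real) set set set" assume \<U>: "\<forall>U\<in>\<U>. cont_mod_const_open U"
  have "\<Union>(\<Union>\<U>) = (\<Union>U\<in>\<U>. \<Union>U)" by blast
  moreover have "openin ucc_topology \<dots>"
    using \<U> unfolding cont_mod_const_open_def by (intro openin_Union) blast
  ultimately show "cont_mod_const_open (\<Union>\<U>)"
    using \<U> unfolding cont_mod_const_open_def by auto
qed

lemma openin_cont_mod_const_topology: "openin cont_mod_const_topology = cont_mod_const_open"
  by (simp add: cont_mod_const_topology_def istopology_cont_mod_const_open)

definition horo_embed :: "'a::metric_space \<Rightarrow> ('a \<Rightarrow> real) set" where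
  "horo_embed x = const_class (\<lambda>y. dist x y)"

definition horo_compactification :: "('a::metric_space \<Rightarrow> real) set set" where
  "horo_compactification = cont_mod_const_topology closure_of (range horo_embed)"

definition horofunction :: "('a \<Rightarrow> real) set \<Rightarrow> 'a \<Rightarrow> 'a \<Rightarrow> real" where
  "horofunction a p = (THE h. h \<in> a \<and> h p = 0)"

text \<open>The map \<open>\<Phi>\<close>. The condition \<open>extensional\<close> only fixes the values outside the domain
  \<open>horo_compactification\<close>, so that the description is unique.\<close>

definition horo_to_gromov :: "('a::metric_space \<Rightarrow> real) set \<Rightarrow> 'a gromov_pt" where
  "horo_to_gromov = (THE \<Phi>. \<Phi> \<in> extensional horo_compactification \<and>
     continuous_map (subtopology cont_mod_const_topology horo_compactification)
       gromov_topology \<Phi> \<and>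
     (\<forall>x. \<Phi> (horo_embed x) = Inl x))"

definition horo_fibre :: "(real \<Rightarrow> 'a::metric_space) set \<Rightarrow> ('a \<Rightarrow> real) set set" where
  "horo_fibre \<eta> = {a \<in> horo_compactification. horo_to_gromov a = Inr \<eta>}"

section \<open>Boundary regular fixed points\<close>

text \<open>\<open>log_dilation p g \<eta>\<close> is \<open>log \<lambda>\<^bsub>\<eta>,p\<^esub>(g)\<close>; the liminf is over points \<open>z\<close> of the space
  tending to \<open>\<eta>\<close> in the Gromov compactification. Dilations are handled through their logarithms,
  so \<open>\<lambda> < \<infinity>\<close> reads \<open>log \<lambda> < \<infinity>\<close> and \<open>\<Lambda> > 1\<close> reads \<open>log \<Lambda> > 0\<close>.\<close>

definition log_dilation ::
    "'a::metric_space \<Rightarrow> ('a \<Rightarrow> 'a) \<Rightarrow> (real \<Rightarrow> 'a) set \<Rightarrow> ereal" where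
  "log_dilation p g \<eta> =
     Liminf (filtercomap Inl (nhdsin gromov_topology (Inr \<eta>)))
       (\<lambda>z. ereal (dist z p - dist (g z) p))"

definition geodesic_region :: "(real \<Rightarrow> 'a::metric_space) \<Rightarrow> real \<Rightarrow> 'a set" where
  "geodesic_region \<gamma> R = {x. infdist x (\<gamma> ` {0..}) < R}"

definition converges_to_bdry :: "(nat \<Rightarrow> 'a::metric_space) \<Rightarrow> (real \<Rightarrow> 'a) set \<Rightarrow> bool" where
  "converges_to_bdry x \<eta> \<longleftrightarrow> limitin gromov_topology (\<lambda>n. Inl (x n)) (Inr \<eta>) sequentially"

definition in_geodesic_region :: "(nat \<Rightarrow> 'a::metric_space) \<Rightarrow> (real \<Rightarrow> 'a) set \<Rightarrow> bool" where
  "in_geodesic_region x \<eta> \<longleftrightarrow>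
     (\<exists>\<gamma> R. geodesic_ray \<gamma> \<and> ray_class \<gamma> = \<eta> \<and> R > 0 \<and> (\<forall>n. x n \<in> geodesic_region \<gamma> R))"

definition has_geodesic_limit ::
    "('a::metric_space \<Rightarrow> 'a) \<Rightarrow> (real \<Rightarrow> 'a) set \<Rightarrow> 'a gromov_pt \<Rightarrow> bool" where
  "has_geodesic_limit g \<eta> \<xi> \<longleftrightarrow>
     (\<forall>x. converges_to_bdry x \<eta> \<and> in_geodesic_region x \<eta> \<longrightarrow>
        limitin gromov_topology (\<lambda>n. Inl (g (x n))) \<xi> sequentially)"

definition BRFP ::
    "'a::metric_space \<Rightarrow> ('a \<Rightarrow> 'a) \<Rightarrow> (real \<Rightarrow> 'a) set \<Rightarrow> bool" where
  "BRFP p g \<eta> \<longleftrightarrow>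
     \<eta> \<in> gromov_boundary \<and> log_dilation p g \<eta> < \<infinity> \<and> has_geodesic_limit g \<eta> (Inr \<eta>)"

definition log_stable_dilation ::
    "'a::metric_space \<Rightarrow> ('a \<Rightarrow> 'a) \<Rightarrow> (real \<Rightarrow> 'a) set \<Rightarrow> ereal" where
  "log_stable_dilation p f \<eta> = lim (\<lambda>n. log_dilation p (f ^^ n) \<eta> / ereal (real n))"

definition repelling_BRFP ::
    "'a::metric_space \<Rightarrow> ('a \<Rightarrow> 'a) \<Rightarrow> (real \<Rightarrow> 'a) set \<Rightarrow> bool" where
  "repelling_BRFP p f \<eta> \<longleftrightarrow> BRFP p f \<eta> \<and> log_stable_dilation p f \<eta> > 0"

section \<open>Backward orbits\<close>

definition non_expanding :: "('a::metric_space \<Rightarrow> 'a) \<Rightarrow> bool" where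
  "non_expanding f \<longleftrightarrow> (\<forall>x y. dist (f x) (f y) \<le> dist x y)"

definition backward_orbit :: "('a \<Rightarrow> 'a) \<Rightarrow> (nat \<Rightarrow> 'a) \<Rightarrow> bool" where
  "backward_orbit f x \<longleftrightarrow> (\<forall>n. f (x (Suc n)) = x n)"

definition bounded_step :: "(nat \<Rightarrow> 'a::metric_space) \<Rightarrow> bool" where
  "bounded_step x \<longleftrightarrow> bdd_above (range (\<lambda>n. dist (x n) (x (Suc n))))"

definition escaping :: "(nat \<Rightarrow> 'a::metric_space) \<Rightarrow> bool" where
  "escaping x \<longleftrightarrow> (\<forall>K. compact K \<longrightarrow> (\<forall>\<^sub>F n in sequentially. x n \<notin> K))"

definition backward_step :: "(nat \<Rightarrow> 'a::metric_space) \<Rightarrow> nat \<Rightarrow> real" where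
  "backward_step x m = lim (\<lambda>n. dist (x n) (x (n + m)))"

definition backward_step_rate :: "(nat \<Rightarrow> 'a::metric_space) \<Rightarrow> real" where
  "backward_step_rate x = lim (\<lambda>m. backward_step x m / real m)"

definition discrete_quasi_geodesic_ray :: "(nat \<Rightarrow> 'a::metric_space) \<Rightarrow> bool" where
  "discrete_quasi_geodesic_ray x \<longleftrightarrow>
     (\<exists>A B. A \<ge> 1 \<and> B \<ge> 0 \<and>
        (\<forall>n m. \<bar>real n - real m\<bar> / A - B \<le> dist (x n) (x m) \<and>
               dist (x n) (x m) \<le> A * \<bar>real n - real m\<bar> + B))"

end

theory Submission
  imports Defs
begin

text \<open>Everything is expressed through Gromov products. For a backward orbit, \<open>dist (x n) (x (n + m))\<close>
  increases with \<open>n\<close> to \<open>\<sigma> m\<close>, and \<open>\<sigma>\<close> is subadditive. If the rate is positive, then \<open>\<sigma> (2 * M)\<close> exceeds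
  \<open>\<sigma> M\<close> by an arbitrarily large constant for some \<open>M\<close>, so that the points \<open>x (N + j * M)\<close> form a chain with
  small Gromov products at each vertex; by the four-point inequality such a chain is geodesic up to a
  constant, converges to a boundary point, and follows a ray, along which \<open>f\<close> has bounded displacement.
  Conversely, at a boundary regular fixed point the iterate \<open>f ^^ n\<close> translates the ray by the
  logarithm of its dilation up to a constant independent of \<open>n\<close>; this logarithm is therefore additive up to a
  constant, which gives the stable dilation and relates it to \<open>\<sigma>\<close> and to Busemann functions.\<close>

section \<open>Subadditive sequences\<close>

text \<open>Condition (1) is the hub: it produces one boundary point that serves all other
  conditions, and each of these gives it back. Single steps of the orbit may be short compared with
  \<open>\<delta>\<close>, a scale at which hyperbolicity says nothing; sampling every
  \<open>M\<close> steps lets the gain beat \<open>\<delta>\<close>, and local expansion then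
  becomes global. In \<open>BRFP_translates_ray\<close> the error depends on \<open>\<delta>\<close>
  alone and not on the map, so it is the same for all iterates. It keeps the logarithmic dilation of
  \<open>f ^^ n\<close> within a fixed distance of \<open>l * real n\<close>, which is stronger than
  convergence of the quotients. The case \<open>l = 0\<close> in (5) relies on this: the dilations
  stay bounded above instead of merely growing sublinearly. The second obstacle is topological.
  \<open>\<Phi>\<close> is given by a description only, so it is first constructed, by extending the
  inclusion of the space continuously into a regular space. Afterwards two facts about its fibres
  suffice: every member is approximated on compacta by normalised distance functions of points near
  \<open>\<eta>\<close>, and one member is the Busemann function of
  \<open>rep \<eta>\<close>.\<close>

lemma subadditive_limit:
  fixes u :: "nat \<Rightarrow> real"
  assumes sub: "\<And>m n. u (m + n) \<le> u m + u n" and lower: "\<And>n. - (D * real n) \<le> u n"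
  obtains l where "(\<lambda>n. u n / real n) \<longlonglongrightarrow> l" "\<And>n. n > 0 \<Longrightarrow> l \<le> u n / real n"
proof -
  define S where "S = (\<lambda>n. u n / real n) ` {0<..}"
  have bdd: "bdd_below S"
    unfolding S_def
  proof (rule bdd_belowI2)
    fix n :: nat assume "n \<in> {0<..}"
    then show "- D \<le> u n / real n" using lower[of n] by (simp add: field_simps)
  qed
  have ne: "S \<noteq> {}" unfolding S_def by auto
  define l where "l = Inf S"
  have l_le: "l \<le> u n / real n" if "n > 0" for n
    unfolding l_def by (rule cInf_lower[OF _ bdd]) (use that in \<open>auto simp: S_def\<close>)
  have mult: "u (q * k + r) \<le> real q * u k + u r" for q k r
  proof (induction q)
    case (Suc q)
    have "u (Suc q * k + r) \<le> u k + u (q * k + r)" using sub[of k "q * k + r"] by (simp add: algebra_simps)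
    with Suc show ?case by (simp add: algebra_simps)
  qed simp
  have "(\<lambda>n. u n / real n) \<longlonglongrightarrow> l"
  proof (rule LIMSEQ_I)
    fix e :: real assume e: "e > 0"
    have "\<exists>x\<in>S. x < l + e / 2" using cInf_lessD[OF ne, of "l + e/2"] e unfolding l_def by auto
    then obtain k where k: "k > 0" "u k / real k < l + e / 2" unfolding S_def by auto
    \<comment> \<open>\<open>C\<close> collects what division with remainder leaves over: the value
      of \<open>u\<close> at \<open>n mod k\<close>, and the replacement of
      \<open>real (n div k)\<close> by \<open>real n / real k\<close>.\<close>
    define C where "C = (\<Sum>r<k. \<bar>u r\<bar>) + \<bar>u k / real k\<bar> * real k"
    obtain N where N: "real N > 2 * C / e" "N > 0"
      using reals_Archimedean2[of "max 1 (2 * C / e)"] by force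
    have "norm (u n / real n - l) < e" if n: "n \<ge> N" for n
    proof -
      have n0: "real n > 0" using n N by auto
      have "u n \<le> real (n div k) * u k + u (n mod k)" using mult[of "n div k" k "n mod k"] by simp
      moreover have "u (n mod k) \<le> (\<Sum>r<k. \<bar>u r\<bar>)"
        using member_le_sum[of "n mod k" "{..<k}" "\<lambda>r. \<bar>u r\<bar>"] k by (auto intro: order_trans[OF abs_ge_self])
      moreover have "real (n div k) * u k = (u k / real k) * real n - (u k / real k) * real (n mod k)"
      proof -
        have "real n = real (n div k) * real k + real (n mod k)"
          by (metis div_mult_mod_eq of_nat_add of_nat_mult)
        then show ?thesis using k by (simp add: field_simps)
      qed
      moreover have "- ((u k / real k) * real (n mod k)) \<le> \<bar>u k / real k\<bar> * real k"
      proof -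
        have "- ((u k / real k) * real (n mod k)) \<le> \<bar>u k / real k\<bar> * real (n mod k)"
          using abs_ge_minus_self[of "(u k / real k) * real (n mod k)"] by (simp add: abs_mult)
        also have "\<dots> \<le> \<bar>u k / real k\<bar> * real k"
          using k by (intro mult_left_mono) (auto intro: less_imp_le)
        finally show ?thesis .
      qed
      ultimately have "u n \<le> (u k / real k) * real n + C" unfolding C_def by linarith
      then have "u n / real n \<le> u k / real k + C / real n" using n0 by (simp add: field_simps)
      moreover have "C / real n < e / 2"
      proof -
        have "2 * C / e < real n" using N n by linarith
        then show ?thesis using n0 e by (simp add: field_simps)
      qed
      moreover have "l \<le> u n / real n" using l_le n N by auto
      ultimately show ?thesis using k unfolding real_norm_def by argo
    qed
    then show "\<exists>N. \<forall>n\<ge>N. norm (u n / real n - l) < e" by blast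
  qed
  with l_le show thesis using that by blast
qed

text \<open>Adding \<open>K\<close> makes both \<open>u\<close> and \<open>- u\<close> subadditive.
  Their limits are \<open>l\<close> and \<open>- l\<close>; as each limit is also a lower bound of
  its quotients, the two one-sided bounds combine to one that is uniform in
  \<open>n\<close>.\<close>

lemma quasi_additive_limit:
  fixes u :: "nat \<Rightarrow> real"
  assumes add: "\<And>m n. \<bar>u (m + n) - u m - u n\<bar> \<le> K"
  obtains l where "(\<lambda>n. u n / real n) \<longlonglongrightarrow> l" "\<And>n. \<bar>u n - l * real n\<bar> \<le> K"
proof -
  have K: "K \<ge> 0" using add[of 0 0] by linarith
  define D where "D = \<bar>u 0\<bar> + \<bar>u 1\<bar> + 2 * K"
  have lin: "\<bar>u n\<bar> \<le> D * real n + \<bar>u 0\<bar>" for n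
  proof (induction n)
    case (Suc n)
    have "\<bar>u (Suc n)\<bar> \<le> \<bar>u n\<bar> + \<bar>u 1\<bar> + K" using add[of n 1] unfolding Suc_eq_plus1 by linarith
    moreover have "\<bar>u 1\<bar> + K \<le> D" using K by (simp add: D_def)
    moreover have "D * real (Suc n) = D * real n + D" by (simp add: algebra_simps)
    ultimately show ?case using Suc by linarith
  qed simp
  have lin': "\<bar>u n\<bar> \<le> D * real n + K" for n
    using lin[of n] add[of 0 0] by (cases "n = 0") (auto simp: D_def algebra_simps)
  have "u (m + n) + K \<le> (u m + K) + (u n + K)" for m n using add[of m n] by linarith
  moreover have "- (D * real n) \<le> u n + K" for n using lin'[of n] by linarith
  ultimately obtain l where l: "(\<lambda>n. (u n + K) / real n) \<longlonglongrightarrow> l" "\<And>n. n > 0 \<Longrightarrow> l \<le> (u n + K) / real n"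
    using subadditive_limit[of "\<lambda>n. u n + K" D] by metis
  have "- u (m + n) + K \<le> (- u m + K) + (- u n + K)" for m n using add[of m n] by linarith
  moreover have "- (D * real n) \<le> - u n + K" for n using lin'[of n] by linarith
  ultimately obtain l' where l': "(\<lambda>n. (- u n + K) / real n) \<longlonglongrightarrow> l'" "\<And>n. n > 0 \<Longrightarrow> l' \<le> (- u n + K) / real n"
    using subadditive_limit[of "\<lambda>n. - u n + K" D] by metis
  have z: "(\<lambda>n. K / real n) \<longlonglongrightarrow> 0" by (rule lim_const_over_n)
  have c: "(\<lambda>n. u n / real n) \<longlonglongrightarrow> l" using tendsto_diff[OF l(1) z] by (simp add: add_divide_distrib)
  have "(\<lambda>n. - (u n / real n)) \<longlonglongrightarrow> l'" using tendsto_diff[OF l'(1) z] by (simp add: diff_divide_distrib add_divide_distrib)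
  from LIMSEQ_unique[OF this tendsto_minus[OF c]] have ll: "l' = - l" .
  have "\<bar>u n - l * real n\<bar> \<le> K" for n
  proof (cases "n = 0")
    case True
    then show ?thesis using add[of 0 0] by simp
  next
    case False
    then show ?thesis using l(2)[of n] l'(2)[of n] ll by (simp add: field_simps abs_le_iff)
  qed
  with c show thesis using that by blast
qed

section \<open>Thin triangles and the four-point condition\<close>

lemma gromov_product_commute: "gromov_product p x y = gromov_product p y x"
  by (simp add: gromov_product_def dist_commute)

lemma gromov_product_le_dist: "gromov_product p x y \<le> dist x p"
  using dist_triangle2[of y p x] by (simp add: gromov_product_def dist_commute)

lemma gromov_product_lipschitz: "\<bar>gromov_product p x y - gromov_product p x' y\<bar> \<le> dist x x'"
proof -
  have "\<bar>dist x p - dist x' p\<bar> \<le> dist x x'" "\<bar>dist x y - dist x' y\<bar> \<le> dist x x'"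
    by (metis abs_dist_diff_le dist_commute)+
  then show ?thesis unfolding gromov_product_def by argo
qed

lemma gromov_product_basepoint: "\<bar>gromov_product p x y - gromov_product q x y\<bar> \<le> dist p q"
proof -
  have "\<bar>dist x p - dist x q\<bar> \<le> dist p q" "\<bar>dist y p - dist y q\<bar> \<le> dist p q"
    by (metis abs_dist_diff_le dist_commute)+
  then show ?thesis unfolding gromov_product_def by argo
qed

lemma geodesic_segmentD:
  assumes "geodesic_segment S x y" "u \<in> S"
  shows "dist x u + dist u y = dist x y"
proof -
  obtain c where c: "c 0 = x" "c (dist x y) = y"
      "\<forall>s\<in>{0..dist x y}. \<forall>t\<in>{0..dist x y}. dist (c s) (c t) = \<bar>s - t\<bar>" "S = c ` {0..dist x y}"
    using assms(1) unfolding geodesic_segment_def by blast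
  then obtain t where t: "t \<in> {0..dist x y}" "u = c t" using assms(2) by blast
  have "dist (c 0) (c t) = t" "dist (c t) (c (dist x y)) = dist x y - t"
    using c(3)[rule_format, of 0 t] c(3)[rule_format, of t "dist x y"] t by auto
  then show ?thesis using c t by simp
qed

lemma geodesic_segment_ends:
  assumes "geodesic_segment S x y" shows "x \<in> S" "y \<in> S"
proof -
  obtain c where "c 0 = x" "c (dist x y) = y" "S = c ` {0..dist x y}"
    using assms unfolding geodesic_segment_def by blast
  moreover have "0 \<in> {0..dist x y}" "dist x y \<in> {0..dist x y}" by auto
  ultimately show "x \<in> S" "y \<in> S" by (metis image_eqI)+
qed

lemma geodesic_segment_connected:
  assumes "geodesic_segment S x y" shows "connected S"
proof -
  obtain c where c: "\<forall>s\<in>{0..dist x y}. \<forall>t\<in>{0..dist x y}. dist (c s) (c t) = \<bar>s - t\<bar>" "S = c ` {0..dist x y}"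
    using assms unfolding geodesic_segment_def by blast
  have "continuous_on {0..dist x y} c"
    unfolding continuous_on_iff using c(1) by (auto simp: dist_real_def)
  then show ?thesis unfolding c(2) by (intro connected_continuous_image) auto
qed

text \<open>The side opposite to \<open>x\<close> is covered by the neighbourhoods of the other two sides; by
  connectedness some point of it is close to both.\<close>

lemma gromov_hyperbolic_four_point:
  assumes geo: "geodesic_space TYPE('a::metric_space)" and "gromov_hyperbolic TYPE('a)"
  obtains \<delta> where "\<delta> > 0"
    "\<And>q x y z::'a. min (gromov_product q x y) (gromov_product q y z) - \<delta> \<le> gromov_product q x z"
proof -
  obtain \<delta> where d0: "\<delta> > 0" and thin: "\<And>(x::'a) y z S1 S2 S3 u. geodesic_segment S1 x y \<Longrightarrow>
      geodesic_segment S2 y z \<Longrightarrow> geodesic_segment S3 z x \<Longrightarrow> u \<in> S1 \<Longrightarrow> \<exists>v\<in>S2 \<union> S3. dist u v < \<delta>"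
    using assms(2) unfolding gromov_hyperbolic_def by blast
  have seg: "\<exists>S. geodesic_segment S x y" for x y :: 'a
    using geo unfolding geodesic_space_def by blast
  have close: "\<exists>u\<in>S. dist q u \<le> gromov_product q y z + 2 * \<delta>" if S: "geodesic_segment S y z" for S q and y z :: 'a
  proof -
    obtain S2 S3 where S2: "geodesic_segment S2 z q" and S3: "geodesic_segment S3 q y" using seg by meson
    define U where "U T = (\<Union>v\<in>T. ball v \<delta>)" for T :: "'a set"
    have cover: "S \<subseteq> U S2 \<union> U S3"
      using thin[OF S S2 S3] unfolding U_def by (fastforce simp: dist_commute)
    have "U S2 \<inter> S \<noteq> {}" "U S3 \<inter> S \<noteq> {}"
      using geodesic_segment_ends[OF S] geodesic_segment_ends[OF S2] geodesic_segment_ends[OF S3] d0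
      unfolding U_def by force+
    moreover have "open (U S2)" "open (U S3)" unfolding U_def by auto
    ultimately have "U S2 \<inter> U S3 \<inter> S \<noteq> {}"
      using geodesic_segment_connected[OF S] cover unfolding connected_def by blast
    then obtain u v w where u: "u \<in> S" "v \<in> S2" "w \<in> S3" "dist v u < \<delta>" "dist w u < \<delta>"
      unfolding U_def by auto
    have "dist y u + dist u z = dist y z" by (rule geodesic_segmentD[OF S u(1)])
    moreover have "dist z v + dist v q = dist z q" by (rule geodesic_segmentD[OF S2 u(2)])
    moreover have "dist q w + dist w y = dist q y" by (rule geodesic_segmentD[OF S3 u(3)])
    moreover have "dist q u \<le> dist v q + dist v u" "dist q u \<le> dist q w + dist w u"
      "dist u z \<le> dist v u + dist z v" "dist y u \<le> dist w y + dist w u"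
      by (metis dist_commute dist_triangle)+
    ultimately have "2 * dist q u \<le> dist y q + dist z q - dist y z + 4 * \<delta>"
      using u(4,5) by (simp add: dist_commute)
    then show ?thesis using u(1) unfolding gromov_product_def by (intro bexI[of _ u]) (auto simp: field_simps)
  qed
  have far: "gromov_product q y z \<le> dist q v" if S: "geodesic_segment S y z" and v: "v \<in> S" for S q v and y z :: 'a
  proof -
    have "dist y q \<le> dist y v + dist q v" "dist z q \<le> dist v z + dist q v"
      by (metis dist_commute dist_triangle)+
    then show ?thesis using geodesic_segmentD[OF S v] unfolding gromov_product_def by simp
  qed
  \<comment> \<open>The point \<open>u\<close> of the side from \<open>x\<close> to \<open>z\<close>
    realises their product up to \<open>2 * \<delta>\<close>. Thinness puts a point \<open>v\<close>
    of another side within \<open>\<delta>\<close> of it, and \<open>v\<close> is at least as far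
    from \<open>q\<close> as the product of the ends of that side. This adds up to
    \<open>3 * \<delta>\<close>.\<close>
  have "min (gromov_product q x y) (gromov_product q y z) - 3 * \<delta> \<le> gromov_product q x z" for q x y z :: 'a
  proof -
    obtain S S2 S3 where S: "geodesic_segment S x z" and S2: "geodesic_segment S2 z y" and S3: "geodesic_segment S3 y x"
      using seg by meson
    obtain u where u: "u \<in> S" "dist q u \<le> gromov_product q x z + 2 * \<delta>" using close[OF S] by blast
    obtain v where v: "v \<in> S2 \<union> S3" "dist u v < \<delta>" using thin[OF S S2 S3 u(1)] by blast
    have "dist q v \<le> dist q u + dist u v" by (rule dist_triangle)
    moreover have "min (gromov_product q x y) (gromov_product q y z) \<le> dist q v"
      using v(1) far[OF S2, of v q] far[OF S3, of v q] by (auto simp: gromov_product_commute)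
    ultimately show ?thesis using u v by linarith
  qed
  then show thesis using that[of "3 * \<delta>"] d0 by auto
qed

section \<open>Chains in hyperbolic spaces\<close>

text \<open>The four-point inequality, for every base point, replaces thin triangles from here on.
  Geodesics are kept as a separate assumption because rays and intermediate points are built from
  them.\<close>

locale hyperbolic_metric =
  fixes \<delta> :: real and p :: "'a::heine_borel"
  assumes delta_pos: "\<delta> > 0"
    and four_point: "min (gromov_product q x y) (gromov_product q y z) - \<delta> \<le> gromov_product q x (z::'a)"
    and geodesic: "geodesic_space TYPE('a)"
begin

abbreviation gp :: "'a \<Rightarrow> 'a \<Rightarrow> real" where "gp \<equiv> gromov_product p"

text \<open>The base-free form of the inequality: of the three sums of opposite distances among four
  points, the two largest differ by at most \<open>2 * \<delta>\<close>.\<close>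

lemma four_point_dist:
  "dist x y + dist z w \<le> max (dist x z + dist y w) (dist x w + dist y z) + 2 * \<delta>" for x y z w :: 'a
  using four_point[of w x z y] dist_commute[of z w] dist_commute[of y z]
  unfolding gromov_product_def by argo

lemma four_point_ge:
  assumes "r \<le> gp x y" "r \<le> gp y z" shows "r - \<delta> \<le> gp x z"
  using four_point[of p x y z] assms by linarith

text \<open>In \<open>four_point_dist\<close> for the indices \<open>i\<close>, \<open>i+n\<close>,
  \<open>i+n+1\<close>, \<open>i+n+2\<close>, the induction hypothesis and \<open>step\<close> make
  the first sum in the maximum too small to bound the left side. So the second sum does, and
  \<open>step\<close> turns it into growth by \<open>a\<close>. The growth starts at
  \<open>n = 1\<close>, where \<open>step\<close> gives it at once.\<close>

lemma chain_growth:
  fixes y :: "nat \<Rightarrow> 'a"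
  assumes step: "\<And>j. max (dist (y j) (y (j+1))) (dist (y (j+1)) (y (j+2))) + 2 * \<delta> + a \<le> dist (y j) (y (j+2))"
    and "a > 0"
  shows "dist (y i) (y (i + n)) + a \<le> dist (y i) (y (i + n + 1)) \<or> n = 0"
proof (induction n)
  case (Suc n)
  show ?case
  proof (cases "n = 0")
    case True
    then show ?thesis using step[of i] delta_pos by simp
  next
    case False
    then have IH: "dist (y i) (y (i + n)) + a \<le> dist (y i) (y (i + n + 1))" using Suc by simp
    have "dist (y i) (y (i+n+1)) + dist (y (i+n)) (y (i+n+2)) \<le>
        max (dist (y i) (y (i+n)) + dist (y (i+n+1)) (y (i+n+2)))
            (dist (y i) (y (i+n+2)) + dist (y (i+n+1)) (y (i+n))) + 2 * \<delta>"
      by (rule four_point_dist)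
    moreover have "dist (y (i+n)) (y (i+n+1)) + 2*\<delta> + a \<le> dist (y (i+n)) (y (i+n+2))"
        "dist (y (i+n+1)) (y (i+n+2)) + 2*\<delta> + a \<le> dist (y (i+n)) (y (i+n+2))"
      using step[of "i+n"] by (auto simp: algebra_simps)
    moreover have "dist (y (i+n+1)) (y (i+n)) = dist (y (i+n)) (y (i+n+1))" by (rule dist_commute)
    ultimately have "dist (y i) (y (i+n+1)) + a \<le> dist (y i) (y (i+n+2))"
      using IH assms(2) delta_pos by argo
    then show ?thesis by simp
  qed
qed simp

lemma chain_growth_forward:
  fixes y :: "nat \<Rightarrow> 'a"
  assumes step: "\<And>j. max (dist (y j) (y (j+1))) (dist (y (j+1)) (y (j+2))) + 2 * \<delta> + a \<le> dist (y j) (y (j+2))"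
    and a: "a > 0" and "i < j"
  shows "dist (y i) (y j) + a \<le> dist (y i) (y (Suc j))"
  using chain_growth[OF step a, of i "j - i"] assms(3) by simp

text \<open>Mirror image of \<open>chain_growth\<close>. The chain has no last point from which to
  reverse it, so the induction runs over \<open>k - Suc i\<close>.\<close>

lemma chain_growth_backward:
  fixes y :: "nat \<Rightarrow> 'a"
  assumes step: "\<And>j. max (dist (y j) (y (j+1))) (dist (y (j+1)) (y (j+2))) + 2 * \<delta> + a \<le> dist (y j) (y (j+2))"
    and a: "a > 0" and "Suc i < k"
  shows "dist (y (Suc i)) (y k) + a \<le> dist (y i) (y k)"
  using assms(3)
proof (induction "k - Suc i" arbitrary: i)
  case (Suc n)
  show ?case
  proof (cases "Suc (Suc i) = k")
    case True
    then have k: "k = i + 2" "Suc i = i + 1" by simp_all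
    show ?thesis unfolding k using step[of i] delta_pos by linarith
  next
    case False
    then have IH: "dist (y (Suc (Suc i))) (y k) + a \<le> dist (y (Suc i)) (y k)" using Suc by auto
    have "dist (y (Suc i)) (y k) + dist (y i) (y (Suc (Suc i))) \<le>
        max (dist (y (Suc i)) (y i) + dist (y k) (y (Suc (Suc i))))
            (dist (y (Suc i)) (y (Suc (Suc i))) + dist (y k) (y i)) + 2 * \<delta>"
      by (rule four_point_dist)
    moreover have "dist (y i) (y (Suc i)) + 2*\<delta> + a \<le> dist (y i) (y (Suc (Suc i)))"
        "dist (y (Suc i)) (y (Suc (Suc i))) + 2*\<delta> + a \<le> dist (y i) (y (Suc (Suc i)))"
      using step[of i] by auto
    moreover have "dist (y (Suc i)) (y i) = dist (y i) (y (Suc i))" "dist (y k) (y i) = dist (y i) (y k)"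
        "dist (y k) (y (Suc (Suc i))) = dist (y (Suc (Suc i))) (y k)" by (simp_all add: dist_commute)
    ultimately show ?thesis using IH a delta_pos by argo
  qed
qed simp

text \<open>The edge from \<open>y j\<close> to \<open>y (Suc j)\<close> is the hinge. Forward
  growth seen from \<open>y i\<close> and backward growth seen from \<open>y k\<close> make the
  first sum in \<open>four_point_dist\<close> smaller than the left side by \<open>2 * a\<close>,
  more than the error \<open>2 * \<delta>\<close>. Hence the sum containing
  \<open>dist (y i) (y k)\<close> is the one that counts. The constant \<open>2 * D\<close> is
  dictated by the case \<open>Suc j = k\<close>.\<close>

lemma chain_almost_geodesic:
  fixes y :: "nat \<Rightarrow> 'a"
  assumes step: "\<And>j. max (dist (y j) (y (j+1))) (dist (y (j+1)) (y (j+2))) + 2 * \<delta> + a \<le> dist (y j) (y (j+2))"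
    and a: "a > \<delta>" and D: "\<And>j. dist (y j) (y (Suc j)) \<le> D" and ijk: "i \<le> j" "j \<le> k"
  shows "dist (y i) (y j) + dist (y j) (y k) - (2 * D + 2 * \<delta>) \<le> dist (y i) (y k)"
proof -
  have a0: "a > 0" using a delta_pos by simp
  have D0: "0 \<le> D" using D[of 0] zero_le_dist order_trans by blast
  consider "i = j" | "j = k" | "Suc j = k" | "i < j" "Suc j < k" using ijk by linarith
  then show ?thesis
  proof cases
    case 3
    have "dist (y i) (y j) \<le> dist (y i) (y k) + dist (y k) (y j)" by (rule dist_triangle)
    then show ?thesis using D[of j] 3 delta_pos D0 dist_commute[of "y j" "y k"] by simp
  next
    case 4
    have "dist (y i) (y (Suc j)) + dist (y j) (y k) \<le>
        max (dist (y i) (y j) + dist (y (Suc j)) (y k)) (dist (y i) (y k) + dist (y (Suc j)) (y j)) + 2 * \<delta>"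
      by (rule four_point_dist)
    moreover have "dist (y i) (y j) + a \<le> dist (y i) (y (Suc j))"
      by (rule chain_growth_forward[OF step a0 4(1)])
    moreover have "dist (y (Suc j)) (y k) + a \<le> dist (y j) (y k)"
      by (rule chain_growth_backward[OF step a0 4(2)])
    moreover have "dist (y (Suc j)) (y j) \<le> D" using D[of j] by (simp add: dist_commute)
    ultimately show ?thesis using a delta_pos D0 by argo
  qed (use D0 delta_pos in auto)
qed

lemma chain_linear_growth:
  fixes y :: "nat \<Rightarrow> 'a"
  assumes step: "\<And>j. max (dist (y j) (y (j+1))) (dist (y (j+1)) (y (j+2))) + 2 * \<delta> + a \<le> dist (y j) (y (j+2))"
    and a: "a > 0"
  shows "a * (real n - 1) \<le> dist (y i) (y (i + n))"
proof (induction n)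
  case (Suc n)
  show ?case
  proof (cases "n = 0")
    case False
    have "dist (y i) (y (i + n)) + a \<le> dist (y i) (y (Suc (i + n)))"
      by (rule chain_growth_forward[OF step a]) (use False in simp)
    then show ?thesis using Suc by (simp add: algebra_simps)
  qed simp
qed (use a in simp)

end

section \<open>Geodesic rays and the Gromov boundary\<close>

lemma gromov_product_ray:
  assumes "geodesic_ray \<gamma>" "s \<ge> 0" "t \<ge> 0"
  shows "gromov_product (\<gamma> 0) (\<gamma> s) (\<gamma> t) = min s t"
proof -
  have "dist (\<gamma> s) (\<gamma> 0) = s" "dist (\<gamma> t) (\<gamma> 0) = t" "dist (\<gamma> s) (\<gamma> t) = \<bar>s - t\<bar>"
    using assms unfolding geodesic_ray_def by auto
  then show ?thesis by (simp add: gromov_product_def min_def)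
qed

lemma ray_class_self: "geodesic_ray \<gamma> \<Longrightarrow> \<gamma> \<in> ray_class \<gamma>"
  unfolding ray_class_def by (auto intro: exI[of _ 0])

lemma ray_class_cong:
  assumes "\<gamma>' \<in> ray_class \<gamma>" shows "ray_class \<gamma>' = ray_class \<gamma>"
proof -
  obtain C where C: "\<forall>t\<ge>0. dist (\<gamma> t) (\<gamma>' t) \<le> C" using assms unfolding ray_class_def by blast
  have 1: "\<exists>D. \<forall>t\<ge>0. dist (\<gamma>' t) (\<beta> t) \<le> D" if D: "\<forall>t\<ge>0. dist (\<gamma> t) (\<beta> t) \<le> D" for \<beta> D
  proof (intro exI[of _ "C + D"] allI impI)
    fix t :: real assume "t \<ge> 0"
    then show "dist (\<gamma>' t) (\<beta> t) \<le> C + D"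
      using C D dist_triangle3[of "\<gamma>' t" "\<beta> t" "\<gamma> t"] by force
  qed
  have 2: "\<exists>D. \<forall>t\<ge>0. dist (\<gamma> t) (\<beta> t) \<le> D" if D: "\<forall>t\<ge>0. dist (\<gamma>' t) (\<beta> t) \<le> D" for \<beta> D
  proof (intro exI[of _ "C + D"] allI impI)
    fix t :: real assume "t \<ge> 0"
    then show "dist (\<gamma> t) (\<beta> t) \<le> C + D"
      using C D dist_triangle[of "\<gamma> t" "\<beta> t" "\<gamma>' t"] by force
  qed
  show ?thesis unfolding ray_class_def using 1 2 by blast
qed

lemma gromov_boundary_rayD:
  assumes "\<eta> \<in> gromov_boundary" "\<gamma> \<in> \<eta>"
  shows "geodesic_ray \<gamma>" "ray_class \<gamma> = \<eta>"
proof -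
  obtain \<beta> where "\<eta> = ray_class \<beta>" using assms(1) unfolding gromov_boundary_def by blast
  then show "geodesic_ray \<gamma>" "ray_class \<gamma> = \<eta>" 
    using assms(2) ray_class_cong[of \<gamma> \<beta>] by (auto simp: ray_class_def)
qed

context hyperbolic_metric
begin

text \<open>Instead of extracting a subsequence, take a cluster point of the geodesics from \<open>p\<close> to \<open>x n\<close>
  in the compact product of the balls \<open>cball p \<bar>t\<bar>\<close>.\<close>

lemma cluster_ray:
  fixes x :: "nat \<Rightarrow> 'a"
  assumes inf: "filterlim (\<lambda>n. dist p (x n)) at_top sequentially"
  shows "\<exists>\<gamma>. geodesic_ray \<gamma> \<and> \<gamma> 0 = p \<and> (\<forall>t\<ge>0. \<exists>\<^sub>F n in sequentially. t - 1 \<le> gp (x n) (\<gamma> t))"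
proof -
  define d where "d n = dist p (x n)" for n
  have d: "eventually (\<lambda>n. t \<le> d n) sequentially" for t
    using inf unfolding filterlim_at_top d_def by blast
  have "\<exists>c. c 0 = p \<and> c (d n) = x n \<and> (\<forall>s\<in>{0..d n}. \<forall>t\<in>{0..d n}. dist (c s) (c t) = \<bar>s - t\<bar>)" for n
    using geodesic unfolding geodesic_space_def geodesic_segment_def d_def by metis
  then obtain c where c: "\<And>n. c n 0 = p" "\<And>n. c n (d n) = x n"
      "\<And>n s t. s \<in> {0..d n} \<Longrightarrow> t \<in> {0..d n} \<Longrightarrow> dist (c n s) (c n t) = \<bar>s - t\<bar>" by metis
  \<comment> \<open>Clamping the parameter to \<open>{0..d n}\<close> turns the geodesic segments
    into total functions lying in one product of balls.\<close>
  define g where "g n t = c n (max 0 (min t (d n)))" for n t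
  have d0: "d n \<ge> 0" for n unfolding d_def by simp
  define K where "K = PiE UNIV (\<lambda>t. cball p \<bar>t\<bar>)"
  have gK: "g n \<in> K" for n
    unfolding K_def
  proof (intro PiE_I)
    fix t
    have "dist (c n 0) (g n t) = \<bar>0 - max 0 (min t (d n))\<bar>"
      unfolding g_def by (rule c(3)) (use d0[of n] in auto)
    then show "g n t \<in> cball p \<bar>t\<bar>" using c(1) by auto
  qed simp
  have "compactin (product_topology (\<lambda>_. euclidean) UNIV) K"
    unfolding K_def compactin_PiE by simp
  then have "compact K" by (simp add: euclidean_product_topology)
  moreover have "eventually (\<lambda>h. h \<in> K) (filtermap g sequentially)" using gK by (simp add: eventually_filtermap)
  moreover have "filtermap g sequentially \<noteq> bot" by (simp add: filtermap_bot_iff)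
  ultimately obtain \<gamma> where g: "inf (nhds \<gamma>) (filtermap g sequentially) \<noteq> bot"
    unfolding compact_filter by blast
  \<comment> \<open>A cluster point replaces a limit: each neighbourhood of \<open>\<gamma>\<close>
    is visited infinitely often, not eventually. This is why the conclusion speaks of frequently
    many \<open>n\<close>.\<close>
  have freq: "\<exists>\<^sub>F n in sequentially. P (g n)" if P: "eventually P (nhds \<gamma>)" for P
  proof (rule ccontr)
    assume "\<not> ?thesis"
    then have "eventually (\<lambda>h. \<not> P h) (filtermap g sequentially)"
      by (simp add: not_frequently eventually_filtermap)
    then have "eventually (\<lambda>h. False) (inf (nhds \<gamma>) (filtermap g sequentially))"
      using P unfolding eventually_inf by blast
    with g show False by (simp add: trivial_limit_def)
  qed
  have nh: "eventually (\<lambda>h. dist (h t) (\<gamma> t) < e) (nhds \<gamma>)" if "e > 0" for t e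
  proof -
    have "open {h :: real \<Rightarrow> 'a. dist (h t) (\<gamma> t) < e}"
      by (intro open_Collect_less continuous_intros continuous_on_product_coordinates)
    then show ?thesis using that unfolding eventually_nhds by auto
  qed
  have iso: "dist (g n s) (g n t) = \<bar>s - t\<bar>" if "s \<ge> 0" "t \<ge> 0" "s \<le> d n" "t \<le> d n" for n s t
    unfolding g_def using c(3)[of s n t] that by (simp add: max_def min_def)
  have ray: "dist (\<gamma> s) (\<gamma> t) = \<bar>s - t\<bar>" if "s \<ge> 0" "t \<ge> 0" for s t
  proof (rule ccontr)
    define e where "e = \<bar>dist (\<gamma> s) (\<gamma> t) - \<bar>s - t\<bar>\<bar> / 2"
    assume "\<not> ?thesis"
    then have e: "e > 0" unfolding e_def by simp
    have "\<exists>\<^sub>F n in sequentially. dist (g n s) (\<gamma> s) < e \<and> dist (g n t) (\<gamma> t) < e"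
      by (rule freq) (intro eventually_conj nh e)
    moreover have "eventually (\<lambda>n. s \<le> d n \<and> t \<le> d n) sequentially" by (intro eventually_conj d)
    ultimately have "\<exists>\<^sub>F n in sequentially. (s \<le> d n \<and> t \<le> d n) \<and> (dist (g n s) (\<gamma> s) < e \<and> dist (g n t) (\<gamma> t) < e)"
      by (rule frequently_eventually_conj)
    then obtain n where n: "s \<le> d n" "t \<le> d n" "dist (g n s) (\<gamma> s) < e" "dist (g n t) (\<gamma> t) < e"
      using frequently_ex by blast
    have "dist (g n s) (g n t) \<le> dist (g n s) (\<gamma> s) + dist (\<gamma> s) (\<gamma> t) + dist (g n t) (\<gamma> t)"
      "dist (\<gamma> s) (\<gamma> t) \<le> dist (g n s) (\<gamma> s) + dist (g n s) (g n t) + dist (g n t) (\<gamma> t)"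
      by (metis add.commute add_mono dist_commute dist_triangle dist_triangle_le order_refl)+
    with n iso[OF that n(1,2)] show False unfolding e_def by argo
  qed
  have "g n 0 = p" for n using c(1) d0[of n] by (simp add: g_def)
  then have "dist p (\<gamma> 0) < e" if "e > 0" for e
    using frequently_ex[OF freq[OF nh[OF that, of 0]]] by auto
  then have "\<gamma> 0 = p" by (metis dist_pos_lt order_less_irrefl)
  moreover have "\<exists>\<^sub>F n in sequentially. t - 1 \<le> gp (x n) (\<gamma> t)" if t: "t \<ge> 0" for t
  proof -
    have "\<exists>\<^sub>F n in sequentially. t \<le> d n \<and> dist (g n t) (\<gamma> t) < 1"
      by (rule frequently_eventually_conj[OF freq[OF nh] d]) simp
    then show ?thesis
    proof (rule frequently_elim1)
      fix n assume n: "t \<le> d n \<and> dist (g n t) (\<gamma> t) < 1"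
      have "g n (d n) = x n" "g n 0 = p" using c d0[of n] by (auto simp: g_def)
      \<comment> \<open>On a geodesic from \<open>p\<close> to \<open>x n\<close> the product with
        the end is the parameter itself; replacing \<open>g n t\<close> by \<open>\<gamma> t\<close>
        costs their distance, less than 1.\<close>
      then have "gp (x n) (g n t) = t"
        using iso[of "d n" t n] iso[of "d n" 0 n] iso[of t 0 n] n t unfolding gromov_product_def by simp
      moreover have "\<bar>gp (g n t) (x n) - gp (\<gamma> t) (x n)\<bar> \<le> dist (g n t) (\<gamma> t)" by (rule gromov_product_lipschitz)
      ultimately show "t - 1 \<le> gp (x n) (\<gamma> t)" 
        using n gromov_product_commute[of p "x n" "g n t"] gromov_product_commute[of p "x n" "\<gamma> t"] by argo
    qed
  qed
  moreover have "geodesic_ray \<gamma>" using ray unfolding geodesic_ray_def by blast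
  ultimately show ?thesis by blast
qed

lemma dist_from_gp: "dist x y = dist x p + dist y p - 2 * gp x y"
  unfolding gromov_product_def by argo

lemma ray_gp_ge:
  assumes "geodesic_ray \<gamma>" "s \<ge> 0" "t \<ge> 0"
  shows "min s t - dist p (\<gamma> 0) \<le> gp (\<gamma> s) (\<gamma> t)"
  using gromov_product_ray[OF assms] gromov_product_basepoint[of p "\<gamma> s" "\<gamma> t" "\<gamma> 0"] by linarith

text \<open>Geodesics from \<open>p\<close> to far points of \<open>\<beta>\<close> cluster at a ray
  \<open>\<gamma>\<close>. It stays close to \<open>\<beta>\<close> because at time \<open>t\<close>
  the Gromov product of the two points is at least \<open>t\<close> up to a constant, while neither
  is farther than \<open>t + D\<close> from \<open>p\<close>.\<close>

lemma boundary_ray_from_base: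
  assumes "\<eta> \<in> gromov_boundary"
  shows "\<exists>\<gamma>\<in>\<eta>. \<gamma> 0 = p"
proof -
  obtain \<beta> where b: "geodesic_ray \<beta>" "\<eta> = ray_class \<beta>" using assms unfolding gromov_boundary_def by blast
  define D where "D = dist p (\<beta> 0)"
  have db: "t - D \<le> dist p (\<beta> t)" "dist p (\<beta> t) \<le> t + D" if "t \<ge> 0" for t
  proof -
    have "dist (\<beta> 0) (\<beta> t) = t" using b(1) that unfolding geodesic_ray_def by force
    then show "t - D \<le> dist p (\<beta> t)" "dist p (\<beta> t) \<le> t + D"
      using dist_triangle[of "\<beta> 0" "\<beta> t" p] dist_triangle[of p "\<beta> t" "\<beta> 0"] unfolding D_def
      by (auto simp: dist_commute)
  qed
  have "filterlim (\<lambda>n. dist p (\<beta> (real n))) at_top sequentially"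
    unfolding filterlim_at_top
  proof
    fix Z
    have "eventually (\<lambda>n. Z + D \<le> real n) sequentially"
      by (metis filterlim_at_top filterlim_real_sequentially)
    then show "eventually (\<lambda>n. Z \<le> dist p (\<beta> (real n))) sequentially"
      by eventually_elim (use db(1) in \<open>smt (verit) of_nat_0_le_iff\<close>)
  qed
  then obtain \<gamma> where g: "geodesic_ray \<gamma>" "\<gamma> 0 = p"
      "\<forall>t\<ge>0. \<exists>\<^sub>F n in sequentially. t - 1 \<le> gp (\<beta> (real n)) (\<gamma> t)"
    using cluster_ray[of "\<lambda>n. \<beta> (real n)"] by blast
  have "dist (\<beta> t) (\<gamma> t) \<le> 3 * D + 2 + 2 * \<delta>" if t: "t \<ge> 0" for t
  proof -
    have "eventually (\<lambda>n. t \<le> real n) sequentially"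
      by (metis filterlim_at_top filterlim_real_sequentially)
    from frequently_eventually_conj[OF g(3)[rule_format, OF t] this]
    obtain n where n: "t - 1 \<le> gp (\<beta> (real n)) (\<gamma> t)" "t \<le> real n" using frequently_ex by blast
    have "t - D \<le> gp (\<beta> t) (\<beta> (real n))" using ray_gp_ge[OF b(1) t, of "real n"] n unfolding D_def by simp
    then have "t - D - 1 - \<delta> \<le> gp (\<beta> t) (\<gamma> t)" 
      using four_point_ge[of "t - D - 1" "\<beta> t" "\<beta> (real n)" "\<gamma> t"] n(1) unfolding D_def
      by (smt (verit) zero_le_dist)
    moreover have "dist (\<gamma> t) p = t" using g(1,2) t unfolding geodesic_ray_def by force
    moreover have "dist (\<beta> t) p \<le> t + D" using db(2)[OF t] by (simp add: dist_commute)
    ultimately show ?thesis using dist_from_gp[of "\<beta> t" "\<gamma> t"] by linarith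
  qed
  then have "\<gamma> \<in> \<eta>" using g(1) unfolding b(2) ray_class_def by blast
  then show ?thesis using g(2) by blast
qed

text \<open>The ray \<open>rep \<eta>\<close> issuing from \<open>p\<close> stands for the boundary point \<open>\<eta>\<close>, and \<open>trace\<close> treats points
  of the space as constant paths, so that Gromov products of arbitrary points of the
  compactification obey a single four-point inequality.\<close>

definition rep :: "(real \<Rightarrow> 'a) set \<Rightarrow> real \<Rightarrow> 'a" where
  "rep \<eta> = (SOME \<gamma>. \<gamma> \<in> \<eta> \<and> \<gamma> 0 = p)"

definition trace :: "'a gromov_pt \<Rightarrow> real \<Rightarrow> 'a" where
  "trace z t = (case z of Inl x \<Rightarrow> x | Inr \<eta> \<Rightarrow> rep \<eta> t)"

text \<open>A predicate rather than a number, since the product of a boundary point with itself is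
  infinite.\<close>

definition gp_ge :: "'a gromov_pt \<Rightarrow> 'a gromov_pt \<Rightarrow> real \<Rightarrow> bool" where
  "gp_ge z w r \<longleftrightarrow> (\<exists>T. \<forall>s\<ge>T. \<forall>t\<ge>T. r \<le> gp (trace z s) (trace w t))"

lemma trace_simps [simp]: "trace (Inl x) t = x" "trace (Inr \<eta>) t = rep \<eta> t"
  by (simp_all add: trace_def)

lemma rep:
  assumes "\<eta> \<in> gromov_boundary"
  shows "rep \<eta> \<in> \<eta>" "rep \<eta> 0 = p" "geodesic_ray (rep \<eta>)" "ray_class (rep \<eta>) = \<eta>"
proof -
  have "rep \<eta> \<in> \<eta> \<and> rep \<eta> 0 = p"
    unfolding rep_def using boundary_ray_from_base[OF assms] by (intro someI_ex[of "\<lambda>\<gamma>. \<gamma> \<in> \<eta> \<and> \<gamma> 0 = p"]) blast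
  then show "rep \<eta> \<in> \<eta>" "rep \<eta> 0 = p" "geodesic_ray (rep \<eta>)" "ray_class (rep \<eta>) = \<eta>"
    using gromov_boundary_rayD[OF assms] by auto
qed

lemma rep_dist:
  assumes "\<eta> \<in> gromov_boundary" "s \<ge> 0" 
  shows "t \<ge> 0 \<Longrightarrow> dist (rep \<eta> s) (rep \<eta> t) = \<bar>s - t\<bar>" "dist (rep \<eta> s) p = s"
  using rep(2,3)[OF assms(1)] assms(2) unfolding geodesic_ray_def by force+

lemma rep_gp:
  assumes "\<eta> \<in> gromov_boundary" "s \<ge> 0" "t \<ge> 0" 
  shows "gp (rep \<eta> s) (rep \<eta> t) = min s t"
  using gromov_product_ray[OF rep(3)[OF assms(1)] assms(2,3)] rep(2)[OF assms(1)] by simp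

lemma gp_ge_sym:
  assumes "gp_ge z w r" shows "gp_ge w z r"
proof -
  obtain T where T: "\<And>s t. s \<ge> T \<Longrightarrow> t \<ge> T \<Longrightarrow> r \<le> gp (trace z s) (trace w t)"
    using assms unfolding gp_ge_def by blast
  have "r \<le> gp (trace w s) (trace z t)" if "s \<ge> T" "t \<ge> T" for s t
    using T[OF that(2,1)] gromov_product_commute[of p "trace w s" "trace z t"] by simp
  then show ?thesis unfolding gp_ge_def by blast
qed

lemma gp_ge_mono: "gp_ge z w r \<Longrightarrow> s \<le> r \<Longrightarrow> gp_ge z w s"
  unfolding gp_ge_def by (metis (no_types) order_trans[of s r])

lemma gp_ge_trans:
  assumes "gp_ge z y r" "gp_ge y w r" shows "gp_ge z w (r - \<delta>)"
proof -
  obtain T T' where "\<forall>s\<ge>T. \<forall>t\<ge>T. r \<le> gp (trace z s) (trace y t)" "\<forall>s\<ge>T'. \<forall>t\<ge>T'. r \<le> gp (trace y s) (trace w t)"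
    using assms unfolding gp_ge_def by blast
  then show ?thesis
    unfolding gp_ge_def
    by (intro exI[of _ "max T T'"] allI impI four_point_ge[of _ _ "trace y (max T T')"]) auto
qed

lemma same_class_gp_ge:
  assumes "\<eta> \<in> gromov_boundary" "\<gamma> \<in> \<eta>" "\<beta> \<in> \<eta>"
  shows "\<exists>T. \<forall>s\<ge>T. \<forall>t\<ge>T. r \<le> gp (\<gamma> s) (\<beta> t)"
proof -
  note g = gromov_boundary_rayD[OF assms(1,2)]
  obtain C where C: "\<And>t. t \<ge> 0 \<Longrightarrow> dist (\<gamma> t) (\<beta> t) \<le> C"
    using assms(3) unfolding g(2)[symmetric] ray_class_def by blast
  have "r \<le> gp (\<gamma> s) (\<beta> t)" if "s \<ge> max 0 (r + dist p (\<gamma> 0) + C)" "t \<ge> max 0 (r + dist p (\<gamma> 0) + C)" for s t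
  proof -
    have "min s t - dist p (\<gamma> 0) \<le> gp (\<gamma> s) (\<gamma> t)" by (rule ray_gp_ge[OF g(1)]) (use that in auto)
    moreover have "\<bar>gp (\<gamma> t) (\<gamma> s) - gp (\<beta> t) (\<gamma> s)\<bar> \<le> dist (\<gamma> t) (\<beta> t)" by (rule gromov_product_lipschitz)
    moreover have "dist (\<gamma> t) (\<beta> t) \<le> C" using C that by simp
    ultimately show ?thesis 
      using that gromov_product_commute[of p "\<gamma> s" "\<gamma> t"] gromov_product_commute[of p "\<gamma> s" "\<beta> t"] by argo
  qed
  then show ?thesis by blast
qed

lemma gp_ge_self: "\<eta> \<in> gromov_boundary \<Longrightarrow> gp_ge (Inr \<eta>) (Inr \<eta>) r"
  unfolding gp_ge_def using same_class_gp_ge[of \<eta> "rep \<eta>" "rep \<eta>"] rep(1) by simp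

lemma gp_ge_Inl_iff: "gp_ge (Inl x) (Inr \<eta>) r \<longleftrightarrow> (\<exists>T. \<forall>t\<ge>T. r \<le> gp x (rep \<eta> t))"
  unfolding gp_ge_def by auto

lemma gp_ge_Inl_le: "gp_ge (Inl x) w r \<Longrightarrow> r \<le> dist x p"
  unfolding gp_ge_def trace_simps using order_trans[OF _ gromov_product_le_dist[of p x]] by blast

lemma gp_ge_Inl_lipschitz:
  assumes "gp_ge (Inl x) w r" "dist x y \<le> e" shows "gp_ge (Inl y) w (r - e)"
proof -
  have "r - e \<le> gp y u" if "r \<le> gp x u" for u
    using gromov_product_lipschitz[of p x u y] that assms(2) by linarith
  then show ?thesis using assms(1) unfolding gp_ge_def trace_simps by blast
qed

text \<open>Comparing \<open>y\<close> with a far point of the ray shows that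
  \<open>rep \<eta> r\<close> almost lies on a geodesic from \<open>p\<close> to \<open>y\<close>:
  the detour costs at most \<open>2 * \<delta>\<close>. This is how products with a boundary point
  become distance estimates.\<close>

lemma gp_ge_imp_dist:
  assumes "\<eta> \<in> gromov_boundary" "gp_ge (Inl y) (Inr \<eta>) r" "0 \<le> r"
  shows "dist y (rep \<eta> r) \<le> dist y p - r + 2 * \<delta>"
proof -
  obtain T where T: "\<forall>t\<ge>T. r \<le> gp y (rep \<eta> t)" using assms(2) gp_ge_Inl_iff by blast
  define t where "t = max T r"
  have "r \<le> gp y (rep \<eta> t)" using T unfolding t_def by simp
  moreover have "r \<le> gp (rep \<eta> t) (rep \<eta> r)" using rep_gp[OF assms(1), of t r] assms(3) unfolding t_def by simp
  ultimately have "r - \<delta> \<le> gp y (rep \<eta> r)" by (rule four_point_ge)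
  then show ?thesis using dist_from_gp[of y "rep \<eta> r"] rep_dist(2)[OF assms(1,3)] by simp
qed

lemma gp_ge_rep:
  assumes "\<eta> \<in> gromov_boundary" "0 \<le> t" shows "gp_ge (Inl (rep \<eta> t)) (Inr \<eta>) t"
  unfolding gp_ge_Inl_iff by (intro exI[of _ t]) (use rep_gp[OF assms] assms(2) in auto)

lemma gp_ge_imp_eq:
  assumes e: "\<eta> \<in> gromov_boundary" and x: "\<xi> \<in> gromov_boundary" and "\<And>r. gp_ge (Inr \<eta>) (Inr \<xi>) r"
  shows "\<eta> = \<xi>"
proof -
  have "dist (rep \<eta> t) (rep \<xi> t) \<le> 4 * \<delta>" if t: "t \<ge> 0" for t
  proof -
    have "gp_ge (Inl (rep \<eta> t)) (Inr \<xi>) (t - \<delta>)"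
      using gp_ge_trans[OF gp_ge_rep[OF e t] assms(3)] .
    moreover have "gp_ge (Inl (rep \<xi> t)) (Inr \<xi>) (t - \<delta>)"
      using gp_ge_rep[OF x t] by (rule gp_ge_mono) (use delta_pos in simp)
    ultimately have "gp_ge (Inl (rep \<eta> t)) (Inl (rep \<xi> t)) (t - \<delta> - \<delta>)"
      using gp_ge_trans gp_ge_sym by blast
    then have "t - 2 * \<delta> \<le> gp (rep \<eta> t) (rep \<xi> t)" unfolding gp_ge_def by auto
    then show ?thesis
      using dist_from_gp[of "rep \<eta> t" "rep \<xi> t"] rep_dist(2)[OF e t] rep_dist(2)[OF x t] by simp
  qed
  then have "rep \<xi> \<in> ray_class (rep \<eta>)" using rep(3)[OF x] unfolding ray_class_def by blast
  then show ?thesis using ray_class_cong rep(4)[OF e] rep(4)[OF x] by blast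
qed

text \<open>\<open>gromov_nbhd\<close> allows any ray of a class, \<open>gp_ge\<close> only the
  chosen one. Exchanging the ray costs \<open>\<delta>\<close> for each boundary point involved,
  hence at most \<open>2 * \<delta>\<close>.\<close>

lemma gromov_nbhd_imp_gp_ge:
  assumes e: "\<eta> \<in> gromov_boundary" and z: "z \<in> gromov_nbhd p \<eta> r"
  shows "gp_ge z (Inr \<eta>) (r - 2 * \<delta>)"
proof (cases z)
  case (Inl x)
  then obtain \<gamma> where "\<gamma> \<in> \<eta>" "\<forall>\<^sub>F t in at_top. r \<le> gp x (\<gamma> t)" using z by (auto simp: gromov_nbhd_def)
  then obtain T where T: "\<And>t. t \<ge> T \<Longrightarrow> r \<le> gp x (\<gamma> t)" unfolding eventually_at_top_linorder by blast
  obtain T' where T': "\<forall>s\<ge>T'. \<forall>t\<ge>T'. r \<le> gp (\<gamma> s) (rep \<eta> t)"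
    using same_class_gp_ge[OF e \<open>\<gamma> \<in> \<eta>\<close> rep(1)[OF e]] by blast
  have "r - \<delta> \<le> gp x (rep \<eta> t)" if "t \<ge> T'" for t
    by (rule four_point_ge[of _ _ "\<gamma> (max T T')"]) (use T T' that in auto)
  then have "gp_ge z (Inr \<eta>) (r - \<delta>)" unfolding Inl gp_ge_Inl_iff by blast
  then show ?thesis by (rule gp_ge_mono) (use delta_pos in simp)
next
  case (Inr \<xi>)
  then obtain \<gamma> \<gamma>' T where x: "\<xi> \<in> gromov_boundary" and g: "\<gamma> \<in> \<eta>" "\<gamma>' \<in> \<xi>"
    and T: "\<forall>s\<ge>T. \<forall>t\<ge>T. r \<le> gp (\<gamma> s) (\<gamma>' t)" using z unfolding gromov_nbhd_def by blast
  obtain T1 where T1: "\<forall>s\<ge>T1. \<forall>t\<ge>T1. r \<le> gp (\<gamma> s) (rep \<eta> t)"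
    using same_class_gp_ge[OF e g(1) rep(1)[OF e]] by blast
  obtain T2 where T2: "\<forall>s\<ge>T2. \<forall>t\<ge>T2. r \<le> gp (rep \<xi> s) (\<gamma>' t)"
    using same_class_gp_ge[OF x rep(1)[OF x] g(2)] by blast
  define M where "M = max T (max T1 T2)"
  have "r - 2 * \<delta> \<le> gp (rep \<xi> s) (rep \<eta> t)" if "s \<ge> M" "t \<ge> M" for s t
  proof -
    have "r \<le> gp (rep \<xi> s) (\<gamma>' M)" using T2 that unfolding M_def by auto
    moreover have "r \<le> gp (\<gamma>' M) (\<gamma> M)" using T gromov_product_commute unfolding M_def by (metis max.cobounded1)
    ultimately have "r - \<delta> \<le> gp (rep \<xi> s) (\<gamma> M)" by (rule four_point_ge)
    moreover have "r - \<delta> \<le> gp (\<gamma> M) (rep \<eta> t)"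
      using T1[rule_format, of M t] that delta_pos unfolding M_def by force
    ultimately show ?thesis using four_point_ge by fastforce
  qed
  then show ?thesis unfolding Inr gp_ge_def trace_simps by blast
qed

lemma gromov_nbhd_basepoint:
  "gromov_nbhd q \<eta> (r + dist q q') \<subseteq> gromov_nbhd q' \<eta> r"
proof
  fix z assume z: "z \<in> gromov_nbhd q \<eta> (r + dist q q')"
  have *: "r \<le> gromov_product q' u v" if "r + dist q q' \<le> gromov_product q u v" for u v
    using gromov_product_basepoint[of q u v q'] that by linarith
  show "z \<in> gromov_nbhd q' \<eta> r"
  proof (cases z)
    case (Inl x)
    then obtain \<gamma> where "\<gamma> \<in> \<eta>" "\<forall>\<^sub>F t in at_top. r + dist q q' \<le> gromov_product q x (\<gamma> t)"
      using z by (auto simp: gromov_nbhd_def)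
    moreover from this(2) have "\<forall>\<^sub>F t in at_top. r \<le> gromov_product q' x (\<gamma> t)"
      by eventually_elim (rule *)
    ultimately show ?thesis unfolding Inl gromov_nbhd_def by blast
  next
    case (Inr \<xi>)
    then obtain \<gamma> \<gamma>' T where "\<xi> \<in> gromov_boundary" "\<gamma> \<in> \<eta>" "\<gamma>' \<in> \<xi>"
      and T: "\<forall>s\<ge>T. \<forall>t\<ge>T. r + dist q q' \<le> gromov_product q (\<gamma> s) (\<gamma>' t)"
      using z unfolding gromov_nbhd_def by blast
    moreover have "\<forall>s\<ge>T. \<forall>t\<ge>T. r \<le> gromov_product q' (\<gamma> s) (\<gamma>' t)" using T * by blast
    ultimately show ?thesis unfolding Inr gromov_nbhd_def by blast
  qed
qed

lemma gp_ge_imp_gromov_nbhd: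
  assumes e: "\<eta> \<in> gromov_boundary" and z: "z \<in> gromov_compactification" "gp_ge z (Inr \<eta>) r"
  shows "z \<in> gromov_nbhd p \<eta> r"
proof (cases z)
  case (Inl x)
  then obtain T where "\<forall>t\<ge>T. r \<le> gp x (rep \<eta> t)" using z(2) gp_ge_Inl_iff by blast
  then have "\<forall>\<^sub>F t in at_top. r \<le> gp x (rep \<eta> t)" unfolding eventually_at_top_linorder by blast
  then show ?thesis using rep(1)[OF e] unfolding Inl gromov_nbhd_def by blast
next
  case (Inr \<xi>)
  then have x: "\<xi> \<in> gromov_boundary" using z(1) unfolding gromov_compactification_def by blast
  obtain T where "\<forall>s\<ge>T. \<forall>t\<ge>T. r \<le> gp (rep \<xi> s) (rep \<eta> t)" using z(2) unfolding Inr gp_ge_def trace_simps by blast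
  then have "\<forall>s\<ge>T. \<forall>t\<ge>T. r \<le> gp (rep \<eta> s) (rep \<xi> t)" using gromov_product_commute by metis
  then show ?thesis using rep(1)[OF e] rep(1)[OF x] x unfolding Inr gromov_nbhd_def by blast
qed

section \<open>The topology of the Gromov compactification\<close>

definition bdry_ball :: "(real \<Rightarrow> 'a) set \<Rightarrow> real \<Rightarrow> 'a gromov_pt set" where
  "bdry_ball \<eta> r = {z \<in> gromov_compactification. gp_ge z (Inr \<eta>) r}"

lemma Inl_in_compactification [simp]: "Inl x \<in> gromov_compactification"
  by (simp add: gromov_compactification_def)

lemma Inr_in_compactification [simp]: "Inr \<eta> \<in> gromov_compactification \<longleftrightarrow> \<eta> \<in> gromov_boundary"
  by (auto simp: gromov_compactification_def)

lemma gromov_nbhd_subset_compactification: "gromov_nbhd q \<eta> r \<subseteq> gromov_compactification"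
  unfolding gromov_nbhd_def gromov_compactification_def by blast

text \<open>A change of base point shifts the radius by the distance of the base points, and a
  change of rays by \<open>2 * \<delta>\<close>. So the quantification over all base points reduces
  to balls based at \<open>p\<close>.\<close>

lemma gromov_open_iff:
  "gromov_open U \<longleftrightarrow> U \<subseteq> gromov_compactification \<and> open {x. Inl x \<in> U} \<and>
     (\<forall>\<eta>. Inr \<eta> \<in> U \<longrightarrow> (\<exists>r. bdry_ball \<eta> r \<subseteq> U))"
proof -
  have "(\<forall>q. \<exists>r. gromov_nbhd q \<eta> r \<subseteq> U) \<longleftrightarrow> (\<exists>r. bdry_ball \<eta> r \<subseteq> U)" if e: "\<eta> \<in> gromov_boundary" for \<eta>
  proof
    assume "\<forall>q. \<exists>r. gromov_nbhd q \<eta> r \<subseteq> U"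
    then obtain r where "gromov_nbhd p \<eta> r \<subseteq> U" by blast
    then have "bdry_ball \<eta> r \<subseteq> U" using gp_ge_imp_gromov_nbhd[OF e] unfolding bdry_ball_def by blast
    then show "\<exists>r. bdry_ball \<eta> r \<subseteq> U" ..
  next
    assume "\<exists>r. bdry_ball \<eta> r \<subseteq> U"
    then obtain r where r: "bdry_ball \<eta> r \<subseteq> U" by blast
    have "gromov_nbhd p \<eta> (r + 2 * \<delta>) \<subseteq> bdry_ball \<eta> r"
      using gromov_nbhd_imp_gp_ge[OF e, of _ "r + 2 * \<delta>"] gromov_nbhd_subset_compactification[of p \<eta> "r + 2 * \<delta>"]
      unfolding bdry_ball_def by auto
    then have "gromov_nbhd q \<eta> (r + 2 * \<delta> + dist q p) \<subseteq> U" for q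
      using gromov_nbhd_basepoint[of q \<eta> "r + 2 * \<delta>" p] r by blast
    then show "\<forall>q. \<exists>r. gromov_nbhd q \<eta> r \<subseteq> U" by blast
  qed
  then show ?thesis
    unfolding gromov_open_def
    by (metis (no_types, lifting) Inr_in_compactification subsetD)
qed

lemma topspace_gromov [simp]: "topspace gromov_topology = (gromov_compactification :: 'a gromov_pt set)"
proof -
  have "gromov_open (gromov_compactification :: 'a gromov_pt set)"
    unfolding gromov_open_iff bdry_ball_def by auto
  then show ?thesis
    using openin_gromov_topology gromov_open_def openin_subset openin_topspace by (metis subset_antisym)
qed

text \<open>The balls need not be open. The witness is the set of points having a whole basic
  neighbourhood inside the ball; approximate transitivity of \<open>gp_ge\<close> makes this set
  open.\<close>

lemma bdry_ball_interior:
  assumes e: "\<eta> \<in> gromov_boundary"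
  obtains U where "openin gromov_topology U" "Inr \<eta> \<in> U" "U \<subseteq> bdry_ball \<eta> r"
proof -
  define U where "U = {z \<in> bdry_ball \<eta> r. case z of Inl x \<Rightarrow> (\<exists>e>0. \<forall>y. dist x y < e \<longrightarrow> Inl y \<in> bdry_ball \<eta> r)
      | Inr \<xi> \<Rightarrow> (\<exists>t. bdry_ball \<xi> t \<subseteq> bdry_ball \<eta> r)}"
  have Ul: "Inl x \<in> U \<longleftrightarrow> (\<exists>e>0. \<forall>y. dist x y < e \<longrightarrow> Inl y \<in> bdry_ball \<eta> r)" for x
    unfolding U_def by auto
  have Ur: "Inr \<xi> \<in> U \<longleftrightarrow> Inr \<xi> \<in> bdry_ball \<eta> r \<and> (\<exists>t. bdry_ball \<xi> t \<subseteq> bdry_ball \<eta> r)" for \<xi>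
    unfolding U_def by auto
  have "gromov_open U"
    unfolding gromov_open_iff
  proof (intro conjI allI impI)
    show "U \<subseteq> gromov_compactification" unfolding U_def bdry_ball_def by blast
    have "{x. Inl x \<in> U} = interior {x. Inl x \<in> bdry_ball \<eta> r}"
      unfolding Ul mem_interior set_eq_iff by (auto simp: subset_iff)
    then show "open {x. Inl x \<in> U}" by simp
    fix \<xi> assume "Inr \<xi> \<in> U"
    then obtain t where t: "bdry_ball \<xi> t \<subseteq> bdry_ball \<eta> r" and x: "\<xi> \<in> gromov_boundary"
      unfolding Ur bdry_ball_def by auto
    \<comment> \<open>The summand 1 allows for a unit ball around a point of the space,
      \<open>\<delta>\<close> for one four-point inequality around a boundary point.\<close>
    have "bdry_ball \<xi> (t + \<delta> + 1) \<subseteq> U"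
    proof
      fix z assume z: "z \<in> bdry_ball \<xi> (t + \<delta> + 1)"
      then have zg: "z \<in> gromov_compactification" "gp_ge z (Inr \<xi>) (t + \<delta> + 1)" unfolding bdry_ball_def by auto
      have "gp_ge z (Inr \<xi>) t" using zg(2) by (rule gp_ge_mono) (use delta_pos in simp)
      then have zt: "z \<in> bdry_ball \<eta> r" using t zg(1) unfolding bdry_ball_def by blast
      show "z \<in> U"
      proof (cases z)
        case (Inl x)
        have "Inl y \<in> bdry_ball \<eta> r" if "dist x y < 1" for y
        proof -
          have "gp_ge (Inl y) (Inr \<xi>) (t + \<delta> + 1 - 1)"
            by (rule gp_ge_Inl_lipschitz) (use zg(2) that Inl in auto)
          then have "gp_ge (Inl y) (Inr \<xi>) t" by (rule gp_ge_mono) (use delta_pos in simp)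
          then have "Inl y \<in> bdry_ball \<xi> t" unfolding bdry_ball_def by simp
          then show ?thesis using t by blast
        qed
        then show ?thesis unfolding Inl Ul by (intro exI[of _ 1]) auto
      next
        case (Inr \<zeta>)
        have "bdry_ball \<zeta> (t + \<delta>) \<subseteq> bdry_ball \<xi> t"
        proof
          fix w assume "w \<in> bdry_ball \<zeta> (t + \<delta>)"
          moreover have "gp_ge (Inr \<zeta>) (Inr \<xi>) (t + \<delta>)" using zg(2) Inr gp_ge_mono by auto
          ultimately show "w \<in> bdry_ball \<xi> t" using gp_ge_trans unfolding bdry_ball_def by fastforce
        qed
        then show ?thesis using zt t unfolding Inr Ur by blast
      qed
    qed
    then show "\<exists>r. bdry_ball \<xi> r \<subseteq> U" ..
  qed
  moreover have "Inr \<eta> \<in> U" using gp_ge_self[OF e] e unfolding Ur by (auto simp: bdry_ball_def)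
  moreover have "U \<subseteq> bdry_ball \<eta> r" unfolding U_def by blast
  ultimately show thesis using that openin_gromov_topology by metis
qed

text \<open>The bridge between the topology and Gromov products: convergence to a boundary point
  becomes divergence of the product with it.\<close>

lemma limitin_bdry_iff:
  "limitin gromov_topology (\<lambda>i. Inl (u i)) (Inr \<eta>) F \<longleftrightarrow>
     \<eta> \<in> gromov_boundary \<and> (\<forall>r. \<forall>\<^sub>F i in F. gp_ge (Inl (u i :: 'a)) (Inr \<eta>) r)"
proof (cases "\<eta> \<in> gromov_boundary")
  case e: True
  show ?thesis
  proof
    assume L: "limitin gromov_topology (\<lambda>i. Inl (u i)) (Inr \<eta>) F"
    have "\<forall>\<^sub>F i in F. gp_ge (Inl (u i)) (Inr \<eta>) r" for r
    proof -
      obtain U where "openin gromov_topology U" "Inr \<eta> \<in> U" "U \<subseteq> bdry_ball \<eta> r"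
        using bdry_ball_interior[OF e] by blast
      then have "\<forall>\<^sub>F i in F. Inl (u i) \<in> U" using L unfolding limitin_def by blast
      then show ?thesis by (rule eventually_mono) (use \<open>U \<subseteq> bdry_ball \<eta> r\<close> in \<open>auto simp: bdry_ball_def\<close>)
    qed
    then show "\<eta> \<in> gromov_boundary \<and> (\<forall>r. \<forall>\<^sub>F i in F. gp_ge (Inl (u i)) (Inr \<eta>) r)" using e by blast
  next
    assume R: "\<eta> \<in> gromov_boundary \<and> (\<forall>r. \<forall>\<^sub>F i in F. gp_ge (Inl (u i)) (Inr \<eta>) r)"
    show "limitin gromov_topology (\<lambda>i. Inl (u i)) (Inr \<eta>) F"
      unfolding limitin_def
    proof (intro conjI allI impI)
      show "Inr \<eta> \<in> topspace gromov_topology" using e by simp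
      fix U :: "'a gromov_pt set" assume "openin gromov_topology U \<and> Inr \<eta> \<in> U"
      then obtain r where r: "bdry_ball \<eta> r \<subseteq> U" unfolding openin_gromov_topology gromov_open_iff by blast
      have "\<forall>\<^sub>F i in F. gp_ge (Inl (u i)) (Inr \<eta>) r" using R by blast
      then show "\<forall>\<^sub>F i in F. Inl (u i) \<in> U"
        by (rule eventually_mono) (use r in \<open>auto simp: bdry_ball_def\<close>)
    qed
  qed
qed (simp add: limitin_def)

lemma converges_to_bdry_iff:
  "converges_to_bdry u \<eta> \<longleftrightarrow>
     \<eta> \<in> gromov_boundary \<and> (\<forall>r. \<forall>\<^sub>F n in sequentially. gp_ge (Inl (u n :: 'a)) (Inr \<eta>) r)"
  unfolding converges_to_bdry_def by (rule limitin_bdry_iff)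

lemma eventually_at_bdry_iff:
  assumes e: "\<eta> \<in> gromov_boundary"
  shows "eventually P (filtercomap Inl (nhdsin gromov_topology (Inr \<eta>))) \<longleftrightarrow>
    (\<exists>r. \<forall>z :: 'a. gp_ge (Inl z) (Inr \<eta>) r \<longrightarrow> P z)"
proof
  assume "eventually P (filtercomap Inl (nhdsin gromov_topology (Inr \<eta>)))"
  then obtain Q where Q: "eventually Q (nhdsin gromov_topology (Inr \<eta>))" "\<And>x. Q (Inl x) \<Longrightarrow> P x"
    unfolding eventually_filtercomap by blast
  then obtain U where U: "openin gromov_topology U" "Inr \<eta> \<in> U" "\<forall>x\<in>U. Q x"
    using e unfolding eventually_nhdsin by auto
  then obtain r where "bdry_ball \<eta> r \<subseteq> U" unfolding openin_gromov_topology gromov_open_iff by blast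
  then show "\<exists>r. \<forall>z. gp_ge (Inl z) (Inr \<eta>) r \<longrightarrow> P z"
    using U(3) Q(2) unfolding bdry_ball_def by (intro exI[of _ r]) (auto dest!: subsetD)
next
  assume "\<exists>r. \<forall>z. gp_ge (Inl z) (Inr \<eta>) r \<longrightarrow> P z"
  then obtain r where r: "\<And>z. gp_ge (Inl z) (Inr \<eta>) r \<Longrightarrow> P z" by blast
  obtain U where U: "openin gromov_topology U" "Inr \<eta> \<in> U" "U \<subseteq> bdry_ball \<eta> r"
    using bdry_ball_interior[OF e] by blast
  have "eventually (\<lambda>z. z \<in> U) (nhdsin gromov_topology (Inr \<eta>))"
    unfolding eventually_nhdsin using U by blast
  then show "eventually P (filtercomap Inl (nhdsin gromov_topology (Inr \<eta>)))"
    unfolding eventually_filtercomap using U(3) r by (intro exI[of _ "\<lambda>z. z \<in> U"]) (auto simp: bdry_ball_def)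
qed

lemma bdry_limit_exists:
  fixes x :: "nat \<Rightarrow> 'a"
  assumes "\<And>r. \<exists>N. \<forall>m\<ge>N. \<forall>n\<ge>N. r \<le> gp (x m) (x n)"
  obtains \<eta> where "\<eta> \<in> gromov_boundary" "converges_to_bdry x \<eta>"
proof -
  have "filterlim (\<lambda>n. dist p (x n)) at_top sequentially"
    unfolding filterlim_at_top
  proof
    fix Z
    obtain N where "\<forall>m\<ge>N. \<forall>n\<ge>N. Z \<le> gp (x m) (x n)" using assms by blast
    then have "\<forall>n\<ge>N. Z \<le> dist p (x n)"
      using gromov_product_le_dist[of p] by (metis dist_commute order_trans)
    then show "\<forall>\<^sub>F n in sequentially. Z \<le> dist p (x n)" unfolding eventually_sequentially by blast
  qed
  then obtain \<gamma> where g: "geodesic_ray \<gamma>" "\<gamma> 0 = p"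
      "\<forall>t\<ge>0. \<exists>\<^sub>F n in sequentially. t - 1 \<le> gp (x n) (\<gamma> t)"
    using cluster_ray[of x] by blast
  define \<eta> where "\<eta> = ray_class \<gamma>"
  have e: "\<eta> \<in> gromov_boundary" unfolding \<eta>_def gromov_boundary_def using g(1) by blast
  have "\<forall>\<^sub>F n in sequentially. gp_ge (Inl (x n)) (Inr \<eta>) r" for r
  proof -
    \<comment> \<open>One \<open>\<delta>\<close> is spent on inserting a late term
      \<open>x m\<close> that is close to the ray, two on passing from \<open>\<gamma>\<close> to
      \<open>rep \<eta>\<close>.\<close>
    define r' where "r' = r + 3 * \<delta>"
    obtain N where N: "\<forall>m\<ge>N. \<forall>n\<ge>N. r' \<le> gp (x m) (x n)" using assms by blast
    have "gp_ge (Inl (x n)) (Inr \<eta>) r" if n: "n \<ge> N" for n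
    proof -
      have "r' - \<delta> \<le> gp (x n) (\<gamma> t)" if t: "t \<ge> max 0 (r' + 1)" for t
      proof -
        have "\<exists>\<^sub>F m in sequentially. N \<le> m \<and> t - 1 \<le> gp (x m) (\<gamma> t)"
          by (rule frequently_eventually_conj[OF g(3)[rule_format]]) (use t eventually_ge_at_top in auto)
        then obtain m where m: "N \<le> m" "t - 1 \<le> gp (x m) (\<gamma> t)" using frequently_ex by blast
        show ?thesis
          by (rule four_point_ge[of _ _ "x m"]) (use N n m t in auto)
      qed
      then have "\<forall>\<^sub>F t in at_top. r' - \<delta> \<le> gp (x n) (\<gamma> t)" unfolding eventually_at_top_linorder by blast
      then have "Inl (x n) \<in> gromov_nbhd p \<eta> (r' - \<delta>)"
        using ray_class_self[OF g(1)] unfolding gromov_nbhd_def \<eta>_def by blast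
      from gromov_nbhd_imp_gp_ge[OF e this] show ?thesis unfolding r'_def by simp
    qed
    then show ?thesis unfolding eventually_sequentially by blast
  qed
  then show thesis using that e unfolding converges_to_bdry_iff by blast
qed

section \<open>Separation properties of the Gromov compactification\<close>

lemma openin_Inl_image: "open S \<Longrightarrow> openin gromov_topology (Inl ` S :: 'a gromov_pt set)"
  unfolding openin_gromov_topology gromov_open_iff by (auto simp: inj_image_mem_iff)

text \<open>Regularity of the target is what extension by pointwise limits asks for; it serves the
  construction of \<open>\<Phi>\<close>. At a boundary point it holds because passing to the closure
  lowers products with \<open>\<eta>\<close> only by a constant: 1 at a point of the space,
  \<open>\<delta>\<close> at a boundary point.\<close>

lemma regular_space_gromov: "regular_space (gromov_topology :: 'a gromov_pt topology)"
  unfolding regular_space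
proof (intro allI impI)
  fix C :: "'a gromov_pt set" and a assume "closedin gromov_topology C \<and> a \<in> topspace gromov_topology - C"
  then have W: "openin gromov_topology (topspace gromov_topology - C)" and a: "a \<in> gromov_compactification" "a \<notin> C"
    by (auto simp: closedin_def)
  have "\<exists>U. openin gromov_topology U \<and> a \<in> U \<and> (\<forall>z. z \<in> gromov_topology closure_of U \<longrightarrow> z \<notin> C)"
  proof (cases a)
    case (Inl x)
    have "open {y. Inl y \<in> topspace gromov_topology - C}"
      using W unfolding openin_gromov_topology gromov_open_iff by blast
    moreover have "x \<in> {y. Inl y \<in> topspace gromov_topology - C}" using a Inl by simp
    ultimately obtain e where e: "e > 0" "ball x e \<subseteq> {y. Inl y \<in> topspace gromov_topology - C}"
      by (rule openE)
    define U where "U = (Inl ` ball x (e / 2) :: 'a gromov_pt set)"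
    have "z \<notin> C" if z: "z \<in> gromov_topology closure_of U" for z
    proof (cases z)
      case (Inl y)
      have "dist x y \<le> e / 2"
      proof (rule ccontr)
        assume "\<not> ?thesis"
        then have "z \<in> Inl ` (- cball x (e / 2))" using Inl by auto
        moreover have "openin gromov_topology (Inl ` (- cball x (e / 2)) :: 'a gromov_pt set)"
          by (rule openin_Inl_image) auto
        ultimately obtain w where "w \<in> U" "w \<in> Inl ` (- cball x (e / 2))" using z unfolding in_closure_of by meson
        then show False unfolding U_def by auto
      qed
      then have "y \<in> ball x e" using e by simp
      then show ?thesis using e Inl by blast
    next
      case (Inr \<xi>)
      then have x: "\<xi> \<in> gromov_boundary" using z in_closure_of[of z gromov_topology U] by simp
      obtain V where V: "openin gromov_topology V" "Inr \<xi> \<in> V" "V \<subseteq> bdry_ball \<xi> (dist x p + e)"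
        using bdry_ball_interior[OF x] by blast
      obtain w where w: "w \<in> U" "w \<in> V" using z V(1,2) Inr unfolding in_closure_of by meson
      obtain y where y: "w = Inl y" "dist x y < e / 2" using w(1) unfolding U_def by auto
      have "dist x p + e \<le> dist y p" using w(2) V(3) y gp_ge_Inl_le unfolding bdry_ball_def by blast
      then have False using y(2) dist_triangle[of y p x] dist_commute[of x y] e(1) by linarith
      then show ?thesis ..
    qed
    moreover have "openin gromov_topology U" unfolding U_def by (rule openin_Inl_image) simp
    moreover have "a \<in> U" unfolding U_def Inl using e by simp
    ultimately show ?thesis by blast
  next
    case (Inr \<eta>)
    then have e: "\<eta> \<in> gromov_boundary" using a by simp
    obtain r where r: "bdry_ball \<eta> r \<subseteq> topspace gromov_topology - C"
      using W a Inr e unfolding openin_gromov_topology gromov_open_iff by auto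
    obtain U where U: "openin gromov_topology U" "Inr \<eta> \<in> U" "U \<subseteq> bdry_ball \<eta> (r + \<delta> + 1)"
      using bdry_ball_interior[OF e] by blast
    have "z \<notin> C" if z: "z \<in> gromov_topology closure_of U" for z
    proof -
      have zc: "z \<in> gromov_compactification" using z in_closure_of[of z gromov_topology U] by simp
      have "gp_ge z (Inr \<eta>) r"
      proof (cases z)
        case (Inl x)
        have "openin gromov_topology (Inl ` ball x 1 :: 'a gromov_pt set)" by (rule openin_Inl_image) simp
        moreover have "z \<in> Inl ` ball x 1" using Inl by simp
        ultimately obtain w where w: "w \<in> U" "w \<in> Inl ` ball x 1" using z unfolding in_closure_of by meson
        then obtain y where y: "w = Inl y" "dist y x \<le> 1" by (auto simp: dist_commute)
        have "gp_ge (Inl y) (Inr \<eta>) (r + \<delta> + 1)" using w(1) U(3) y unfolding bdry_ball_def by blast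
        from gp_ge_Inl_lipschitz[OF this y(2)] show ?thesis
          unfolding Inl by (rule gp_ge_mono) (use delta_pos in simp)
      next
        case (Inr \<xi>)
        then have x: "\<xi> \<in> gromov_boundary" using zc by simp
        obtain V where V: "openin gromov_topology V" "Inr \<xi> \<in> V" "V \<subseteq> bdry_ball \<xi> (r + \<delta> + 1)"
          using bdry_ball_interior[OF x] by blast
        obtain w where w: "w \<in> U" "w \<in> V" using z V(1,2) Inr unfolding in_closure_of by meson
        have "gp_ge (Inr \<xi>) w (r + \<delta> + 1)" "gp_ge w (Inr \<eta>) (r + \<delta> + 1)"
          using w V(3) U(3) gp_ge_sym unfolding bdry_ball_def by blast+
        from gp_ge_trans[OF this] show ?thesis unfolding Inr by (rule gp_ge_mono) simp
      qed
      then show ?thesis using r zc unfolding bdry_ball_def by blast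
    qed
    then show ?thesis using U Inr by blast
  qed
  then show "\<exists>U. openin gromov_topology U \<and> a \<in> U \<and> disjnt C (gromov_topology closure_of U)"
    unfolding disjnt_iff by blast
qed

text \<open>Serves uniqueness of \<open>\<Phi>\<close> and of limits. Given regularity it is enough
  to separate in the T0 sense, and two boundary points that no ball separates coincide by
  \<open>gp_ge_imp_eq\<close>.\<close>

lemma Hausdorff_space_gromov: "Hausdorff_space (gromov_topology :: 'a gromov_pt topology)"
proof (rule regular_t0_imp_Hausdorff_space[OF regular_space_gromov])
  have sep: "\<exists>U. openin gromov_topology U \<and> Inl x \<in> U \<and> z \<notin> U" if "Inl x \<noteq> z" for x :: 'a and z
  proof (cases z)
    case (Inl y)
    then have "x \<in> - {y}" using that by simp
    then show ?thesis using openin_Inl_image[of "- {y}"] Inl by (intro exI[of _ "Inl ` (- {y})"]) auto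
  next
    case (Inr \<eta>)
    then show ?thesis using openin_Inl_image[of UNIV] by (intro exI[of _ "Inl ` UNIV"]) auto
  qed
  show "t0_space (gromov_topology :: 'a gromov_pt topology)"
    unfolding t0_space_def
  proof (intro ballI impI)
    fix z w :: "'a gromov_pt" assume zw: "z \<in> topspace gromov_topology" "w \<in> topspace gromov_topology" "z \<noteq> w"
    show "\<exists>U. openin gromov_topology U \<and> (z \<notin> U) = (w \<in> U)"
    proof (cases z)
      case (Inl x)
      then show ?thesis using sep[of x w] zw(3) by auto
    next
      case z: (Inr \<eta>)
      show ?thesis
      proof (cases w)
        case (Inl x)
        then show ?thesis using sep[of x z] zw(3) by auto
      next
        case w: (Inr \<xi>)
        have b: "\<eta> \<in> gromov_boundary" "\<xi> \<in> gromov_boundary" "\<eta> \<noteq> \<xi>" using zw z w by auto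
        then obtain r where r: "\<not> gp_ge (Inr \<eta>) (Inr \<xi>) r" using gp_ge_imp_eq by blast
        obtain V where "openin gromov_topology V" "Inr \<xi> \<in> V" "V \<subseteq> bdry_ball \<xi> r"
          using bdry_ball_interior[OF b(2)] by blast
        moreover from this(3) have "Inr \<eta> \<notin> V" using r unfolding bdry_ball_def by blast
        ultimately show ?thesis using z w by blast
      qed
    qed
  qed
qed

section \<open>The horofunction compactification\<close>

text \<open>Normalising both functions at \<open>p\<close> makes the condition blind to additive
  constants, so the set is saturated for the quotient map.\<close>

definition horo_nbhd :: "('a \<Rightarrow> real) \<Rightarrow> 'a set \<Rightarrow> real \<Rightarrow> ('a \<Rightarrow> real) set set" where
  "horo_nbhd g K \<epsilon> = const_class ` {h \<in> cont_funs. \<forall>y\<in>K. \<bar>(h y - h p) - (g y - g p)\<bar> < \<epsilon>}"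

lemma cont_funs_dist: "(\<lambda>y. dist x y) \<in> cont_funs"
  unfolding cont_funs_def by (auto intro!: continuous_intros)

lemma Union_horo_nbhd: "\<Union>(horo_nbhd g K \<epsilon>) = {h \<in> cont_funs. \<forall>y\<in>K. \<bar>(h y - h p) - (g y - g p)\<bar> < \<epsilon>}"
proof
  show "\<Union>(horo_nbhd g K \<epsilon>) \<subseteq> {h \<in> cont_funs. \<forall>y\<in>K. \<bar>(h y - h p) - (g y - g p)\<bar> < \<epsilon>}"
  proof
    fix h' assume "h' \<in> \<Union>(horo_nbhd g K \<epsilon>)"
    then obtain h where h: "h \<in> cont_funs" "\<forall>y\<in>K. \<bar>(h y - h p) - (g y - g p)\<bar> < \<epsilon>" "h' \<in> const_class h"
      unfolding horo_nbhd_def by blast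
    then obtain c where c: "\<And>y. h' y = h y + c" unfolding const_class_def by blast
    then have "h' = (\<lambda>y. h y + c)" by auto
    moreover have "continuous_on UNIV (\<lambda>y. h y + c)"
      using h(1) unfolding cont_funs_def by (auto intro!: continuous_intros)
    ultimately show "h' \<in> {h \<in> cont_funs. \<forall>y\<in>K. \<bar>(h y - h p) - (g y - g p)\<bar> < \<epsilon>}"
      using h(2) c unfolding cont_funs_def by simp
  qed
  show "{h \<in> cont_funs. \<forall>y\<in>K. \<bar>(h y - h p) - (g y - g p)\<bar> < \<epsilon>} \<subseteq> \<Union>(horo_nbhd g K \<epsilon>)"
    unfolding horo_nbhd_def using const_class_refl by blast
qed

lemma openin_horo_nbhd:
  assumes g: "g \<in> cont_funs" and K: "compact K"
  shows "openin cont_mod_const_topology (horo_nbhd g K \<epsilon>)"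
  unfolding openin_cont_mod_const_topology cont_mod_const_open_def
proof
  show "horo_nbhd g K \<epsilon> \<subseteq> const_class ` cont_funs" unfolding horo_nbhd_def by blast
  show "openin ucc_topology (\<Union> (horo_nbhd g K \<epsilon>))"
    unfolding Union_horo_nbhd openin_ucc_topology ucc_open_def
  proof (intro conjI ballI)
    fix h assume h: "h \<in> {h \<in> cont_funs. \<forall>y\<in>K. \<bar>(h y - h p) - (g y - g p)\<bar> < \<epsilon>}"
    define D where "D y = \<bar>(h y - h p) - (g y - g p)\<bar>" for y
    \<comment> \<open>By compactness the deviation is bounded by some \<open>M\<close> below
      \<open>\<epsilon>\<close>; the slack \<open>\<epsilon> - M\<close> is shared between the
      values at \<open>y\<close> and at the normalising point \<open>p\<close>, which is therefore
      added to \<open>K\<close>.\<close>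
    have "\<exists>M<\<epsilon>. \<forall>y\<in>K. D y \<le> M"
    proof (cases "K = {}")
      case False
      have "continuous_on UNIV h" "continuous_on UNIV g" using g h unfolding cont_funs_def by auto
      then have "continuous_on K h" "continuous_on K g" using continuous_on_subset by blast+
      then have "continuous_on K D" unfolding D_def by (intro continuous_intros)
      then obtain y where "y \<in> K" "\<forall>z\<in>K. D z \<le> D y" using continuous_attains_sup[OF K False] by blast
      then show ?thesis using h unfolding D_def by blast
    qed (auto intro: exI[of _ "\<epsilon> - 1"])
    then obtain M where M: "M < \<epsilon>" "\<And>y. y \<in> K \<Longrightarrow> D y \<le> M" by blast
    have "\<bar>(k y - k p) - (g y - g p)\<bar> < \<epsilon>"
      if k: "\<forall>y\<in>insert p K. \<bar>k y - h y\<bar> < (\<epsilon> - M) / 2" and y: "y \<in> K" for k y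
      using M(2)[OF y] k[rule_format, of p] k[rule_format, of y] y unfolding D_def by simp argo
    then show "\<exists>L e. compact L \<and> e > 0 \<and> {k \<in> cont_funs. \<forall>y\<in>L. \<bar>k y - h y\<bar> < e} \<subseteq>
        {h \<in> cont_funs. \<forall>y\<in>K. \<bar>(h y - h p) - (g y - g p)\<bar> < \<epsilon>}"
      using K M(1) by (intro exI[of _ "insert p K"] exI[of _ "(\<epsilon> - M) / 2"]) auto
  qed auto
qed

lemma horo_embed_in_nbhd_iff:
  "horo_embed x \<in> horo_nbhd g K \<epsilon> \<longleftrightarrow> (\<forall>y\<in>K. \<bar>(dist x y - dist x p) - (g y - g p)\<bar> < \<epsilon>)"
proof
  assume "horo_embed x \<in> horo_nbhd g K \<epsilon>"
  then have "(\<lambda>y. dist x y) \<in> \<Union>(horo_nbhd g K \<epsilon>)"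
    unfolding horo_embed_def using const_class_refl by blast
  then show "\<forall>y\<in>K. \<bar>(dist x y - dist x p) - (g y - g p)\<bar> < \<epsilon>" unfolding Union_horo_nbhd by blast
next
  assume "\<forall>y\<in>K. \<bar>(dist x y - dist x p) - (g y - g p)\<bar> < \<epsilon>"
  then show "horo_embed x \<in> horo_nbhd g K \<epsilon>"
    unfolding horo_nbhd_def horo_embed_def using cont_funs_dist by blast
qed

lemma const_class_in_horo_nbhd: "g \<in> cont_funs \<Longrightarrow> \<epsilon> > 0 \<Longrightarrow> const_class g \<in> horo_nbhd g K \<epsilon>"
  unfolding horo_nbhd_def by auto

lemma topspace_cont_mod_const: "topspace cont_mod_const_topology = const_class ` (cont_funs :: ('a \<Rightarrow> real) set)"
proof -
  have "\<Union>(const_class ` cont_funs) = (cont_funs :: ('a \<Rightarrow> real) set)"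
    using Union_horo_nbhd[of "\<lambda>_. 0" "{}" 1] unfolding horo_nbhd_def by simp
  moreover have "ucc_open (cont_funs :: ('a \<Rightarrow> real) set)"
    unfolding ucc_open_def by (auto intro!: exI[of _ "{}"] exI[of _ 1])
  ultimately have "openin cont_mod_const_topology (const_class ` (cont_funs :: ('a \<Rightarrow> real) set))"
    unfolding openin_cont_mod_const_topology cont_mod_const_open_def openin_ucc_topology by simp
  moreover have "topspace cont_mod_const_topology \<subseteq> const_class ` (cont_funs :: ('a \<Rightarrow> real) set)"
    using openin_topspace[of "cont_mod_const_topology :: ('a \<Rightarrow> real) set topology"]
    unfolding openin_cont_mod_const_topology cont_mod_const_open_def by blast
  ultimately show ?thesis using openin_subset by (metis subset_antisym)
qed

lemma horo_embed_in_topspace: "range (horo_embed :: 'a \<Rightarrow> _) \<subseteq> topspace cont_mod_const_topology"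
  unfolding topspace_cont_mod_const horo_embed_def using cont_funs_dist by blast

lemma horo_embed_in_compactification: "range (horo_embed :: 'a \<Rightarrow> _) \<subseteq> horo_compactification"
  unfolding horo_compactification_def by (rule closure_of_subset[OF horo_embed_in_topspace])

lemma horo_compactificationD:
  assumes "a \<in> horo_compactification"
  obtains g where "g \<in> cont_funs" "a = const_class (g :: 'a \<Rightarrow> real)"
proof -
  have "a \<in> topspace cont_mod_const_topology"
    using assms unfolding horo_compactification_def in_closure_of by blast
  then show thesis using that unfolding topspace_cont_mod_const by blast
qed

lemma horo_compactification_approx:
  assumes "a \<in> horo_compactification" "openin cont_mod_const_topology U" "a \<in> U"
  shows "\<exists>x :: 'a. horo_embed x \<in> U"
  using assms unfolding horo_compactification_def in_closure_of by blast

lemma inj_horo_embed: "inj (horo_embed :: 'a \<Rightarrow> _)"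
proof (rule injI)
  fix x x' :: 'a assume "horo_embed x = horo_embed x'"
  then have "(\<lambda>y. dist x y) \<in> const_class (\<lambda>y. dist x' y)" unfolding horo_embed_def using const_class_refl by metis
  then obtain c where c: "\<And>y. dist x y = dist x' y + c" unfolding const_class_def by blast
  show "x = x'" using c[of x] c[of x'] by (simp add: dist_commute)
qed

lemma horofunction_const_class: "horofunction (const_class g) q y = g y - g q"
proof -
  have "(THE h. h \<in> const_class g \<and> h q = 0) = (\<lambda>y. g y - g q)"
  proof (rule the_equality)
    show "(\<lambda>y. g y - g q) \<in> const_class g \<and> g q - g q = 0"
      unfolding const_class_def by (auto intro: exI[of _ "- g q"])
    fix h assume h: "h \<in> const_class g \<and> h q = 0"
    then obtain c where "\<And>y. h y = g y + c" unfolding const_class_def by blast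
    moreover from this[of q] h have "c = - g q" by simp
    ultimately show "h = (\<lambda>y. g y - g q)" by auto
  qed
  then show ?thesis unfolding horofunction_def by simp
qed

section \<open>From nearby horofunctions to Gromov products\<close>

lemma point_on_geodesic:
  fixes x y :: 'a
  assumes "0 \<le> R" "R \<le> dist x y"
  obtains z where "dist x z = R" "dist z y = dist x y - R"
proof -
  obtain c where c: "c 0 = x" "c (dist x y) = y"
      "\<forall>s\<in>{0..dist x y}. \<forall>t\<in>{0..dist x y}. dist (c s) (c t) = \<bar>s - t\<bar>"
    using geodesic unfolding geodesic_space_def geodesic_segment_def by metis
  show thesis
    using that[of "c R"] c(1,2) c(3)[rule_format, of 0 R] c(3)[rule_format, of R "dist x y"] assms by simp
qed

text \<open>Gives continuity of the inverse of \<open>horo_embed\<close>. If \<open>x\<close> were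
  farther than 1 from \<open>x0\<close>, then at the point at distance 1 on a geodesic from
  \<open>x0\<close> to \<open>x\<close> one distance function has dropped by 1 while the other has
  risen by 1, a gap of 2.\<close>

lemma dist_close_imp_close:
  fixes x x0 :: 'a
  assumes "\<epsilon> \<le> 1" and "\<And>y. y \<in> cball x0 1 \<Longrightarrow> \<bar>(dist x y - dist x p) - (dist x0 y - dist x0 p)\<bar> < \<epsilon> / 2"
  shows "dist x0 x < \<epsilon>"
proof -
  have "0 \<le> \<bar>(dist x x0 - dist x p) - (dist x0 x0 - dist x0 p)\<bar>" by (rule abs_ge_zero)
  also have "\<dots> < \<epsilon> / 2" by (rule assms(2)) simp
  finally have \<epsilon>: "\<epsilon> > 0" by simp
  have *: "\<bar>dist x y - dist x x0 - dist x0 y\<bar> < \<epsilon>" if "y \<in> cball x0 1" for y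
    using assms(2)[OF that] assms(2)[of x0] by simp argo
  show ?thesis
  proof (cases "dist x0 x \<le> 1")
    case True
    then show ?thesis using *[of x] \<epsilon> dist_commute[of x x0] by simp
  next
    case False
    then obtain z where "dist x0 z = 1" "dist z x = dist x0 x - 1" using point_on_geodesic[of 1 x0 x] by auto
    then show ?thesis using *[of z] assms(1) \<epsilon> dist_commute[of x x0] dist_commute[of x z] by simp
  qed
qed

text \<open>Along a geodesic from \<open>p\<close> to \<open>x'\<close> the distance to
  \<open>x'\<close> drops by \<open>R\<close>, so \<open>g\<close>, and with it the distance to
  \<open>x\<close>, drops almost as much. The point \<open>z\<close> reached there has a large
  product with both \<open>x\<close> and \<open>x'\<close>.\<close>

lemma close_horofunctions_gp:
  fixes x x' :: 'a and g :: "'a \<Rightarrow> real"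
  assumes x: "\<And>y. y \<in> cball p R \<Longrightarrow> \<bar>(dist x y - dist x p) - (g y - g p)\<bar> < 1"
    and x': "\<And>y. y \<in> cball p R \<Longrightarrow> \<bar>(dist x' y - dist x' p) - (g y - g p)\<bar> < 1"
    and R: "0 \<le> R" "R \<le> dist p x'"
  shows "R - 1 - \<delta> \<le> gp x x'"
proof -
  obtain z where z: "dist p z = R" "dist z x' = dist p x' - R" using point_on_geodesic[OF R] by blast
  have "z \<in> cball p R" using z by simp
  from x[OF this] x'[OF this] have "dist x z - dist x p < - R + 2"
    using z dist_commute[of z x'] dist_commute[of p x'] by argo
  then have "R - 1 \<le> gp x z" using z dist_commute[of p z] unfolding gromov_product_def by argo
  moreover have "R - 1 \<le> gp z x'"
    using z dist_commute[of p z] dist_commute[of p x'] unfolding gromov_product_def by argo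
  ultimately show ?thesis by (rule four_point_ge)
qed

text \<open>By properness, points that stay bounded while their classes approach that of
  \<open>g\<close> accumulate at some \<open>l\<close>, and then \<open>g\<close> is the distance
  from \<open>l\<close> up to a constant.\<close>

lemma horo_bdry_escape:
  assumes g: "g \<in> cont_funs" and a: "const_class g \<notin> range (horo_embed :: 'a \<Rightarrow> _)"
  shows "\<exists>n::nat. \<forall>x. horo_embed x \<in> horo_nbhd g (cball p (real n)) (1 / (real n + 1)) \<longrightarrow> R \<le> dist p x"
proof (rule ccontr)
  assume "\<not> ?thesis"
  then obtain w where w: "\<And>n::nat. horo_embed (w n) \<in> horo_nbhd g (cball p (real n)) (1 / (real n + 1))"
      "\<And>n. dist p (w n) < R" by (metis not_le)
  have "\<forall>n. w n \<in> cball p R" using w(2) by (auto intro: less_imp_le)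
  then obtain l r where l: "strict_mono r" "(w \<circ> r) \<longlonglongrightarrow> l"
    using compact_cball[of p R] unfolding compact_def by meson
  have lim: "g y - g p = dist l y - dist l p" for y
  proof -
    have "(\<lambda>n. dist (w (r n)) y - dist (w (r n)) p) \<longlonglongrightarrow> dist l y - dist l p"
      using l(2) unfolding o_def by (intro tendsto_intros)
    moreover have "(\<lambda>n. dist (w (r n)) y - dist (w (r n)) p) \<longlonglongrightarrow> g y - g p"
    proof -
      have "(\<lambda>n. ((dist (w n) y - dist (w n) p) - (g y - g p))) \<longlonglongrightarrow> 0"
      proof (rule Lim_null_comparison)
        have "\<forall>\<^sub>F n in sequentially. dist p y \<le> real n"
          by (metis filterlim_at_top filterlim_real_sequentially)
        then show "\<forall>\<^sub>F n in sequentially. norm ((dist (w n) y - dist (w n) p) - (g y - g p)) \<le> 1 / (real n + 1)"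
          by eventually_elim (use w(1) in \<open>auto simp: horo_embed_in_nbhd_iff intro: less_imp_le\<close>)
        show "(\<lambda>n. 1 / (real n + 1)) \<longlonglongrightarrow> 0"
          using LIMSEQ_inverse_real_of_nat by (simp add: inverse_eq_divide add.commute)
      qed
      from LIMSEQ_subseq_LIMSEQ[OF this l(1)] show ?thesis
        unfolding o_def by (subst LIM_zero_iff[symmetric])
    qed
    ultimately show ?thesis using LIMSEQ_unique by blast
  qed
  have "g \<in> const_class (\<lambda>y. dist l y)"
    unfolding const_class_def
    by (intro CollectI exI[of _ "g p - dist l p"] allI) (use lim in \<open>simp add: algebra_simps\<close>)
  then have "const_class g = horo_embed l" unfolding horo_embed_def by (rule const_class_eq)
  then show False using a by blast
qed

text \<open>Points whose classes are close to \<open>a\<close> are far away and have large mutual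
  products. Any choice of such points therefore converges to a boundary point, and the limit is the
  same for all choices; it becomes the value of \<open>\<Phi>\<close> at \<open>a\<close>.\<close>

lemma horo_bdry_limit:
  assumes a: "a \<in> horo_compactification" "a \<notin> range (horo_embed :: 'a \<Rightarrow> _)" and g: "g \<in> cont_funs" "a = const_class g"
  obtains \<eta> where "\<eta> \<in> gromov_boundary"
    "\<And>r. \<exists>n::nat. \<forall>x. horo_embed x \<in> horo_nbhd g (cball p (real n)) (1 / (real n + 1)) \<longrightarrow> gp_ge (Inl x) (Inr \<eta>) r"
proof -
  define A where "A n = {x. horo_embed x \<in> horo_nbhd g (cball p (real n)) (1 / (real n + 1))}" for n :: nat
  have "\<exists>x. x \<in> A n" for n
    unfolding A_def mem_Collect_eq
    by (rule horo_compactification_approx[OF a(1)])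
       (use g const_class_in_horo_nbhd openin_horo_nbhd in auto)
  then obtain w where w: "\<And>n. w n \<in> A n" by metis
  have mono: "A m \<subseteq> A n" if "n \<le> m" for m n
  proof -
    have "1 / (real m + 1) \<le> 1 / (real n + 1)" using that by (simp add: frac_le)
    then show ?thesis using that unfolding A_def horo_embed_in_nbhd_iff by (auto intro: order_less_le_trans)
  qed
  have key: "\<exists>n. \<forall>x\<in>A n. \<forall>x'\<in>A n. R \<le> gp x x'" for R
  proof -
    define R' where "R' = max 0 (R + 1 + \<delta>)"
    obtain n where n: "\<And>x. x \<in> A n \<Longrightarrow> R' \<le> dist p x"
      using horo_bdry_escape[of g R'] g a(2) unfolding A_def by auto
    obtain m where m: "R' \<le> real m" using real_arch_simple by blast
    define N where "N = max m n"
    have "R \<le> gp x x'" if x: "x \<in> A N" "x' \<in> A N" for x x'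
    proof -
      have "\<bar>(dist u y - dist u p) - (g y - g p)\<bar> < 1" if "u \<in> A N" "y \<in> cball p R'" for u y
      proof -
        have "y \<in> cball p (real N)" using that(2) m unfolding N_def by auto
        then have "\<bar>(dist u y - dist u p) - (g y - g p)\<bar> < 1 / (real N + 1)"
          using that(1) unfolding A_def horo_embed_in_nbhd_iff by blast
        also have "\<dots> \<le> 1" by simp
        finally show ?thesis .
      qed
      moreover have "R' \<le> dist p x'" using n mono[of n N] x(2) unfolding N_def by auto
      ultimately have "R' - 1 - \<delta> \<le> gp x x'"
        using x by (intro close_horofunctions_gp[of R' x g x']) (auto simp: R'_def)
      then show ?thesis unfolding R'_def by linarith
    qed
    then show ?thesis by blast
  qed
  have "\<exists>N. \<forall>m\<ge>N. \<forall>n\<ge>N. r \<le> gp (w m) (w n)" for r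
    using key[of r] w mono by (meson subsetD)
  then obtain \<eta> where e: "\<eta> \<in> gromov_boundary" "converges_to_bdry w \<eta>" using bdry_limit_exists[of w] by blast
  have "\<exists>n. \<forall>x\<in>A n. gp_ge (Inl x) (Inr \<eta>) r" for r
  proof -
    obtain N where N: "\<forall>n\<ge>N. gp_ge (Inl (w n)) (Inr \<eta>) (r + \<delta>)"
      using e unfolding converges_to_bdry_iff eventually_sequentially by blast
    obtain n where n: "\<forall>x\<in>A n. \<forall>x'\<in>A n. r + \<delta> \<le> gp x x'" using key by blast
    have "gp_ge (Inl x) (Inr \<eta>) r" if "x \<in> A n" for x
    proof -
      have "w (max n N) \<in> A n" using w mono[of n "max n N"] by auto
      then have "gp_ge (Inl x) (Inl (w (max n N))) (r + \<delta>)" using n that unfolding gp_ge_def by auto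
      moreover have "gp_ge (Inl (w (max n N))) (Inr \<eta>) (r + \<delta>)" using N by simp
      ultimately have "gp_ge (Inl x) (Inr \<eta>) (r + \<delta> - \<delta>)" by (rule gp_ge_trans)
      then show ?thesis by simp
    qed
    then show ?thesis by blast
  qed
  then show thesis using that e(1) unfolding A_def by auto
qed

text \<open>The inverse of \<open>horo_embed\<close> is continuous on the dense copy of the space
  and has a limit at each added point, so it extends continuously into the regular target.\<close>

lemma horo_to_gromov_exists:
  obtains \<Phi> where "continuous_map (subtopology cont_mod_const_topology horo_compactification) gromov_topology \<Phi>"
    "\<And>x :: 'a. \<Phi> (horo_embed x) = Inl x"
proof -
  let ?X = "cont_mod_const_topology :: ('a \<Rightarrow> real) set topology"
  let ?S = "range (horo_embed :: 'a \<Rightarrow> _)"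
  define f :: "('a \<Rightarrow> real) set \<Rightarrow> 'a gromov_pt" where "f a = Inl (inv horo_embed a)" for a
  have f: "f (horo_embed x) = Inl x" for x unfolding f_def using inj_horo_embed by simp
  have cont: "continuous_map (subtopology ?X ?S) gromov_topology f"
    unfolding continuous_map_atin
  proof
    fix a assume "a \<in> topspace (subtopology ?X ?S)"
    then obtain x0 where a: "a = horo_embed x0" by auto
    show "limitin gromov_topology f (f a) (atin (subtopology ?X ?S) a)"
      unfolding limitin_def
    proof (intro conjI allI impI)
      show "f a \<in> topspace gromov_topology" unfolding f_def by simp
      fix U :: "'a gromov_pt set" assume U: "openin gromov_topology U \<and> f a \<in> U"
      then have "open {x. Inl x \<in> U}" "x0 \<in> {x. Inl x \<in> U}"
        unfolding a f openin_gromov_topology gromov_open_def by auto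
      then obtain e where e: "e > 0" "ball x0 e \<subseteq> {x. Inl x \<in> U}" by (rule openE)
      define N where "N = horo_nbhd (dist x0) (cball x0 1) (min e 1 / 2)"
      have "openin ?X N" unfolding N_def by (rule openin_horo_nbhd[OF cont_funs_dist]) simp
      then have "openin (subtopology ?X ?S) (N \<inter> ?S)" unfolding openin_subtopology by blast
      moreover have "a \<in> N \<inter> ?S"
        unfolding a N_def using const_class_in_horo_nbhd[OF cont_funs_dist] e by (auto simp: horo_embed_def)
      moreover have "f b \<in> U" if b: "b \<in> N \<inter> ?S" for b
      proof -
        obtain x where x: "b = horo_embed x" using b by blast
        have "horo_embed x \<in> N" using b unfolding x by (rule IntD1)
        then have "dist x0 x < min e 1"
          unfolding N_def horo_embed_in_nbhd_iff by (intro dist_close_imp_close) auto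
        then show ?thesis using e(2) unfolding x f by auto
      qed
      ultimately show "\<forall>\<^sub>F b in atin (subtopology ?X ?S) a. f b \<in> U" unfolding eventually_atin by blast
    qed
  qed
  have lim: "\<exists>l. limitin gromov_topology f l (atin_within ?X a ?S)"
    if a: "a \<in> horo_compactification - ?S" for a
  proof -
    obtain g where g: "g \<in> cont_funs" "a = const_class g" using a horo_compactificationD by blast
    obtain \<eta> where e: "\<eta> \<in> gromov_boundary"
      and eg: "\<And>r. \<exists>n::nat. \<forall>x. horo_embed x \<in> horo_nbhd g (cball p (real n)) (1 / (real n + 1)) \<longrightarrow> gp_ge (Inl x) (Inr \<eta>) r"
      using horo_bdry_limit[of a g] a g by blast
    have "limitin gromov_topology f (Inr \<eta>) (atin_within ?X a ?S)"
      unfolding limitin_def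
    proof (intro conjI allI impI)
      show "Inr \<eta> \<in> topspace gromov_topology" using e by simp
      fix U :: "'a gromov_pt set" assume U: "openin gromov_topology U \<and> Inr \<eta> \<in> U"
      then obtain r where r: "bdry_ball \<eta> r \<subseteq> U" unfolding openin_gromov_topology gromov_open_iff by blast
      obtain n :: nat where n: "\<And>x. horo_embed x \<in> horo_nbhd g (cball p (real n)) (1 / (real n + 1)) \<Longrightarrow> gp_ge (Inl x) (Inr \<eta>) r"
        using eg by blast
      define N where "N = horo_nbhd g (cball p (real n)) (1 / (real n + 1))"
      have "openin ?X N" unfolding N_def by (rule openin_horo_nbhd[OF g(1)]) simp
      moreover have "a \<in> N" unfolding g(2) N_def by (rule const_class_in_horo_nbhd[OF g(1)]) simp
      moreover have "f b \<in> U" if b: "b \<in> N" "b \<in> ?S" for b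
      proof -
        obtain x where x: "b = horo_embed x" using b(2) by blast
        have "gp_ge (Inl x) (Inr \<eta>) r" by (rule n) (use b(1) in \<open>simp add: x N_def\<close>)
        then show ?thesis using r unfolding x f bdry_ball_def by auto
      qed
      ultimately show "\<forall>\<^sub>F b in atin_within ?X a ?S. f b \<in> U" unfolding eventually_atin_within by blast
    qed
    then show ?thesis ..
  qed
  obtain \<Phi> where "continuous_map (subtopology ?X horo_compactification) gromov_topology \<Phi>" "\<And>b. b \<in> ?S \<Longrightarrow> \<Phi> b = f b"
    using continuous_map_extension_pointwise_alt[OF regular_space_gromov horo_embed_in_compactification _ cont lim]
    unfolding horo_compactification_def by blast
  then show thesis using that f by auto
qed

text \<open>Justifies the definite description: density of the space and the Hausdorff property
  determine the extension on its domain, and extensionality does so outside.\<close>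

lemma horo_to_gromov:
  "continuous_map (subtopology cont_mod_const_topology horo_compactification) gromov_topology
     (horo_to_gromov :: ('a \<Rightarrow> real) set \<Rightarrow> _)"
  "horo_to_gromov (horo_embed x) = Inl (x :: 'a)"
proof -
  let ?X = "subtopology cont_mod_const_topology horo_compactification :: ('a \<Rightarrow> real) set topology"
  define P where "P \<Phi> \<longleftrightarrow> \<Phi> \<in> extensional horo_compactification \<and>
      continuous_map ?X gromov_topology \<Phi> \<and> (\<forall>x :: 'a. \<Phi> (horo_embed x) = Inl x)"
    for \<Phi> :: "('a \<Rightarrow> real) set \<Rightarrow> 'a gromov_pt"
  have top: "topspace ?X = horo_compactification"
    by (simp add: horo_compactification_def closure_of_subset_topspace inf.absorb2)
  have dense: "?X closure_of range horo_embed = horo_compactification"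
    using horo_embed_in_compactification unfolding closure_of_subtopology
    by (simp add: Int_absorb1 flip: horo_compactification_def)
  obtain \<Phi> where \<Phi>: "continuous_map ?X gromov_topology \<Phi>" "\<And>x :: 'a. \<Phi> (horo_embed x) = Inl x"
    using horo_to_gromov_exists by blast
  have "continuous_map ?X gromov_topology (restrict \<Phi> horo_compactification)"
    by (rule continuous_map_eq[OF \<Phi>(1)]) (simp add: top)
  then have "P (restrict \<Phi> horo_compactification)"
    unfolding P_def using \<Phi>(2) horo_embed_in_compactification by auto
  moreover have "\<Psi> = \<Psi>'" if "P \<Psi>" "P \<Psi>'" for \<Psi> \<Psi>' :: "('a \<Rightarrow> real) set \<Rightarrow> 'a gromov_pt"
  proof (rule extensionalityI[of _ horo_compactification])
    fix a :: "('a \<Rightarrow> real) set" assume "a \<in> horo_compactification"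
    then have "a \<in> ?X closure_of range horo_embed" using dense by simp
    then show "\<Psi> a = \<Psi>' a"
      by (rule forall_in_closure_of_eq[OF _ Hausdorff_space_gromov]) (use that in \<open>auto simp: P_def\<close>)
  qed (use that in \<open>auto simp: P_def\<close>)
  ultimately have "P (THE \<Phi>. P \<Phi>)" by (metis the_equality)
  then have "P horo_to_gromov" unfolding horo_to_gromov_def P_def by simp
  then show "continuous_map ?X gromov_topology horo_to_gromov" "horo_to_gromov (horo_embed x) = Inl x"
    unfolding P_def by auto
qed

text \<open>Intersecting the preimage of a neighbourhood of \<open>\<eta>\<close> under
  \<open>\<Phi>\<close> with a neighbourhood of \<open>a\<close> gives an open set, which meets the
  dense copy of the space. Estimates for all members of the fibre thus reduce to distances from
  points near \<open>\<eta>\<close>.\<close>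

lemma horo_fibre_approx:
  assumes a: "a \<in> horo_fibre \<eta>" and K: "compact K" and \<epsilon>: "\<epsilon> > 0"
  shows "\<exists>w :: 'a. gp_ge (Inl w) (Inr \<eta>) r \<and> (\<forall>y\<in>K. \<bar>(dist w y - dist w p) - horofunction a p y\<bar> < \<epsilon>)"
proof -
  let ?X = "cont_mod_const_topology :: ('a \<Rightarrow> real) set topology"
  have ac: "a \<in> horo_compactification" and \<Phi>a: "horo_to_gromov a = Inr \<eta>" using a unfolding horo_fibre_def by auto
  have aX: "a \<in> topspace ?X" using ac unfolding horo_compactification_def in_closure_of by blast
  then have "horo_to_gromov a \<in> topspace gromov_topology"
    using continuous_map_image_subset_topspace[OF horo_to_gromov(1)] ac by auto
  then have e: "\<eta> \<in> gromov_boundary" using \<Phi>a by simp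
  obtain g where g: "g \<in> cont_funs" "a = const_class g" using ac horo_compactificationD by blast
  obtain U where U: "openin gromov_topology U" "Inr \<eta> \<in> U" "U \<subseteq> bdry_ball \<eta> r"
    using bdry_ball_interior[OF e] by blast
  have "openin (subtopology ?X horo_compactification)
      {b \<in> topspace (subtopology ?X horo_compactification). horo_to_gromov b \<in> U}"
    by (rule openin_continuous_map_preimage[OF horo_to_gromov(1) U(1)])
  then obtain V where V: "openin ?X V"
      "{b \<in> topspace (subtopology ?X horo_compactification). horo_to_gromov b \<in> U} = V \<inter> horo_compactification"
    unfolding openin_subtopology by (elim exE conjE)
  have "a \<in> V \<inter> horo_compactification"
    unfolding V(2)[symmetric] using ac aX \<Phi>a U(2) by simp
  then have "a \<in> V" by simp
  then have "a \<in> V \<inter> horo_nbhd g K \<epsilon>" using const_class_in_horo_nbhd[OF g(1) \<epsilon>] g(2) by blast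
  moreover have "openin ?X (V \<inter> horo_nbhd g K \<epsilon>)" using V(1) openin_horo_nbhd[OF g(1) K] by blast
  ultimately obtain w where w: "horo_embed w \<in> V \<inter> horo_nbhd g K \<epsilon>"
    using horo_compactification_approx[OF ac] by blast
  then have "horo_to_gromov (horo_embed w) \<in> U"
    using V(2) horo_embed_in_compactification by blast
  then have "gp_ge (Inl w) (Inr \<eta>) r" using U(3) unfolding horo_to_gromov(2) bdry_ball_def by blast
  moreover have "\<forall>y\<in>K. \<bar>(dist w y - dist w p) - horofunction a p y\<bar> < \<epsilon>"
    using w unfolding g(2) horofunction_const_class horo_embed_in_nbhd_iff[symmetric] by blast
  ultimately show ?thesis by blast
qed

section \<open>Busemann functions of rays\<close>

lemma converges_to_bdry_rep:
  assumes e: "\<eta> \<in> gromov_boundary" shows "converges_to_bdry (\<lambda>n. rep \<eta> (real n)) \<eta>"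
  unfolding converges_to_bdry_iff
proof (intro conjI allI e)
  fix r
  have "\<forall>\<^sub>F n in sequentially. r \<le> real n" by (metis filterlim_at_top filterlim_real_sequentially)
  then show "\<forall>\<^sub>F n in sequentially. gp_ge (Inl (rep \<eta> (real n))) (Inr \<eta>) r"
    by eventually_elim (rule gp_ge_mono[OF gp_ge_rep[OF e of_nat_0_le_iff]])
qed

lemma lipschitz_uniform_limit:
  fixes h :: "nat \<Rightarrow> 'a \<Rightarrow> real"
  assumes lip: "\<And>n x y. \<bar>h n x - h n y\<bar> \<le> dist x y" and lipg: "\<And>x y. \<bar>g x - g y\<bar> \<le> dist x y"
    and lim: "\<And>y. (\<lambda>n. h n y) \<longlonglongrightarrow> g y" and K: "compact K" and \<epsilon>: "\<epsilon> > 0"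
  shows "\<forall>\<^sub>F n in sequentially. \<forall>y\<in>K. \<bar>h n y - g y\<bar> < \<epsilon>"
proof -
  have "\<epsilon> / 3 > 0" using \<epsilon> by simp
  then obtain F where F: "finite F" "K \<subseteq> (\<Union>x\<in>F. ball x (\<epsilon> / 3))"
    using K unfolding compact_eq_totally_bounded by meson
  have "\<forall>\<^sub>F n in sequentially. dist (h n x) (g x) < \<epsilon> / 3" for x
    using tendstoD[OF lim \<open>\<epsilon> / 3 > 0\<close>] .
  then have "\<forall>\<^sub>F n in sequentially. \<forall>x\<in>F. dist (h n x) (g x) < \<epsilon> / 3"
    using F(1) by (simp add: eventually_ball_finite)
  then show ?thesis
  proof eventually_elim
    case (elim n)
    show ?case
    proof
      fix y assume "y \<in> K"
      then obtain x where x: "x \<in> F" "dist x y < \<epsilon> / 3" using F(2) by auto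
      then have "\<bar>h n x - g x\<bar> < \<epsilon> / 3" using elim by (simp add: dist_real_def)
      then show "\<bar>h n y - g y\<bar> < \<epsilon>" using lip[of n x y] lipg[of x y] x(2) by argo
    qed
  qed
qed

text \<open>Provides an explicit member of the fibre, on which condition (5) can be tested. The
  normalised distances decrease along the ray and are bounded below; the limit lies over
  \<open>\<eta>\<close> because \<open>\<Phi>\<close> is continuous and the ray itself tends to
  \<open>\<eta>\<close>.\<close>

lemma busemann_in_horo_fibre:
  assumes e: "\<eta> \<in> gromov_boundary"
  obtains a where "a \<in> horo_fibre \<eta>"
    "\<And>y. (\<lambda>n. dist (rep \<eta> (real n)) y - real n) \<longlonglongrightarrow> horofunction a p (y :: 'a)"
proof -
  let ?X = "cont_mod_const_topology :: ('a \<Rightarrow> real) set topology"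
  define h where "h n y = dist (rep \<eta> (real n)) y - real n" for n y
  define g where "g y = lim (\<lambda>n. h n y)" for y
  have lim: "(\<lambda>n. h n y) \<longlonglongrightarrow> g y" for y
  proof -
    have "decseq (\<lambda>n. h n y)"
    proof (rule decseq_SucI)
      fix n
      have "dist (rep \<eta> (real (Suc n))) (rep \<eta> (real n)) = 1" using rep_dist(1)[OF e, of "real (Suc n)" "real n"] by simp
      then show "h (Suc n) y \<le> h n y"
        unfolding h_def using dist_triangle[of "rep \<eta> (real (Suc n))" y "rep \<eta> (real n)"] by simp
    qed
    moreover have "- dist y p \<le> h n y" for n
      unfolding h_def using dist_triangle[of "rep \<eta> (real n)" p y] rep_dist(2)[OF e, of "real n"] by simp
    ultimately obtain l where "(\<lambda>n. h n y) \<longlonglongrightarrow> l" using decseq_convergent by metis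
    then show ?thesis unfolding g_def by (simp add: limI)
  qed
  have lip: "\<bar>h n x - h n y\<bar> \<le> dist x y" for n x y
    unfolding h_def using abs_dist_diff_le[of x "rep \<eta> (real n)" y] by (simp add: dist_commute)
  have lipg: "\<bar>g x - g y\<bar> \<le> dist x y" for x y
    by (rule Lim_bounded[of "\<lambda>n. \<bar>h n x - h n y\<bar>" _ 0]) (use lim lip in \<open>auto intro!: tendsto_intros\<close>)
  have gc: "g \<in> cont_funs"
    unfolding cont_funs_def mem_Collect_eq continuous_on_iff
    using lipg by (metis dist_commute dist_real_def order_le_less_trans)
  have hp: "h n p = 0" for n unfolding h_def using rep_dist(2)[OF e, of "real n"] by simp
  then have gp: "g p = 0" unfolding g_def by simp
  have hcl: "h n \<in> const_class (dist (rep \<eta> (real n)))" for n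
    unfolding const_class_def h_def by (auto intro: exI[of _ "- real n"])
  have hc: "h n \<in> cont_funs" for n
    unfolding cont_funs_def h_def by (auto intro!: continuous_intros)
  have L: "limitin ?X (\<lambda>n. horo_embed (rep \<eta> (real n))) (const_class g) sequentially"
    unfolding limitin_def
  proof (intro conjI allI impI)
    show "const_class g \<in> topspace ?X" unfolding topspace_cont_mod_const using gc by blast
    fix U assume U: "openin ?X U \<and> const_class g \<in> U"
    then have "ucc_open (\<Union>U)" "g \<in> \<Union>U" and Uc: "U \<subseteq> const_class ` cont_funs"
      unfolding openin_cont_mod_const_topology cont_mod_const_open_def openin_ucc_topology
      using const_class_refl by blast+
    then obtain K \<epsilon> where K: "compact K" "\<epsilon> > 0" "{k \<in> cont_funs. \<forall>y\<in>K. \<bar>k y - g y\<bar> < \<epsilon>} \<subseteq> \<Union>U"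
      unfolding ucc_open_def by meson
    have "\<forall>\<^sub>F n in sequentially. \<forall>y\<in>K. \<bar>h n y - g y\<bar> < \<epsilon>"
      by (rule lipschitz_uniform_limit[OF lip lipg lim K(1,2)])
    then show "\<forall>\<^sub>F n in sequentially. horo_embed (rep \<eta> (real n)) \<in> U"
    proof eventually_elim
      case (elim n)
      then have "h n \<in> \<Union>U" using K(3) hc by blast
      then obtain A where "A \<in> U" "h n \<in> A" by blast
      moreover from this Uc have "A = const_class (h n)" using const_class_eq by blast
      ultimately show ?case using const_class_eq[OF hcl] unfolding horo_embed_def by simp
    qed
  qed
  have ac: "const_class g \<in> horo_compactification"
    unfolding horo_compactification_def
    unfolding in_closure_of
  proof (intro conjI allI impI)
    show "const_class g \<in> topspace ?X" unfolding topspace_cont_mod_const using gc by blast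
    fix T assume "const_class g \<in> T \<and> openin ?X T"
    then have "\<forall>\<^sub>F n in sequentially. horo_embed (rep \<eta> (real n)) \<in> T" using L unfolding limitin_def by blast
    then have "\<exists>n. horo_embed (rep \<eta> (real n)) \<in> T" 
      using eventually_happens'[OF sequentially_bot] by blast
    then show "\<exists>b. b \<in> range horo_embed \<and> b \<in> T" by blast
  qed
  have "limitin (subtopology ?X horo_compactification) (\<lambda>n. horo_embed (rep \<eta> (real n))) (const_class g) sequentially"
    unfolding limitin_subtopology
    by (intro conjI L ac always_eventually allI subsetD[OF horo_embed_in_compactification]) auto
  from continuous_map_limit[OF horo_to_gromov(1) this]
  have "limitin gromov_topology (\<lambda>n. Inl (rep \<eta> (real n))) (horo_to_gromov (const_class g)) sequentially"
    by (simp add: o_def horo_to_gromov(2))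
  moreover have "limitin gromov_topology (\<lambda>n. Inl (rep \<eta> (real n))) (Inr \<eta>) sequentially"
    using converges_to_bdry_rep[OF e] unfolding converges_to_bdry_def .
  ultimately have "horo_to_gromov (const_class g) = Inr \<eta>"
    by (rule limitin_Hausdorff_unique) (auto simp: Hausdorff_space_gromov)
  then have "const_class g \<in> horo_fibre \<eta>" using ac unfolding horo_fibre_def by blast
  moreover have "(\<lambda>n. dist (rep \<eta> (real n)) y - real n) \<longlonglongrightarrow> horofunction (const_class g) p y" for y
    using lim[of y] unfolding horofunction_const_class gp h_def by simp
  ultimately show thesis using that by blast
qed

end

section \<open>Dilations at boundary regular fixed points\<close>

lemma non_expandingD: "non_expanding f \<Longrightarrow> dist (f x) (f y) \<le> dist x y"
  unfolding non_expanding_def by blast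

lemma non_expanding_funpow: "non_expanding f \<Longrightarrow> non_expanding (f ^^ n)"
proof (induction n)
  case (Suc n)
  have "dist (f ((f ^^ n) x)) (f ((f ^^ n) y)) \<le> dist x y" for x y
    using non_expandingD[OF Suc.prems] non_expandingD[OF Suc.IH[OF Suc.prems]] by (rule order_trans)
  then show ?case by (simp add: non_expanding_def)
qed (simp add: non_expanding_def)

context hyperbolic_metric
begin

lemma log_dilation_geI:
  assumes e: "\<eta> \<in> gromov_boundary" and "\<And>z. gp_ge (Inl z) (Inr \<eta>) r \<Longrightarrow> c \<le> dist z p - dist (g z) p"
  shows "ereal c \<le> log_dilation p g \<eta>"
  unfolding log_dilation_def
  by (rule Liminf_bounded) (use assms(2) in \<open>auto simp: eventually_at_bdry_iff[OF e]\<close>)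

lemma log_dilation_gtD:
  assumes e: "\<eta> \<in> gromov_boundary" and "ereal c < log_dilation p g \<eta>"
  shows "\<exists>r. \<forall>z. gp_ge (Inl z) (Inr \<eta>) r \<longrightarrow> c < dist z p - dist (g z) p"
  using less_LiminfD[OF assms(2)[unfolded log_dilation_def]] unfolding eventually_at_bdry_iff[OF e] by simp

lemma log_dilation_leI:
  assumes x: "converges_to_bdry x \<eta>" and "\<And>n. dist (x n) p - dist (g (x n)) p \<le> c"
  shows "log_dilation p g \<eta> \<le> ereal c"
proof (rule ccontr)
  assume "\<not> ?thesis"
  moreover have e: "\<eta> \<in> gromov_boundary" using x converges_to_bdry_iff by blast
  ultimately obtain r where r: "\<And>z. gp_ge (Inl z) (Inr \<eta>) r \<Longrightarrow> c < dist z p - dist (g z) p"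
    using log_dilation_gtD[of \<eta> c g] by force
  have "\<forall>\<^sub>F n in sequentially. gp_ge (Inl (x n)) (Inr \<eta>) r" using x converges_to_bdry_iff by blast
  then obtain n where "gp_ge (Inl (x n)) (Inr \<eta>) r" using eventually_happens'[OF sequentially_bot] by blast
  then show False using r[of "x n"] assms(2)[of n] by simp
qed

lemma log_dilation_lower:
  assumes e: "\<eta> \<in> gromov_boundary" and g: "non_expanding g"
  shows "ereal (- dist (g p) p) \<le> log_dilation p g \<eta>"
proof (rule log_dilation_geI[OF e])
  fix z show "- dist (g p) p \<le> dist z p - dist (g z) p"
    using non_expandingD[OF g, of z p] dist_triangle[of "g z" p "g p"] by linarith
qed

lemma BRFP_log_dilation_real:
  assumes "BRFP p g \<eta>" "non_expanding g"
  obtains L where "log_dilation p g \<eta> = ereal L"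
proof -
  have "log_dilation p g \<eta> < \<infinity>" "ereal (- dist (g p) p) \<le> log_dilation p g \<eta>"
    using assms log_dilation_lower unfolding BRFP_def by blast+
  then show thesis using that by (cases "log_dilation p g \<eta>") auto
qed

text \<open>A single ray point bounds the whole liminf: a geodesic from \<open>p\<close> to any
  \<open>z\<close> near \<open>\<eta>\<close> nearly passes through \<open>rep \<eta> s\<close>, and
  \<open>g\<close> does not lengthen the part beyond it.\<close>

lemma log_dilation_ge_ray:
  assumes e: "\<eta> \<in> gromov_boundary" and g: "non_expanding g" and s: "s \<ge> 0"
  shows "ereal (s - dist (g (rep \<eta> s)) p - 2 * \<delta>) \<le> log_dilation p g \<eta>"
proof (rule log_dilation_geI[OF e])
  fix z assume "gp_ge (Inl z) (Inr \<eta>) s"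
  then have "dist z (rep \<eta> s) \<le> dist z p - s + 2 * \<delta>" by (rule gp_ge_imp_dist[OF e _ s])
  moreover have "dist (g z) p \<le> dist (g z) (g (rep \<eta> s)) + dist (g (rep \<eta> s)) p" by (rule dist_triangle)
  moreover have "dist (g z) (g (rep \<eta> s)) \<le> dist z (rep \<eta> s)" by (rule non_expandingD[OF g])
  ultimately show "s - dist (g (rep \<eta> s)) p - 2 * \<delta> \<le> dist z p - dist (g z) p" by linarith
qed

text \<open>For large \<open>s\<close> the dilation fixes the distance of
  \<open>g (rep \<eta> s)\<close> from \<open>p\<close> between \<open>s - L - 2 * \<delta>\<close>
  and \<open>s - L + 1\<close>, the 1 being slack in the liminf; the geodesic limit fixes the
  direction. The image is then within \<open>5 * \<delta> + 1\<close> of the ray point at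
  \<open>s - L - 3 * \<delta>\<close>, and \<open>3 * \<delta>\<close> more leads to
  \<open>s - L\<close>.\<close>

lemma BRFP_translates_ray:
  assumes B: "BRFP p g \<eta>" and g: "non_expanding g" and L: "log_dilation p g \<eta> = ereal L"
  obtains S where "S \<ge> 0" "\<And>s. s \<ge> S \<Longrightarrow> s - L \<ge> 0 \<and> dist (g (rep \<eta> s)) (rep \<eta> (s - L)) \<le> 8 * \<delta> + 1"
proof -
  have e: "\<eta> \<in> gromov_boundary" and lim: "has_geodesic_limit g \<eta> (Inr \<eta>)" using B unfolding BRFP_def by auto
  have up: "s - L - 2 * \<delta> \<le> dist (g (rep \<eta> s)) p" if "s \<ge> 0" for s
    using log_dilation_ge_ray[OF e g that] unfolding L by simp
  obtain r where r: "\<And>z. gp_ge (Inl z) (Inr \<eta>) r \<Longrightarrow> L - 1 < dist z p - dist (g z) p"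
    using log_dilation_gtD[OF e, of "L - 1" g] unfolding L by auto
  have low: "dist (g (rep \<eta> s)) p < s - L + 1" if "s \<ge> 0" "s \<ge> r" for s
    using r[OF gp_ge_mono[OF gp_ge_rep[OF e that(1)] that(2)]] rep_dist(2)[OF e that(1)] by simp
  have "in_geodesic_region (\<lambda>n. rep \<eta> (real n)) \<eta>"
    unfolding in_geodesic_region_def geodesic_region_def
    using rep(3,4)[OF e] by (intro exI[of _ "rep \<eta>"] exI[of _ 1]) simp
  then have "limitin gromov_topology (\<lambda>n. Inl (g (rep \<eta> (real n)))) (Inr \<eta>) sequentially"
    using lim converges_to_bdry_rep[OF e] unfolding has_geodesic_limit_def by blast
  then have gl: "\<forall>\<^sub>F n in sequentially. gp_ge (Inl (g (rep \<eta> (real n)))) (Inr \<eta>) R" for R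
    unfolding limitin_bdry_iff by blast
  have "s - L \<ge> 0 \<and> dist (g (rep \<eta> s)) (rep \<eta> (s - L)) \<le> 8 * \<delta> + 1" if s: "s \<ge> max 0 (max r (L + 3 * \<delta>))" for s
  proof -
    have s0: "0 \<le> s" "r \<le> s" "0 \<le> s - L - 3 * \<delta>" using s by auto
    have "\<forall>\<^sub>F n in sequentially. s \<le> real n" by (metis filterlim_at_top filterlim_real_sequentially)
    with gl[of "s - L - 2 * \<delta>"]
    have "\<forall>\<^sub>F n in sequentially. gp_ge (Inl (g (rep \<eta> (real n)))) (Inr \<eta>) (s - L - 2 * \<delta>) \<and> s \<le> real n"
      by (rule eventually_conj)
    then obtain n where n: "gp_ge (Inl (g (rep \<eta> (real n)))) (Inr \<eta>) (s - L - 2 * \<delta>)" "s \<le> real n"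
      using eventually_happens'[OF sequentially_bot] by blast
    have "dist (g (rep \<eta> s)) (g (rep \<eta> (real n))) \<le> real n - s"
      using non_expandingD[OF g, of "rep \<eta> s" "rep \<eta> (real n)"] rep_dist(1)[OF e s0(1), of "real n"] n(2) by simp
    \<comment> \<open>Both images have the lower bound \<open>up\<close> on their distance from
      \<open>p\<close>, and they are at most \<open>real n - s\<close> apart; in the product
      \<open>real n\<close> cancels.\<close>
    then have "s - L - 2 * \<delta> \<le> gp (g (rep \<eta> s)) (g (rep \<eta> (real n)))"
      using up[OF s0(1)] up[of "real n"] unfolding gromov_product_def by simp
    then have "gp_ge (Inl (g (rep \<eta> s))) (Inl (g (rep \<eta> (real n)))) (s - L - 2 * \<delta>)"
      unfolding gp_ge_def by auto
    from gp_ge_trans[OF this n(1)] have "gp_ge (Inl (g (rep \<eta> s))) (Inr \<eta>) (s - L - 3 * \<delta>)" by simp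
    from gp_ge_imp_dist[OF e this s0(3)]
    have "dist (g (rep \<eta> s)) (rep \<eta> (s - L - 3 * \<delta>)) \<le> 5 * \<delta> + 1" using low[OF s0(1,2)] by simp
    moreover have "dist (rep \<eta> (s - L - 3 * \<delta>)) (rep \<eta> (s - L)) = 3 * \<delta>"
      using rep_dist(1)[OF e s0(3), of "s - L"] s0(3) delta_pos by simp
    ultimately show ?thesis
      using dist_triangle[of "g (rep \<eta> s)" "rep \<eta> (s - L)" "rep \<eta> (s - L - 3 * \<delta>)"] s0(3) delta_pos by simp
  qed
  then show thesis using that[of "max 0 (max r (L + 3 * \<delta>))"] by simp
qed

lemma BRFP_bounded_displacement:
  assumes B: "BRFP p g \<eta>" and g: "non_expanding g"
  obtains C where "\<And>t. t \<ge> 0 \<Longrightarrow> dist (g (rep \<eta> t)) (rep \<eta> t) \<le> C"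
proof -
  have e: "\<eta> \<in> gromov_boundary" using B unfolding BRFP_def by auto
  obtain L where L: "log_dilation p g \<eta> = ereal L" using BRFP_log_dilation_real[OF B g] .
  obtain S where S: "S \<ge> 0" "\<And>s. s \<ge> S \<Longrightarrow> s - L \<ge> 0 \<and> dist (g (rep \<eta> s)) (rep \<eta> (s - L)) \<le> 8 * \<delta> + 1"
    using BRFP_translates_ray[OF B g L] by blast
  have far: "dist (g (rep \<eta> t)) (rep \<eta> t) \<le> 8 * \<delta> + 1 + \<bar>L\<bar>" if "t \<ge> S" for t
  proof -
    have "dist (rep \<eta> (t - L)) (rep \<eta> t) = \<bar>L\<bar>"
      using rep_dist(1)[OF e, of "t - L" t] S(2)[OF that] that S(1) by simp
    then show ?thesis
      using S(2)[OF that] dist_triangle[of "g (rep \<eta> t)" "rep \<eta> t" "rep \<eta> (t - L)"] by simp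
  qed
  have "dist (g (rep \<eta> t)) (rep \<eta> t) \<le> 8 * \<delta> + 1 + \<bar>L\<bar> + 2 * S" if t: "t \<ge> 0" for t
  proof (cases "t \<ge> S")
    case False
    then have "dist (rep \<eta> t) (rep \<eta> S) \<le> S" using rep_dist(1)[OF e t S(1)] t by simp
    moreover have "dist (g (rep \<eta> t)) (g (rep \<eta> S)) \<le> dist (rep \<eta> t) (rep \<eta> S)" by (rule non_expandingD[OF g])
    moreover have "dist (g (rep \<eta> t)) (rep \<eta> t) \<le> dist (g (rep \<eta> t)) (g (rep \<eta> S)) + dist (g (rep \<eta> S)) (rep \<eta> t)"
      by (rule dist_triangle)
    moreover have "dist (g (rep \<eta> S)) (rep \<eta> t) \<le> dist (g (rep \<eta> S)) (rep \<eta> S) + dist (rep \<eta> t) (rep \<eta> S)"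
      by (rule dist_triangle2)
    ultimately show ?thesis using far[of S] by simp
  qed (use far S(1) in fastforce)
  then show thesis using that by blast
qed

text \<open>Converse of \<open>BRFP_bounded_displacement\<close>. Points of a geodesic region are at
  bounded distance from \<open>rep \<eta>\<close>, so \<open>g\<close> moves them a bounded amount,
  which does not change a limit on the boundary. The criterion concerns one ray only and therefore
  passes to iterates.\<close>

lemma bounded_displacement_BRFP:
  assumes e: "\<eta> \<in> gromov_boundary" and g: "non_expanding g"
    and C: "\<And>t. t \<ge> 0 \<Longrightarrow> dist (g (rep \<eta> t)) (rep \<eta> t) \<le> C"
  shows "BRFP p g \<eta>"
  unfolding BRFP_def
proof (intro conjI e)
  have "log_dilation p g \<eta> \<le> ereal C"
  proof (rule log_dilation_leI[OF converges_to_bdry_rep[OF e]])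
    fix n :: nat
    show "dist (rep \<eta> (real n)) p - dist (g (rep \<eta> (real n))) p \<le> C"
      using C[of "real n"] dist_triangle3[of "rep \<eta> (real n)" p "g (rep \<eta> (real n))"] by simp
  qed
  then show "log_dilation p g \<eta> < \<infinity>" by auto
  show "has_geodesic_limit g \<eta> (Inr \<eta>)"
    unfolding has_geodesic_limit_def
  proof (intro allI impI)
    fix x assume x: "converges_to_bdry x \<eta> \<and> in_geodesic_region x \<eta>"
    then obtain \<gamma> R where \<gamma>: "geodesic_ray \<gamma>" "ray_class \<gamma> = \<eta>" and R: "\<And>n. infdist (x n) (\<gamma> ` {0..}) < R"
      unfolding in_geodesic_region_def geodesic_region_def by auto
    have "rep \<eta> \<in> ray_class \<gamma>" using rep(1)[OF e] \<gamma>(2) by simp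
    then obtain D where D: "\<And>t. t \<ge> 0 \<Longrightarrow> dist (\<gamma> t) (rep \<eta> t) \<le> D" unfolding ray_class_def by blast
    have bd: "dist (g (x n)) (x n) \<le> 2 * (R + D) + C" for n
    proof -
      obtain t where t: "t \<ge> 0" "dist (x n) (\<gamma> t) < R"
        using R[of n] unfolding infdist_def by (auto simp: cINF_less_iff split: if_splits)
      have "dist (x n) (rep \<eta> t) \<le> R + D"
        using t D[OF t(1)] dist_triangle[of "x n" "rep \<eta> t" "\<gamma> t"] by simp
      then show ?thesis
        using C[OF t(1)] non_expandingD[OF g, of "x n" "rep \<eta> t"]
          dist_triangle[of "g (x n)" "x n" "g (rep \<eta> t)"] dist_triangle2[of "g (rep \<eta> t)" "x n" "rep \<eta> t"] by simp
    qed
    show "limitin gromov_topology (\<lambda>n. Inl (g (x n))) (Inr \<eta>) sequentially"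
      unfolding limitin_bdry_iff
    proof (intro conjI allI e)
      fix r
      have "\<forall>\<^sub>F n in sequentially. gp_ge (Inl (x n)) (Inr \<eta>) (r + (2 * (R + D) + C))"
        using x unfolding converges_to_bdry_iff by blast
      then show "\<forall>\<^sub>F n in sequentially. gp_ge (Inl (g (x n))) (Inr \<eta>) r"
      proof eventually_elim
        case (elim n)
        from gp_ge_Inl_lipschitz[OF elim, of "g (x n)" "2 * (R + D) + C"] bd[of n]
        show ?case by (simp add: dist_commute)
      qed
    qed
  qed
qed

lemma BRFP_funpow:
  assumes B: "BRFP p f \<eta>" and f: "non_expanding f"
  shows "BRFP p (f ^^ n) \<eta>"
proof -
  have e: "\<eta> \<in> gromov_boundary" using B unfolding BRFP_def by auto
  obtain C where C: "\<And>t. t \<ge> 0 \<Longrightarrow> dist (f (rep \<eta> t)) (rep \<eta> t) \<le> C"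
    using BRFP_bounded_displacement[OF B f] by blast
  have "dist ((f ^^ n) (rep \<eta> t)) (rep \<eta> t) \<le> real n * C" if t: "t \<ge> 0" for t
  proof (induction n)
    case (Suc n)
    have "dist ((f ^^ Suc n) (rep \<eta> t)) (rep \<eta> t) \<le> dist (f ((f ^^ n) (rep \<eta> t))) (f (rep \<eta> t)) + dist (f (rep \<eta> t)) (rep \<eta> t)"
      by (simp add: dist_triangle)
    also have "\<dots> \<le> real n * C + C" using Suc C[OF t] non_expandingD[OF f] by (meson add_mono order_trans)
    finally show ?case by (simp add: algebra_simps)
  qed simp
  then show ?thesis by (rule bounded_displacement_BRFP[OF e non_expanding_funpow[OF f]])
qed

text \<open>Far out, \<open>f ^^ n\<close> moves the ray \<open>rep \<eta>\<close> back along itself by \<open>L n\<close>, up to a constant that does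
  not depend on \<open>n\<close>; hence \<open>L\<close> is additive up to a constant.\<close>

lemma stable_dilation:
  assumes B: "BRFP p f \<eta>" and f: "non_expanding f"
  obtains L l where "\<And>n. log_dilation p (f ^^ n) \<eta> = ereal (L n)" "log_stable_dilation p f \<eta> = ereal l"
    "\<And>n. \<bar>L n - l * real n\<bar> \<le> 24 * \<delta> + 3"
proof -
  have e: "\<eta> \<in> gromov_boundary" using B unfolding BRFP_def by auto
  note Bn = BRFP_funpow[OF B f] and fn = non_expanding_funpow[OF f]
  have "\<exists>L. log_dilation p (f ^^ n) \<eta> = ereal L" for n
    using BRFP_log_dilation_real[OF Bn fn] by metis
  then obtain L where L: "\<And>n. log_dilation p (f ^^ n) \<eta> = ereal (L n)" by metis
  have "\<exists>S\<ge>0. \<forall>s\<ge>S. s - L n \<ge> 0 \<and> dist ((f ^^ n) (rep \<eta> s)) (rep \<eta> (s - L n)) \<le> 8 * \<delta> + 1" for n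
    using BRFP_translates_ray[OF Bn fn L] by metis
  then obtain S where S: "\<And>n. S n \<ge> 0"
      "\<And>n s. s \<ge> S n \<Longrightarrow> s - L n \<ge> 0 \<and> dist ((f ^^ n) (rep \<eta> s)) (rep \<eta> (s - L n)) \<le> 8 * \<delta> + 1" by metis
  have "\<bar>L (m + n) - L m - L n\<bar> \<le> 24 * \<delta> + 3" for m n
  proof -
    \<comment> \<open>\<open>s\<close> is so large that three translations apply: those of
      \<open>f ^^ n\<close> and \<open>f ^^ (m + n)\<close> at \<open>s\<close>, and that of
      \<open>f ^^ m\<close> at \<open>s - L n\<close>. Each contributes
      \<open>8 * \<delta> + 1\<close>.\<close>
    define s where "s = max (S n) (max (S (m + n)) (S m + L n))"
    have s: "s \<ge> S n" "s \<ge> S (m + n)" "s - L n \<ge> S m" unfolding s_def by auto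
    have "dist ((f ^^ m) ((f ^^ n) (rep \<eta> s))) ((f ^^ m) (rep \<eta> (s - L n))) \<le> 8 * \<delta> + 1"
      using non_expandingD[OF fn] S(2)[OF s(1)] order_trans by blast
    moreover have "dist ((f ^^ m) (rep \<eta> (s - L n))) (rep \<eta> (s - L n - L m)) \<le> 8 * \<delta> + 1" using S(2)[OF s(3)] by blast
    moreover have "dist ((f ^^ m) ((f ^^ n) (rep \<eta> s))) (rep \<eta> (s - L (m + n))) \<le> 8 * \<delta> + 1"
      using S(2)[OF s(2)] by (simp add: funpow_add)
    moreover have "dist (rep \<eta> (s - L (m + n))) (rep \<eta> (s - L n - L m)) \<le>
        dist (rep \<eta> (s - L (m + n))) ((f ^^ m) ((f ^^ n) (rep \<eta> s))) +
        (dist ((f ^^ m) ((f ^^ n) (rep \<eta> s))) ((f ^^ m) (rep \<eta> (s - L n))) +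
         dist ((f ^^ m) (rep \<eta> (s - L n))) (rep \<eta> (s - L n - L m)))"
      by (meson add_left_mono dist_triangle order_trans)
    ultimately have "dist (rep \<eta> (s - L (m + n))) (rep \<eta> (s - L n - L m)) \<le> 24 * \<delta> + 3"
      by (simp add: dist_commute)
    moreover have "dist (rep \<eta> (s - L (m + n))) (rep \<eta> (s - L n - L m)) = \<bar>(s - L (m + n)) - (s - L n - L m)\<bar>"
      using S(2)[OF s(2)] S(2)[OF s(3)] by (intro rep_dist(1)[OF e]) auto
    ultimately show ?thesis by linarith
  qed
  then obtain l where l: "(\<lambda>n. L n / real n) \<longlonglongrightarrow> l" "\<And>n. \<bar>L n - l * real n\<bar> \<le> 24 * \<delta> + 3"
    using quasi_additive_limit by blast
  have "(\<lambda>n. ereal (L n / real n)) \<longlonglongrightarrow> ereal l" using l(1) by simp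
  moreover have "\<forall>\<^sub>F n in sequentially. ereal (L n / real n) = log_dilation p (f ^^ n) \<eta> / ereal (real n)"
    using eventually_gt_at_top[of 0] by eventually_elim (simp add: L)
  ultimately have "(\<lambda>n. log_dilation p (f ^^ n) \<eta> / ereal (real n)) \<longlonglongrightarrow> ereal l"
    by (rule Lim_transform_eventually)
  then have "log_stable_dilation p f \<eta> = ereal l" unfolding log_stable_dilation_def by (rule limI)
  then show thesis using that L l(2) by blast
qed

end

section \<open>Backward orbits\<close>

locale bounded_backward_orbit = hyperbolic_metric \<delta> p for \<delta> and p :: "'a::heine_borel" +
  fixes f :: "'a \<Rightarrow> 'a" and x :: "nat \<Rightarrow> 'a"
  assumes f: "non_expanding f" and orbit: "backward_orbit f x"
    and esc: "escaping x" and bdd: "bounded_step x"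
begin

abbreviation \<sigma> :: "nat \<Rightarrow> real" where "\<sigma> \<equiv> backward_step x"

lemma f_orbit: "f (x (Suc n)) = x n"
  using orbit unfolding backward_orbit_def by blast

lemma funpow_orbit: "(f ^^ m) (x (n + m)) = x n"
proof (induction m)
  case (Suc m)
  have "(f ^^ Suc m) (x (n + Suc m)) = (f ^^ m) (f (x (Suc (n + m))))" by (simp add: funpow_swap1)
  then show ?case using Suc by (simp add: f_orbit)
qed simp

lemma step_incseq: "incseq (\<lambda>n. dist (x n) (x (n + m)))"
proof (rule incseq_SucI)
  fix n
  have "dist (f (x (Suc n))) (f (x (Suc (n + m)))) \<le> dist (x (Suc n)) (x (Suc (n + m)))"
    by (rule non_expandingD[OF f])
  then show "dist (x n) (x (n + m)) \<le> dist (x (Suc n)) (x (Suc n + m))" by (simp add: f_orbit)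
qed

lemma step_bounded: "\<exists>C\<ge>0. \<forall>n m. dist (x n) (x (n + m)) \<le> C * real m"
proof -
  obtain C where C: "\<And>n. dist (x n) (x (Suc n)) \<le> C"
    using bdd unfolding bounded_step_def bdd_above_def by auto
  have "dist (x n) (x (n + m)) \<le> C * real m" for n m
  proof (induction m)
    case (Suc m)
    then show ?case using C[of "n + m"] dist_triangle[of "x n" "x (n + Suc m)" "x (n + m)"]
      by (simp add: algebra_simps)
  qed simp
  moreover have "C \<ge> 0" using C[of 0] zero_le_dist order_trans by blast
  ultimately show ?thesis by blast
qed

lemma step_limit: "(\<lambda>n. dist (x n) (x (n + m))) \<longlonglongrightarrow> \<sigma> m"
proof -
  obtain C where "\<forall>n m. dist (x n) (x (n + m)) \<le> C * real m" using step_bounded by blast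
  then have "\<forall>n. dist (x n) (x (n + m)) \<le> C * real m" by blast
  from incseq_convergent[OF step_incseq this]
  obtain L where "(\<lambda>n. dist (x n) (x (n + m))) \<longlonglongrightarrow> L" by blast
  then show ?thesis unfolding backward_step_def by (simp add: limI)
qed

lemma dist_le_step: "dist (x n) (x (n + m)) \<le> \<sigma> m"
  using incseq_le[OF step_incseq step_limit] .

lemma step_leI: "(\<And>n. dist (x n) (x (n + m)) \<le> c) \<Longrightarrow> \<sigma> m \<le> c"
  using step_limit by (rule Lim_bounded) blast

lemma step_rate:
  "(\<lambda>m. \<sigma> m / real m) \<longlonglongrightarrow> backward_step_rate x" "m > 0 \<Longrightarrow> backward_step_rate x \<le> \<sigma> m / real m"
proof -
  have "\<sigma> (m + k) \<le> \<sigma> m + \<sigma> k" for m k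
  proof (rule step_leI)
    fix n
    show "dist (x n) (x (n + (m + k))) \<le> \<sigma> m + \<sigma> k"
      using dist_le_step[of n m] dist_le_step[of "n + m" k] dist_triangle[of "x n" "x (n + (m + k))" "x (n + m)"]
      by (simp add: add.assoc)
  qed
  moreover have "- (0 * real n) \<le> \<sigma> n" for n
    using order_trans[OF zero_le_dist dist_le_step[of 0 n]] by simp
  ultimately obtain l where l: "(\<lambda>m. \<sigma> m / real m) \<longlonglongrightarrow> l" "\<And>m. m > 0 \<Longrightarrow> l \<le> \<sigma> m / real m"
    using subadditive_limit[of \<sigma> 0] by blast
  then have "backward_step_rate x = l" unfolding backward_step_rate_def by (simp add: limI)
  with l show "(\<lambda>m. \<sigma> m / real m) \<longlonglongrightarrow> backward_step_rate x" "m > 0 \<Longrightarrow> backward_step_rate x \<le> \<sigma> m / real m"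
    by auto
qed

lemma step_rate_geI:
  assumes "\<And>m. c * real m - D \<le> \<sigma> m" shows "c \<le> backward_step_rate x"
proof (rule LIMSEQ_le)
  show "(\<lambda>m. c - D / real m) \<longlonglongrightarrow> c" using tendsto_diff[OF tendsto_const lim_const_over_n[of D]] by simp
  show "(\<lambda>m. \<sigma> m / real m) \<longlonglongrightarrow> backward_step_rate x" by (rule step_rate)
  have "c - D / real m \<le> \<sigma> m / real m" if "m \<ge> 1" for m
  proof -
    have "(c * real m - D) / real m \<le> \<sigma> m / real m" using assms[of m] by (intro divide_right_mono) auto
    then show ?thesis using that by (simp add: diff_divide_distrib)
  qed
  then show "\<exists>N. \<forall>n\<ge>N. c - D / real n \<le> \<sigma> n / real n" by blast
qed

lemma orbit_to_infinity: "\<exists>N. \<forall>n\<ge>N. R \<le> dist (x n) q"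
proof -
  have "compact (cball q R)" by simp
  then have "\<forall>\<^sub>F n in sequentially. x n \<notin> cball q R" using esc unfolding escaping_def by blast
  then show ?thesis unfolding eventually_sequentially by (force simp: dist_commute)
qed

section \<open>Conditions that force a positive rate\<close>

lemma quasi_geodesic_imp_rate_pos:
  assumes "discrete_quasi_geodesic_ray x" shows "backward_step_rate x > 0"
proof -
  obtain A B where A: "A \<ge> 1" and AB: "\<And>n m. \<bar>real n - real m\<bar> / A - B \<le> dist (x n) (x m)"
    using assms unfolding discrete_quasi_geodesic_ray_def by blast
  have "1 / A \<le> backward_step_rate x"
  proof (rule step_rate_geI)
    fix m show "1 / A * real m - B \<le> \<sigma> m" using AB[of 0 m] dist_le_step[of 0 m] by simp
  qed
  moreover have "0 < 1 / A" using A by simp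
  ultimately show ?thesis by linarith
qed

text \<open>Points of the orbit are shadowed by parameters \<open>t n\<close> on the ray. Once \<open>x n\<close> and \<open>x (n + M)\<close>
  are always far apart, \<open>t (n + M) - t n\<close> cannot change sign between consecutive \<open>n\<close>.\<close>

lemma geodesic_region_imp_rate_pos:
  assumes "in_geodesic_region x \<eta>" shows "backward_step_rate x > 0"
proof -
  obtain \<gamma> R where \<gamma>: "geodesic_ray \<gamma>" and R: "R > 0" "\<And>n. infdist (x n) (\<gamma> ` {0..}) < R"
    using assms unfolding in_geodesic_region_def geodesic_region_def by auto
  have "\<exists>t\<ge>0. dist (x n) (\<gamma> t) < R" for n
    using R(2)[of n] unfolding infdist_def by (auto simp: cINF_less_iff split: if_splits)
  then obtain t where t: "\<And>n. t n \<ge> 0" "\<And>n. dist (x n) (\<gamma> (t n)) < R" by metis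
  have tt: "\<bar>t m - t n\<bar> \<le> dist (x m) (x n) + 2 * R" "dist (x m) (x n) \<le> \<bar>t m - t n\<bar> + 2 * R" for m n
  proof -
    have "dist (\<gamma> (t m)) (\<gamma> (t n)) = \<bar>t m - t n\<bar>" using \<gamma> t(1) unfolding geodesic_ray_def by blast
    moreover have "dist (\<gamma> (t m)) (\<gamma> (t n)) \<le> dist (x m) (\<gamma> (t m)) + (dist (x m) (x n) + dist (x n) (\<gamma> (t n)))"
      by (meson add_left_mono dist_triangle dist_triangle3 order_trans)
    moreover have "dist (x m) (x n) \<le> dist (x m) (\<gamma> (t m)) + (dist (\<gamma> (t m)) (\<gamma> (t n)) + dist (x n) (\<gamma> (t n)))"
      by (meson add_left_mono dist_triangle dist_triangle2 order_trans)
    ultimately show "\<bar>t m - t n\<bar> \<le> dist (x m) (x n) + 2 * R" "dist (x m) (x n) \<le> \<bar>t m - t n\<bar> + 2 * R"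
      using t(2)[of m] t(2)[of n] by auto
  qed
  obtain C where C: "C \<ge> 0" "\<And>n m. dist (x n) (x (n + m)) \<le> C * real m" using step_bounded by blast
  \<comment> \<open>\<open>c\<close> strictly bounds the change of the parameter \<open>t\<close> in
    one step, so \<open>s\<close> below changes by less than \<open>2 * c\<close>; a change of sign
    between values of modulus at least \<open>2 * c\<close> would be a jump of
    \<open>4 * c\<close>.\<close>
  define c where "c = C + 2 * R + 1"
  have c: "c \<ge> 1" using C(1) R(1) unfolding c_def by simp
  \<comment> \<open>One far point \<open>x M\<close> suffices: by monotonicity
    \<open>dist (x n) (x (n + M))\<close> is at least as large for every \<open>n\<close>.\<close>
  obtain M where M: "2 * c + 2 * R \<le> dist (x M) (x 0)" using orbit_to_infinity by blast
  have M0: "M > 0" using M c R(1) by (intro gr0I) auto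
  define s where "s n = t (n + M) - t n" for n
  have s_big: "2 * c \<le> \<bar>s n\<bar>" for n
  proof -
    have "dist (x 0) (x (0 + M)) \<le> dist (x n) (x (n + M))" using step_incseq by (rule incseqD) simp
    then show ?thesis using M tt(2)[of "n + M" n] unfolding s_def by (simp add: dist_commute)
  qed
  have t_step: "\<bar>t (Suc n) - t n\<bar> < c" for n
    using tt(1)[of "Suc n" n] C(2)[of n 1] unfolding c_def by (simp add: dist_commute)
  have s_step: "\<bar>s (Suc n) - s n\<bar> < 2 * c" for n
    using t_step[of n] t_step[of "n + M"] unfolding s_def by simp
  have sign: "s n > 0 \<longleftrightarrow> s 0 > 0" for n
  proof (induction n)
    case (Suc n)
    have "s (Suc n) > 0 \<longleftrightarrow> s n > 0" using s_big[of n] s_big[of "Suc n"] s_step[of n] c by (intro iffI) linarith+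
    then show ?case using Suc by simp
  qed simp
  \<comment> \<open>With the other sign the parameters would decrease without bound along multiples
    of \<open>M\<close>, but they are nonnegative.\<close>
  have "s 0 > 0"
  proof (rule ccontr)
    assume "\<not> s 0 > 0"
    then have "s n \<le> - 1" for n using sign[of n] s_big[of n] c by linarith
    then have dec: "t (n + M) \<le> t n - 1" for n unfolding s_def by (simp add: diff_le_eq)
    have "t (j * M) \<le> t 0 - real j" for j
    proof (induction j)
      case (Suc j)
      then show ?case using dec[of "j * M"] by (simp add: add.commute)
    qed simp
    moreover obtain j :: nat where "t 0 < real j" using reals_Archimedean2 by blast
    ultimately show False using t(1)[of "j * M"] by (smt (verit))
  qed
  then have inc: "t n + 1 \<le> t (n + M)" for n using sign[of n] s_big[of n] c unfolding s_def by linarith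
  have tj: "real j \<le> t (j * M + r)" for j r
  proof (induction j)
    case (Suc j)
    have eq: "Suc j * M + r = (j * M + r) + M" by simp
    have "real j + 1 \<le> t (j * M + r + M)" using Suc inc[of "j * M + r"] by linarith
    then show ?case unfolding eq by simp
  qed (use t in simp)
  have "1 / real M \<le> backward_step_rate x"
  proof (rule step_rate_geI)
    fix m
    have "real m = real (m div M) * real M + real (m mod M)" by (metis div_mult_mod_eq of_nat_add of_nat_mult)
    then have "real m \<le> (real (m div M) + 1) * real M" using M0 by (simp add: algebra_simps less_imp_le)
    then have "1 / real M * real m - 1 \<le> real (m div M)" using M0 by (simp add: field_simps)
    also have "\<dots> \<le> t m" using tj[of "m div M" "m mod M"] by simp
    finally show "1 / real M * real m - (1 + t 0 + 2 * R) \<le> \<sigma> m"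
      using tt(1)[of m 0] dist_le_step[of 0 m] by (simp add: dist_commute)
  qed
  moreover have "0 < 1 / real M" using M0 by simp
  ultimately show ?thesis by linarith
qed

text \<open>The orbit itself serves as test sequence for the liminf: it tends to
  \<open>\<eta>\<close>, and \<open>f ^^ m\<close> carries \<open>x (n + m)\<close> to
  \<open>x n\<close>.\<close>

lemma log_dilation_le_step:
  assumes "converges_to_bdry x \<eta>" shows "log_dilation p (f ^^ m) \<eta> \<le> ereal (\<sigma> m)"
proof (rule log_dilation_leI)
  show "converges_to_bdry (\<lambda>n. x (n + m)) \<eta>"
    using assms unfolding converges_to_bdry_iff
    by (auto intro: eventually_sequentially_seg[THEN iffD2])
  fix n
  show "dist (x (n + m)) p - dist ((f ^^ m) (x (n + m))) p \<le> \<sigma> m"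
    using dist_le_step[of n m] dist_triangle3[of "x (n + m)" p "x n"] by (simp add: funpow_orbit)
qed

text \<open>Used in both directions: it makes the rate positive once \<open>l\<close> is, and it is
  one half of the equality in (7).\<close>

lemma stable_dilation_le_rate:
  assumes "BRFP p f \<eta>" "converges_to_bdry x \<eta>" "log_stable_dilation p f \<eta> = ereal l"
  shows "l \<le> backward_step_rate x"
proof -
  obtain L l' where L: "\<And>n. log_dilation p (f ^^ n) \<eta> = ereal (L n)" "log_stable_dilation p f \<eta> = ereal l'"
    "\<And>n. \<bar>L n - l' * real n\<bar> \<le> 24 * \<delta> + 3"
    using stable_dilation[OF assms(1) f] by metis
  show ?thesis
  proof (rule step_rate_geI)
    fix m
    have "L m \<le> \<sigma> m" using log_dilation_le_step[OF assms(2), of m] L(1) by simp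
    then show "l * real m - (24 * \<delta> + 3) \<le> \<sigma> m" using L(3)[of m] L(2) assms(3) by simp
  qed
qed

lemma repelling_imp_rate_pos:
  assumes "repelling_BRFP p f \<eta>" "converges_to_bdry x \<eta>"
  shows "backward_step_rate x > 0"
proof -
  have B: "BRFP p f \<eta>" and pos: "log_stable_dilation p f \<eta> > 0" using assms(1) unfolding repelling_BRFP_def by auto
  obtain l where l: "log_stable_dilation p f \<eta> = ereal l" using stable_dilation[OF B f] by metis
  then have "l > 0" using pos by simp
  then show ?thesis using stable_dilation_le_rate[OF B assms(2) l] by simp
qed

text \<open>If the logarithm \<open>l\<close> of the stable dilation is at most \<open>0\<close>, then \<open>log_dilation p (f ^^ n) \<eta>\<close> is
  bounded above in \<open>n\<close>. For \<open>w\<close> far out on the ray, \<open>dist w (x n) \<ge> dist ((f ^^ n) w) (x 0)\<close> then bounds the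
  Busemann function of the ray from below along the orbit.\<close>

lemma horofunction_unbounded_imp_rate_pos:
  assumes B: "BRFP p f \<eta>" and x: "converges_to_bdry x \<eta>"
    and h: "\<And>a. a \<in> horo_fibre \<eta> \<Longrightarrow> liminf (\<lambda>n. ereal (horofunction a p (x n))) = -\<infinity>"
  shows "backward_step_rate x > 0"
proof -
  have e: "\<eta> \<in> gromov_boundary" using B unfolding BRFP_def by auto
  obtain L l where L: "\<And>n. log_dilation p (f ^^ n) \<eta> = ereal (L n)" "log_stable_dilation p f \<eta> = ereal l"
    "\<And>n. \<bar>L n - l * real n\<bar> \<le> 24 * \<delta> + 3"
    using stable_dilation[OF B f] by metis
  obtain a where a: "a \<in> horo_fibre \<eta>"
    "\<And>y. (\<lambda>n. dist (rep \<eta> (real n)) y - real n) \<longlonglongrightarrow> horofunction a p y"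
    using busemann_in_horo_fibre[OF e] by blast
  have "l > 0"
  proof (rule ccontr)
    assume "\<not> l > 0"
    then have Lb: "L n \<le> 24 * \<delta> + 3" for n
      using L(3)[of n] mult_nonpos_nonneg[of l "real n"] by simp
    \<comment> \<open>\<open>24 * \<delta> + 3\<close> bounds \<open>L n\<close>,
      \<open>2 * \<delta>\<close> comes from \<open>log_dilation_ge_ray\<close>, and
      \<open>dist p (x 0)\<close> from replacing \<open>p\<close> by \<open>x 0\<close>.\<close>
    define c where "c = 26 * \<delta> + 3 + dist p (x 0)"
    have "- c \<le> horofunction a p (x n)" for n
    proof (rule LIMSEQ_le_const[OF a(2)], intro exI allI impI)
      fix k :: nat
      have "real k - dist ((f ^^ n) (rep \<eta> (real k))) p - 2 * \<delta> \<le> L n"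
        using log_dilation_ge_ray[OF e non_expanding_funpow[OF f], of "real k" n] unfolding L(1) by simp
      moreover have "dist ((f ^^ n) (rep \<eta> (real k))) (x 0) \<le> dist (rep \<eta> (real k)) (x n)"
        using non_expandingD[OF non_expanding_funpow[OF f, of n], of "rep \<eta> (real k)" "x n"] funpow_orbit[of n 0] by simp
      moreover have "dist ((f ^^ n) (rep \<eta> (real k))) p \<le> dist ((f ^^ n) (rep \<eta> (real k))) (x 0) + dist p (x 0)"
        by (rule dist_triangle2)
      ultimately show "- c \<le> dist (rep \<eta> (real k)) (x n) - real k" using Lb[of n] unfolding c_def by simp
    qed
    then have "ereal (- c) \<le> liminf (\<lambda>n. ereal (horofunction a p (x n)))"
      by (intro Liminf_bounded always_eventually allI) simp
    then show False using h[OF a(1)] by simp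
  qed
  then show ?thesis using stable_dilation_le_rate[OF B x L(2)] by simp
qed

section \<open>Backward orbits of positive rate\<close>

text \<open>If doubling always gained less than \<open>\<kappa>\<close>, then dividing by
  \<open>2 * M\<close> and letting \<open>M\<close> grow would bound the rate by half of
  itself.\<close>

lemma rate_pos_imp_doubling:
  assumes b: "backward_step_rate x > 0"
  shows "\<exists>M>0. \<sigma> M + \<kappa> \<le> \<sigma> (2 * M)"
proof (rule ccontr)
  assume "\<not> ?thesis"
  then have less: "\<sigma> (2 * M) < \<sigma> M + \<kappa>" if "M > 0" for M using that by (meson not_le)
  let ?b = "backward_step_rate x"
  have "strict_mono (\<lambda>M::nat. 2 * M)" by (simp add: strict_mono_def)
  from LIMSEQ_subseq_LIMSEQ[OF step_rate(1) this]
  have 1: "(\<lambda>M. \<sigma> (2 * M) / real (2 * M)) \<longlonglongrightarrow> ?b" by (simp add: o_def)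
  have 2: "(\<lambda>M. (\<sigma> M / real M + \<kappa> / real M) / 2) \<longlonglongrightarrow> (?b + 0) / 2"
    by (intro tendsto_intros step_rate(1) lim_const_over_n) simp
  have "?b \<le> (?b + 0) / 2"
  proof (rule LIMSEQ_le[OF 1 2], intro exI allI impI)
    fix M :: nat assume "M \<ge> 1"
    then show "\<sigma> (2 * M) / real (2 * M) \<le> (\<sigma> M / real M + \<kappa> / real M) / 2"
      using less[of M] by (simp add: field_simps)
  qed
  then show False using b by simp
qed

text \<open>By the doubling property, \<open>x (N + j * M)\<close> is a chain to which the chain lemmas apply; the
  remaining points of the orbit stay within bounded distance of it.\<close>

lemma rate_pos_chain:
  assumes b: "backward_step_rate x > 0"
  obtains y :: "nat \<Rightarrow> 'a" and j :: "nat \<Rightarrow> nat" and E D a M N where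
    "mono j" "\<And>n. dist (x n) (y (j n)) \<le> E"
    "\<And>i k m. i \<le> k \<Longrightarrow> k \<le> m \<Longrightarrow> dist (y i) (y k) + dist (y k) (y m) - D \<le> dist (y i) (y m)"
    "a > 0" "\<And>i n. a * (real n - 1) \<le> dist (y i) (y (i + n))"
    "M > 0" "\<And>n m. real m \<le> M * (real (j (n + m)) - real (j n)) + N"
proof -
  obtain C where C: "C \<ge> 0" "\<And>n m. dist (x n) (x (n + m)) \<le> C * real m" using step_bounded by blast
  \<comment> \<open>The chain lemmas need the gain \<open>2 * \<delta> + a\<close> with
    \<open>a = 2 * \<delta> + 1\<close>; one more unit is lost because the distances reach
    \<open>\<sigma> (2 * M)\<close> only up to 1 from the index \<open>N\<close> on.\<close>
  obtain M where M: "M > 0" "\<sigma> M + (4 * \<delta> + 2) \<le> \<sigma> (2 * M)" using rate_pos_imp_doubling[OF b] by blast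
  have "\<forall>\<^sub>F n in sequentially. \<sigma> (2 * M) - 1 < dist (x n) (x (n + 2 * M))"
    by (rule order_tendstoD(1)[OF step_limit]) simp
  then obtain N where N: "\<And>n. n \<ge> N \<Longrightarrow> \<sigma> (2 * M) - 1 < dist (x n) (x (n + 2 * M))"
    unfolding eventually_sequentially by blast
  define y where "y i = x (N + i * M)" for i
  \<comment> \<open>Truncated subtraction assigns the finitely many points before \<open>N\<close>
    to the first chain point.\<close>
  define j where "j n = (n - N) div M" for n
  define a where "a = 2 * \<delta> + 1"
  have a: "a > \<delta>" "a > 0" using delta_pos unfolding a_def by auto
  have ystep: "dist (y i) (y (Suc i)) \<le> \<sigma> M" for i
    using dist_le_step[of "N + i * M" M] unfolding y_def by (simp add: algebra_simps)
  have step: "max (dist (y i) (y (i+1))) (dist (y (i+1)) (y (i+2))) + 2 * \<delta> + a \<le> dist (y i) (y (i+2))" for i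
  proof -
    have "\<sigma> (2 * M) - 1 < dist (y i) (y (i + 2))"
    proof -
      have "N + (i + 2) * M = N + i * M + 2 * M" by simp
      then show ?thesis using N[of "N + i * M"] unfolding y_def by (simp only: le_add1 simp_thms)
    qed
    then show ?thesis using ystep[of i] ystep[of "i + 1"] M(2) unfolding a_def by simp
  qed
  have "mono j" unfolding j_def by (intro monoI div_le_mono diff_le_mono)
  moreover have "dist (x n) (y (j n)) \<le> C * real (N + M)" for n
  proof (cases "n \<ge> N")
    case True
    have "n = N + j n * M + (n - N) mod M" unfolding j_def using True by simp
    then have "dist (y (j n)) (x n) \<le> C * real ((n - N) mod M)"
      using C(2)[of "N + j n * M" "(n - N) mod M"] unfolding y_def by simp
    also have "\<dots> \<le> C * real (N + M)" using C(1) M(1)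
      by (intro mult_left_mono of_nat_mono) (auto intro: trans_le_add2 mod_le_divisor)
    finally show ?thesis by (simp add: dist_commute)
  next
    case False
    then have "j n = 0" "n + (N - n) = N" unfolding j_def by auto
    then have "dist (x n) (y (j n)) \<le> C * real (N - n)" using C(2)[of n "N - n"] unfolding y_def by simp
    also have "\<dots> \<le> C * real (N + M)" using C(1) by (intro mult_left_mono) auto
    finally show ?thesis .
  qed
  moreover have "real m \<le> real M * (real (j (n + m)) - real (j n)) + (real N + real M)" for n m
  proof -
    have up: "real k \<le> real M * real (j k) + real N + real M" for k
    proof -
      have "k \<le> N + (j k * M + (k - N) mod M)" unfolding j_def by simp
      also have "\<dots> \<le> N + (j k * M + M)" using M(1) by (simp add: less_imp_le)
      finally have "real k \<le> real (N + (j k * M + M))" by (rule of_nat_mono)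
      then show ?thesis by (simp add: algebra_simps)
    qed
    have "real M * real (j n) \<le> real n \<and> (n \<ge> N \<longrightarrow> real M * real (j n) \<le> real n - real N) \<and> (n < N \<longrightarrow> j n = 0)"
    proof -
      have "j n * M \<le> n - N" unfolding j_def by simp
      then have *: "real M * real (j n) \<le> real (n - N)" by (metis mult.commute of_nat_mono of_nat_mult)
      also have "\<dots> \<le> real n" by simp
      finally show ?thesis using * by (auto simp: j_def of_nat_diff)
    qed
    then show ?thesis using up[of "n + m"] by (cases "n \<ge> N") (auto simp: algebra_simps)
  qed
  ultimately show thesis
    using that[of j y "C * real (N + M)" "2 * \<sigma> M + 2 * \<delta>" a "real M" "real N + real M"]
      chain_almost_geodesic[OF step a(1) ystep] chain_linear_growth[OF step a(2)] a(2) M(1) by simp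
qed

lemma rate_pos_imp_quasi_geodesic:
  assumes b: "backward_step_rate x > 0"
  shows "discrete_quasi_geodesic_ray x"
proof -
  obtain y :: "nat \<Rightarrow> 'a" and j :: "nat \<Rightarrow> nat" and E D a M N where
    j: "mono j" and E: "\<And>n. dist (x n) (y (j n)) \<le> E"
    and a: "a > 0" "\<And>i n. a * (real n - 1) \<le> dist (y i) (y (i + n))"
    and M: "M > 0" "\<And>n m. real m \<le> M * (real (j (n + m)) - real (j n)) + N"
    using rate_pos_chain[OF b] by metis
  obtain C where C: "C \<ge> 0" "\<And>n m. dist (x n) (x (n + m)) \<le> C * real m" using step_bounded by blast
  \<comment> \<open>\<open>C\<close> bounds one orbit step from above. From below, the chain gains
    \<open>a\<close> per index and an index stands for about \<open>M\<close> orbit steps, hence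
    \<open>M / a\<close>; \<open>B\<close> absorbs the rounding of indices and the distance
    \<open>E\<close> to the chain.\<close>
  define A where "A = max 1 (max C (M / a))"
  define B where "B = \<bar>a * (N / M + 1)\<bar> + 2 * E"
  have E0: "E \<ge> 0" using E[of 0] zero_le_dist order_trans by blast
  have low: "real m / A - B \<le> dist (x n) (x (n + m))" for n m
  proof -
    define k where "k = j (n + m) - j n"
    have k: "j (n + m) = j n + k" using monoD[OF j, of n "n + m"] unfolding k_def by simp
    have "real m \<le> M * real k + N" using M(2)[of m n] k by simp
    then have "real m / M \<le> real k + N / M" using M(1) by (simp add: field_simps)
    then have "a * (real m / M) \<le> a * (real k + N / M)" using a(1) by (intro mult_left_mono) auto
    moreover have "a * (real k - 1) \<le> dist (y (j n)) (y (j (n + m)))" using a(2)[of k "j n"] k by simp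
    moreover have "dist (y (j n)) (y (j (n + m))) \<le> dist (x n) (x (n + m)) + 2 * E"
      using E[of n] E[of "n + m"] dist_triangle3[of "y (j n)" "y (j (n + m))" "x n"]
        dist_triangle[of "x n" "y (j (n + m))" "x (n + m)"] by simp
    moreover have "real m / A \<le> a * (real m / M)"
    proof -
      have "M / a \<le> A" unfolding A_def by simp
      then have "1 / A \<le> a / M" using a(1) M(1)
        by (metis divide_pos_pos frac_le inverse_divide inverse_eq_divide le_imp_inverse_le)
      from mult_left_mono[OF this, of "real m"] show ?thesis by (simp add: mult.commute)
    qed
    ultimately have "real m / A - (a * (N / M + 1) + 2 * E) \<le> dist (x n) (x (n + m))" by (simp add: algebra_simps)
    then show ?thesis unfolding B_def by argo
  qed
  have up: "dist (x n) (x (n + m)) \<le> A * real m + B" for n m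
  proof -
    have "C * real m \<le> A * real m" unfolding A_def by (intro mult_right_mono) auto
    then show ?thesis using C(2)[of n m] E0 unfolding B_def by simp
  qed
  have "\<bar>real n - real m\<bar> / A - B \<le> dist (x n) (x m) \<and> dist (x n) (x m) \<le> A * \<bar>real n - real m\<bar> + B" for n m
  proof (cases "n \<le> m")
    case True
    then show ?thesis using low[of "m - n" n] up[of n "m - n"] by (simp add: of_nat_diff)
  next
    case False
    then show ?thesis using low[of "n - m" m] up[of m "n - m"] by (simp add: of_nat_diff dist_commute)
  qed
  then show ?thesis
    unfolding discrete_quasi_geodesic_ray_def
    by (intro exI[of _ A] exI[of _ B]) (auto simp: A_def B_def E0)
qed

section \<open>The boundary point of an orbit of positive rate and its properties\<close>

lemma rate_pos_almost_geodesic: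
  assumes b: "backward_step_rate x > 0"
  obtains D where "D \<ge> 0"
    "\<And>i k m. i \<le> k \<Longrightarrow> k \<le> m \<Longrightarrow> dist (x i) (x k) + dist (x k) (x m) - D \<le> dist (x i) (x m)"
proof -
  obtain y :: "nat \<Rightarrow> 'a" and j :: "nat \<Rightarrow> nat" and E D where
    j: "mono j" and E: "\<And>n. dist (x n) (y (j n)) \<le> E"
    and D: "\<And>i k m. i \<le> k \<Longrightarrow> k \<le> m \<Longrightarrow> dist (y i) (y k) + dist (y k) (y m) - D \<le> dist (y i) (y m)"
    using rate_pos_chain[OF b] by metis
  have xy: "\<bar>dist (x i) (x k) - dist (y (j i)) (y (j k))\<bar> \<le> 2 * E" for i k
    using E[of i] E[of k] dist_triangle3[of "y (j i)" "y (j k)" "x i"] dist_triangle[of "x i" "y (j k)" "x k"]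
      dist_triangle[of "x i" "x k" "y (j i)"] dist_triangle2[of "y (j i)" "x k" "y (j k)"] by simp
  have *: "dist (x i) (x k) + dist (x k) (x m) - (D + 6 * E) \<le> dist (x i) (x m)" if "i \<le> k" "k \<le> m" for i k m
    using D[of "j i" "j k" "j m"] monoD[OF j that(1)] monoD[OF j that(2)] xy[of i k] xy[of k m] xy[of i m] by linarith
  moreover have "D + 6 * E \<ge> 0" using *[of 0 0 0] by simp
  ultimately show thesis using that by blast
qed

text \<open>For \<open>n \<le> m\<close> the point \<open>x n\<close> almost lies between
  \<open>x 0\<close>, hence \<open>p\<close>, and \<open>x m\<close>; so the product of
  \<open>x n\<close> and \<open>x m\<close> is nearly \<open>dist (x n) p\<close>. Escape makes
  these products diverge, and the limit \<open>\<eta>\<close> inherits the estimate at the cost of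
  one more \<open>\<delta>\<close>. The last two conclusions drive everything that follows.\<close>

lemma rate_pos_boundary_point:
  assumes b: "backward_step_rate x > 0"
  obtains \<eta> D where "\<eta> \<in> gromov_boundary" "converges_to_bdry x \<eta>" "D \<ge> 0"
    "\<And>n m. dist (x n) (x (n + m)) - D \<le> dist (x (n + m)) p - dist (x n) p"
    "\<And>n. gp_ge (Inl (x n)) (Inr \<eta>) (dist (x n) p - D)"
proof -
  obtain D where D: "D \<ge> 0"
    "\<And>i k m. i \<le> k \<Longrightarrow> k \<le> m \<Longrightarrow> dist (x i) (x k) + dist (x k) (x m) - D \<le> dist (x i) (x m)"
    using rate_pos_almost_geodesic[OF b] by metis
  define d where "d = dist (x 0) p"
  have inc: "dist (x n) (x m) - (D + 2 * d) \<le> dist (x m) p - dist (x n) p" if "n \<le> m" for n m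
    using D(2)[OF _ that, of 0] dist_triangle2[of "x 0" "x m" p] dist_triangle3[of "x n" p "x 0"]
    unfolding d_def by simp
  have gp: "dist (x n) p - (D + 2 * d) \<le> gp (x n) (x m)" if "n \<le> m" for n m
    using inc[OF that] D(1) zero_le_dist[of "x 0" p] unfolding gromov_product_def d_def by argo
  have "\<exists>N. \<forall>m\<ge>N. \<forall>n\<ge>N. r \<le> gp (x m) (x n)" for r
  proof -
    obtain N where N: "\<forall>n\<ge>N. r + (D + 2 * d) \<le> dist (x n) p" using orbit_to_infinity by blast
    have "r \<le> gp (x m) (x n)" if "m \<ge> N" "n \<ge> N" for m n
    proof (cases "m \<le> n")
      case True
      then show ?thesis using gp[OF True] N that by force
    next
      case False
      then have "n \<le> m" by simp
      then show ?thesis using gp[OF \<open>n \<le> m\<close>] N that gromov_product_commute[of p "x m" "x n"] by force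
    qed
    then show ?thesis by blast
  qed
  then obtain \<eta> where e: "\<eta> \<in> gromov_boundary" "converges_to_bdry x \<eta>" using bdry_limit_exists[of x] by blast
  have gge: "gp_ge (Inl (x n)) (Inr \<eta>) (dist (x n) p - (D + 2 * d) - \<delta>)" for n
  proof -
    have "\<forall>\<^sub>F m in sequentially. gp_ge (Inl (x m)) (Inr \<eta>) (dist (x n) p - (D + 2 * d)) \<and> n \<le> m"
      using e(2) eventually_ge_at_top unfolding converges_to_bdry_iff by (auto intro: eventually_conj)
    then obtain m where m: "gp_ge (Inl (x m)) (Inr \<eta>) (dist (x n) p - (D + 2 * d))" "n \<le> m"
      using eventually_happens'[OF sequentially_bot] by blast
    have "gp_ge (Inl (x n)) (Inl (x m)) (dist (x n) p - (D + 2 * d))"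
      using gp[OF m(2)] unfolding gp_ge_def by auto
    then show ?thesis using m(1) by (rule gp_ge_trans)
  qed
  have "D + 2 * d + \<delta> \<ge> 0" using D(1) delta_pos unfolding d_def by simp
  moreover have "dist (x n) (x (n + m)) - (D + 2 * d + \<delta>) \<le> dist (x (n + m)) p - dist (x n) p" for n m
    using inc[of n "n + m"] delta_pos by simp
  moreover have "gp_ge (Inl (x n)) (Inr \<eta>) (dist (x n) p - (D + 2 * d + \<delta>))" for n
    using gge[of n] by (simp add: algebra_simps)
  ultimately show thesis using that e by blast
qed

text \<open>Each \<open>x n\<close> is near the ray point at parameter \<open>r n\<close>. These
  parameters grow by at most \<open>C\<close> per step and are unbounded, so beyond
  \<open>r 0\<close> every ray point has an orbit point nearby; \<open>f\<close> moves the latter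
  one step back along the orbit, hence the former by a bounded amount.\<close>

lemma shadowing_ray_imp_BRFP:
  assumes e: "\<eta> \<in> gromov_boundary" and D: "D \<ge> 0"
    and gge: "\<And>n. gp_ge (Inl (x n)) (Inr \<eta>) (dist (x n) p - D)"
  shows "in_geodesic_region x \<eta>" "BRFP p f \<eta>"
proof -
  obtain C where C: "C \<ge> 0" "\<And>n. dist (x n) (x (Suc n)) \<le> C"
    using step_bounded by (metis Suc_eq_plus1 mult.right_neutral of_nat_1)
  define r where "r n = max 0 (dist (x n) p - D)" for n
  have r0: "r n \<ge> 0" for n unfolding r_def by simp
  have near: "dist (x n) (rep \<eta> (r n)) \<le> D + 2 * \<delta>" for n
  proof (cases "dist (x n) p \<ge> D")
    case True
    then have "dist (x n) (rep \<eta> (dist (x n) p - D)) \<le> D + 2 * \<delta>" 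
      using gp_ge_imp_dist[OF e gge[of n]] by simp
    then show ?thesis using True unfolding r_def by simp
  next
    case False
    then show ?thesis using rep(2)[OF e] delta_pos unfolding r_def by simp
  qed
  have "infdist (x n) (rep \<eta> ` {0..}) < D + 2 * \<delta> + 1" for n
    using infdist_le[of "rep \<eta> (r n)" "rep \<eta> ` {0..}" "x n"] r0[of n] near[of n] by force
  then show "in_geodesic_region x \<eta>"
    unfolding in_geodesic_region_def geodesic_region_def
    using rep(3,4)[OF e] D delta_pos by (intro exI[of _ "rep \<eta>"] exI[of _ "D + 2 * \<delta> + 1"]) simp
  have rstep: "r (Suc n) \<le> r n + C" for n
    using C(1) C(2)[of n] dist_triangle3[of "x (Suc n)" p "x n"] unfolding r_def by simp
  have "dist (f (rep \<eta> t)) (rep \<eta> t) \<le> max (2 * r 0 + dist (f p) p) (2 * (D + 2 * \<delta> + C) + C)" if t: "t \<ge> 0" for t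
  proof (cases "t \<le> r 0")
    case True
    have "dist (rep \<eta> t) p = t" using rep_dist(2)[OF e t] .
    then show ?thesis
      using non_expandingD[OF f, of "rep \<eta> t" p] True dist_triangle[of "f (rep \<eta> t)" "rep \<eta> t" "f p"]
        dist_triangle2[of "f p" "rep \<eta> t" p] by simp
  next
    case False
    obtain N where "t + D \<le> dist (x N) p" using orbit_to_infinity by blast
    then have N: "t \<le> r N" unfolding r_def by simp
    \<comment> \<open>The first parameter to reach \<open>t\<close> overshoots it by at most one
      step, that is by \<open>C\<close>. As \<open>t > r 0\<close>, the index is a successor, so
      \<open>f (x n)\<close> is again an orbit point.\<close>
    define n where "n = (LEAST n. t \<le> r n)"
    have n: "t \<le> r n" unfolding n_def using N by (rule LeastI)
    then have "n \<noteq> 0" using False by (metis)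
    then obtain k where k: "n = Suc k" using not0_implies_Suc by blast
    then have "\<not> t \<le> r k" using not_less_Least[of k "\<lambda>n. t \<le> r n"] unfolding n_def by simp
    then have "\<bar>r n - t\<bar> \<le> C" using n rstep[of k] k by simp
    then have "dist (rep \<eta> (r n)) (rep \<eta> t) \<le> C" using rep_dist(1)[OF e r0 t] by simp
    then have xt: "dist (x n) (rep \<eta> t) \<le> D + 2 * \<delta> + C"
      using near[of n] dist_triangle[of "x n" "rep \<eta> t" "rep \<eta> (r n)"] by simp
    have "dist (f (rep \<eta> t)) (rep \<eta> t) \<le> dist (f (rep \<eta> t)) (f (x n)) + (dist (f (x n)) (x n) + dist (x n) (rep \<eta> t))"
      by (meson add_left_mono dist_triangle order_trans)
    moreover have "dist (f (rep \<eta> t)) (f (x n)) \<le> dist (x n) (rep \<eta> t)"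
      using non_expandingD[OF f, of "rep \<eta> t" "x n"] by (simp add: dist_commute)
    moreover have "dist (f (x n)) (x n) \<le> C" using C(2)[of k] unfolding k f_orbit .
    ultimately show ?thesis using xt by simp
  qed
  then show "BRFP p f \<eta>" by (rule bounded_displacement_BRFP[OF e f])
qed

text \<open>By \<open>horo_fibre_approx\<close> every horofunction over \<open>\<eta>\<close> is, at
  \<open>x n\<close>, within 1 of a normalised distance from some \<open>w\<close> near
  \<open>\<eta>\<close>. The large product of \<open>w\<close> and \<open>x n\<close> makes that
  value about \<open>- dist (x n) p\<close>.\<close>

lemma shadowing_ray_imp_horo:
  assumes e: "\<eta> \<in> gromov_boundary" and gge: "\<And>n. gp_ge (Inl (x n)) (Inr \<eta>) (dist (x n) p - D)"
    and a: "a \<in> horo_fibre \<eta>"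
  shows "filterlim (\<lambda>n. horofunction a p (x n)) at_bot sequentially"
proof -
  have bound: "horofunction a p (x n) \<le> - dist (x n) p + 2 * D + 2 * \<delta> + 1" for n
  proof -
    obtain w where w: "gp_ge (Inl w) (Inr \<eta>) (dist (x n) p - D)"
        "\<bar>(dist w (x n) - dist w p) - horofunction a p (x n)\<bar> < 1"
      using horo_fibre_approx[OF a, of "{x n}" 1 "dist (x n) p - D"] by auto
    have "gp_ge (Inl w) (Inl (x n)) (dist (x n) p - D - \<delta>)"
      by (rule gp_ge_trans[OF w(1) gp_ge_sym[OF gge]])
    then have "dist (x n) p - D - \<delta> \<le> gp w (x n)" unfolding gp_ge_def by auto
    then show ?thesis using w(2) dist_from_gp[of w "x n"] by linarith
  qed
  show ?thesis
    unfolding filterlim_at_bot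
  proof
    fix Z
    obtain N where N: "\<forall>n\<ge>N. 2 * D + 2 * \<delta> + 1 - Z \<le> dist (x n) p" using orbit_to_infinity by blast
    have "\<forall>n\<ge>N. horofunction a p (x n) \<le> Z" using N bound by (smt (verit))
    then show "\<forall>\<^sub>F n in sequentially. horofunction a p (x n) \<le> Z" unfolding eventually_sequentially by blast
  qed
qed

text \<open>What is left is that the rate is at most \<open>l\<close>. A geodesic from
  \<open>p\<close> to any \<open>z\<close> near \<open>\<eta>\<close> nearly passes through
  \<open>x (n + m)\<close>, which \<open>f ^^ m\<close> carries to \<open>x n\<close>; so
  \<open>z\<close> comes closer to \<open>p\<close> by almost \<open>dist (x n) (x (n + m))\<close>.
  Of the loss, \<open>D\<close> comes from \<open>inc\<close> and
  \<open>2 * D + 2 * \<delta>\<close> from the Gromov product.\<close>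

lemma shadowing_ray_imp_rate_eq:
  assumes B: "BRFP p f \<eta>" and x: "converges_to_bdry x \<eta>"
    and inc: "\<And>n m. dist (x n) (x (n + m)) - D \<le> dist (x (n + m)) p - dist (x n) p"
    and gge: "\<And>n. gp_ge (Inl (x n)) (Inr \<eta>) (dist (x n) p - D)"
  shows "log_stable_dilation p f \<eta> = ereal (backward_step_rate x)"
proof -
  have e: "\<eta> \<in> gromov_boundary" using B unfolding BRFP_def by auto
  obtain L l where L: "\<And>n. log_dilation p (f ^^ n) \<eta> = ereal (L n)" "log_stable_dilation p f \<eta> = ereal l"
    "\<And>n. \<bar>L n - l * real n\<bar> \<le> 24 * \<delta> + 3"
    using stable_dilation[OF B f] by metis
  have Lm: "\<sigma> m - (3 * D + 2 * \<delta>) \<le> L m" for m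
  proof -
    have "dist (x n) (x (n + m)) \<le> L m + (3 * D + 2 * \<delta>)" for n
    proof -
      have "ereal (dist (x n) (x (n + m)) - (3 * D + 2 * \<delta>)) \<le> log_dilation p (f ^^ m) \<eta>"
      proof (rule log_dilation_geI[OF e])
        fix z assume z: "gp_ge (Inl z) (Inr \<eta>) (dist (x (n + m)) p - D)"
        have "gp_ge (Inl z) (Inl (x (n + m))) (dist (x (n + m)) p - D - \<delta>)"
          by (rule gp_ge_trans[OF z gp_ge_sym[OF gge]])
        then have "dist (x (n + m)) p - D - \<delta> \<le> gp z (x (n + m))" unfolding gp_ge_def by auto
        moreover have "dist ((f ^^ m) z) (x n) \<le> dist z (x (n + m))"
          using non_expandingD[OF non_expanding_funpow[OF f, of m], of z "x (n + m)"] unfolding funpow_orbit .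
        moreover have "dist ((f ^^ m) z) p \<le> dist ((f ^^ m) z) (x n) + dist (x n) p" by (rule dist_triangle)
        ultimately show "dist (x n) (x (n + m)) - (3 * D + 2 * \<delta>) \<le> dist z p - dist ((f ^^ m) z) p"
          using inc[of n m] dist_from_gp[of z "x (n + m)"] by linarith
      qed
      then show ?thesis unfolding L(1) by simp
    qed
    then show ?thesis using step_leI[of m "L m + (3 * D + 2 * \<delta>)"] by simp
  qed
  have "backward_step_rate x \<le> l"
  proof (rule LIMSEQ_le[OF step_rate(1)])
    let ?K = "24 * \<delta> + 3 + (3 * D + 2 * \<delta>)"
    show "(\<lambda>m. l + ?K / real m) \<longlonglongrightarrow> l" using tendsto_add[OF tendsto_const lim_const_over_n[of ?K]] by simp
    have "\<sigma> m / real m \<le> l + ?K / real m" if "m \<ge> 1" for m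
    proof -
      have "\<sigma> m \<le> l * real m + ?K" using Lm[of m] L(3)[of m] by linarith
      then show ?thesis using that by (simp add: field_simps)
    qed
    then show "\<exists>N. \<forall>n\<ge>N. \<sigma> n / real n \<le> l + ?K / real n" by blast
  qed
  then show ?thesis using stable_dilation_le_rate[OF B x L(2)] L(2) by simp
qed

lemma rate_pos_imp_all:
  assumes b: "backward_step_rate x > 0"
  shows "\<exists>\<eta>. BRFP p f \<eta> \<and> converges_to_bdry x \<eta> \<and> in_geodesic_region x \<eta> \<and>
    (\<forall>a\<in>horo_fibre \<eta>. filterlim (\<lambda>n. horofunction a p (x n)) at_bot sequentially) \<and>
    ereal (backward_step_rate x) = log_stable_dilation p f \<eta>"
proof -
  obtain \<eta> D where e: "\<eta> \<in> gromov_boundary" and x: "converges_to_bdry x \<eta>" and D: "D \<ge> 0"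
    and inc: "\<And>n m. dist (x n) (x (n + m)) - D \<le> dist (x (n + m)) p - dist (x n) p"
    and gge: "\<And>n. gp_ge (Inl (x n)) (Inr \<eta>) (dist (x n) p - D)"
    using rate_pos_boundary_point[OF b] by metis
  note B = shadowing_ray_imp_BRFP[OF e D gge]
  show ?thesis
    using B x shadowing_ray_imp_horo[OF e gge] shadowing_ray_imp_rate_eq[OF B(2) x inc gge] by metis
qed

end

lemma filterlim_at_bot_imp_liminf:
  fixes u :: "nat \<Rightarrow> real"
  assumes "filterlim u at_bot sequentially" shows "liminf (\<lambda>n. ereal (u n)) = -\<infinity>"
proof (rule lim_imp_Liminf)
  show "((\<lambda>n. ereal (u n)) \<longlongrightarrow> -\<infinity>) sequentially"
    using assms unfolding tendsto_MInfty filterlim_at_bot_dense by simp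
qed simp

theorem proposition6p3:
  fixes f :: "'a::heine_borel \<Rightarrow> 'a" and p :: 'a and x :: "nat \<Rightarrow> 'a"
  assumes "geodesic_space TYPE('a)"
    and "gromov_hyperbolic TYPE('a)"
    and "non_expanding f"
    and "backward_orbit f x"
    and "escaping x"
    and "bounded_step x"
  shows
    "(backward_step_rate x > 0 \<longleftrightarrow> discrete_quasi_geodesic_ray x) \<and>
     (backward_step_rate x > 0 \<longleftrightarrow>
        (\<exists>\<eta>. BRFP p f \<eta> \<and> converges_to_bdry x \<eta> \<and> in_geodesic_region x \<eta>)) \<and>
     (backward_step_rate x > 0 \<longleftrightarrow>
        (\<exists>\<eta>. BRFP p f \<eta> \<and> converges_to_bdry x \<eta> \<and>
          (\<forall>a\<in>horo_fibre \<eta>. filterlim (\<lambda>n. horofunction a p (x n)) at_bot sequentially))) \<and>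
     (backward_step_rate x > 0 \<longleftrightarrow>
        (\<exists>\<eta>. BRFP p f \<eta> \<and> converges_to_bdry x \<eta> \<and>
          (\<forall>a\<in>horo_fibre \<eta>. liminf (\<lambda>n. ereal (horofunction a p (x n))) = -\<infinity>))) \<and>
     (backward_step_rate x > 0 \<longleftrightarrow>
        (\<exists>\<eta>. repelling_BRFP p f \<eta> \<and> converges_to_bdry x \<eta>)) \<and>
     (backward_step_rate x > 0 \<longleftrightarrow>
        (\<exists>\<eta>. repelling_BRFP p f \<eta> \<and> converges_to_bdry x \<eta> \<and>
          ereal (backward_step_rate x) = log_stable_dilation p f \<eta>))"
proof -
  obtain \<delta> where "\<delta> > 0"
    "\<And>q x y z::'a. min (gromov_product q x y) (gromov_product q y z) - \<delta> \<le> gromov_product q x z"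
    using gromov_hyperbolic_four_point[OF assms(1,2)] by blast
  then interpret bounded_backward_orbit \<delta> p f x
    using assms by unfold_locales auto
  let ?b = "backward_step_rate x"
  \<comment> \<open>The boundary point is repelling because its logarithmic stable dilation equals
    the positive rate.\<close>
  have all: "\<exists>\<eta>. BRFP p f \<eta> \<and> converges_to_bdry x \<eta> \<and> in_geodesic_region x \<eta> \<and>
    (\<forall>a\<in>horo_fibre \<eta>. filterlim (\<lambda>n. horofunction a p (x n)) at_bot sequentially) \<and>
    ereal ?b = log_stable_dilation p f \<eta> \<and> repelling_BRFP p f \<eta>" if b: "?b > 0"
    using rate_pos_imp_all[OF b] b unfolding repelling_BRFP_def by (metis ereal_less(2))
  show ?thesis
  proof (intro conjI iffI)
    show "discrete_quasi_geodesic_ray x" if "?b > 0" using that by (rule rate_pos_imp_quasi_geodesic)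
    show "?b > 0" if "discrete_quasi_geodesic_ray x" using that by (rule quasi_geodesic_imp_rate_pos)
    show "\<exists>\<eta>. BRFP p f \<eta> \<and> converges_to_bdry x \<eta> \<and> in_geodesic_region x \<eta>" if "?b > 0"
      using all[OF that] by blast
    show "?b > 0" if "\<exists>\<eta>. BRFP p f \<eta> \<and> converges_to_bdry x \<eta> \<and> in_geodesic_region x \<eta>"
      using that geodesic_region_imp_rate_pos by blast
    show "\<exists>\<eta>. BRFP p f \<eta> \<and> converges_to_bdry x \<eta> \<and>
        (\<forall>a\<in>horo_fibre \<eta>. filterlim (\<lambda>n. horofunction a p (x n)) at_bot sequentially)" if "?b > 0"
      using all[OF that] by blast
    show *: "?b > 0" if "\<exists>\<eta>. BRFP p f \<eta> \<and> converges_to_bdry x \<eta> \<and>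
        (\<forall>a\<in>horo_fibre \<eta>. liminf (\<lambda>n. ereal (horofunction a p (x n))) = -\<infinity>)"
      using that horofunction_unbounded_imp_rate_pos by blast
    show "?b > 0" if "\<exists>\<eta>. BRFP p f \<eta> \<and> converges_to_bdry x \<eta> \<and>
        (\<forall>a\<in>horo_fibre \<eta>. filterlim (\<lambda>n. horofunction a p (x n)) at_bot sequentially)"
      using that filterlim_at_bot_imp_liminf by (intro *) blast
    show "\<exists>\<eta>. BRFP p f \<eta> \<and> converges_to_bdry x \<eta> \<and>
        (\<forall>a\<in>horo_fibre \<eta>. liminf (\<lambda>n. ereal (horofunction a p (x n))) = -\<infinity>)" if "?b > 0"
      using all[OF that] filterlim_at_bot_imp_liminf by blast
    show "\<exists>\<eta>. repelling_BRFP p f \<eta> \<and> converges_to_bdry x \<eta>" if "?b > 0"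
      using all[OF that] by blast
    show "?b > 0" if "\<exists>\<eta>. repelling_BRFP p f \<eta> \<and> converges_to_bdry x \<eta>"
      using that repelling_imp_rate_pos by blast
    show "\<exists>\<eta>. repelling_BRFP p f \<eta> \<and> converges_to_bdry x \<eta> \<and> ereal ?b = log_stable_dilation p f \<eta>" if "?b > 0"
      using all[OF that] by blast
    show "?b > 0" if "\<exists>\<eta>. repelling_BRFP p f \<eta> \<and> converges_to_bdry x \<eta> \<and> ereal ?b = log_stable_dilation p f \<eta>"
      using that repelling_imp_rate_pos by blast
  qed
qed

end
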